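(* Let $\Omega\subset\mathbb{R}^n$ be a (nonempty) open and bounded set. Let $K:\mathbb{R}^n\setminus\{0\}\to(0,+\infty)$ be a measurable function such that $mK\in L^1(\mathbb{R}^n)$, where $m(x)=\min\{|x|^2,1\}$, and such that there exist $\theta>0$ and $\sigma\in(0,1)$ with $K(x)\ge\theta|x|^{-(n+2\sigma)}$ for all $x\in\mathbb{R}^n\setminus\{0\}$. Let $f:\Omega\times\mathbb{R}\to\mathbb{R}$ be a Carathéodory function for which there exist $a\in L^2(\Omega)$ and $b\ge 0$ with $|f(x,t)|\le a(x)+b|t|$ for a.e. $x\in\Omega$ and all $t\in\mathbb{R}$. For a.e. $x\in\Omega$ set $$\underline{\alpha}(x):=\liminf_{|t|\to\infty}\frac{f(x,t)}{t},\qquad \overline{\alpha}(x):=\limsup_{|t|\to\infty}\frac{f(x,t)}{t}.$$ Let $\lambda_1<\lambda_2\le\lambda_3\le\dots$ be the eigenvalues of $-\mathcal L_K$ in $Z$ (defined in the context). Assume that either $\overline{\alpha}(x)<\lambda_1$ for a.e. $x\in\Omega$, or there exists an integer $h\ge1$ such that $\lambda_h<\underline{\alpha}(x)\le\overline{\alpha}(x)<\lambda_{h+1}$ for a.e. $x\in\Omega$. Assume in addition that there exists an integer $k\ge1$ such that, for a.e. $x\in\Omega$, $$\lambda_k<\frac{f(x,s)-f(x,t)}{s-t}<\lambda_{k+1}\quad\text{for all } s,t\in\mathbb{R}\text{ with } s\ne t.$$ Then there is exactly one $u\in Z$ such that $$\int_Q (u(x)-u(y))(\varphi(x)-\varphi(y))K(x-y)\,dx\,dy=\int_\Omega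 f(x,u(x))\varphi(x)\,dx\quad\text{for every }\varphi\in Z.$$
   Context: Notation: $\mathcal{C}\Omega=\mathbb{R}^n\setminus\Omega$ and $Q:=\mathbb{R}^{2n}\setminus(\mathcal{C}\Omega\times\mathcal{C}\Omega)$. $X$ is the linear space of Lebesgue measurable functions $u:\mathbb{R}^n\to\mathbb{R}$ (identified when equal a.e.) such that $(x,y)\mapsto (u(x)-u(y))^2K(x-y)$ is in $L^1(Q,dx\,dy)$, with norm $\|u\|_X=\big(\int_\Omega|u|^2dx+\int_Q|u(x)-u(y)|^2K(x-y)\,dx\,dy\big)^{1/2}$. $Z$ is the closure in $X$ of $C_0^\infty(\Omega)$ (smooth functions with compact support in $\Omega$, extended by $0$ to $\mathbb{R}^n$). $Z$ is a Hilbert space with scalar product $\langle u,v\rangle_Z=\int_Q(u(x)-u(y))(v(x)-v(y))K(x-y)\,dx\,dy$ and norm $\|u\|_Z=\langle u,u\rangle_Z^{1/2}$, which is equivalent to $\|\cdot\|_X$ on $Z$; $Z$ is compactly embedded in $L^2(\Omega)$. Eigenvalues: $\lambda\in\mathbb{R}$ is an eigenvalue of $-\mathcal L_K$ if there is $e\in Z\setminus\{0\}$ with $\langle e,\varphi\rangle_Z=\lambda\int_\Omega e\varphi\,dx$ for all $\varphi\in Z$; then $e$ is an eigenfunction. The eigenvalues, repeated according to multiplicity, form a sequence $0<\lambda_1<\lambda_2\le\lambda_3\le\dots$ with $\sup_j\lambda_j=+\infty$. Carathéodory: $f(\cdot,t)$ is measurable for each $t$ and $f(x,\cdot)$ is continuous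 for a.e. $x$. *)

theory Defs
  imports "HOL-Analysis.Analysis"
begin

text \<open>Elements of the function spaces below are honest functions on \<open>\<real>\<^sup>n\<close>; the identification of
  functions that agree almost everywhere is made explicit (by \<open>AE\<close>) wherever it matters.\<close>

primrec Ck :: "nat \<Rightarrow> (real ^ 'n::finite \<Rightarrow> real) \<Rightarrow> bool" where
  "Ck 0 f \<longleftrightarrow> continuous_on UNIV f"
| "Ck (Suc k) f \<longleftrightarrow> f differentiable_on UNIV \<and>
     (\<forall>i. Ck k (\<lambda>x. frechet_derivative f (at x) (axis i 1)))"

definition smooth :: "(real ^ 'n::finite \<Rightarrow> real) \<Rightarrow> bool" where
  "smooth f \<longleftrightarrow> (\<forall>k. Ck k f)"

definition test_functions :: "(real ^ 'n::finite) set \<Rightarrow> (real ^ 'n \<Rightarrow> real) set" where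
  "test_functions \<Omega> = {\<phi>. smooth \<phi> \<and> compact (closure {x. \<phi> x \<noteq> 0}) \<and> closure {x. \<phi> x \<noteq> 0} \<subseteq> \<Omega>}"

definition Q_set :: "'a set \<Rightarrow> ('a \<times> 'a) set" where
  "Q_set \<Omega> = - ((- \<Omega>) \<times> (- \<Omega>))"

definition X_space ::
    "(real ^ 'n::finite) set \<Rightarrow> (real ^ 'n \<Rightarrow> real) \<Rightarrow> (real ^ 'n \<Rightarrow> real) set" where
  "X_space \<Omega> K = {u. u \<in> borel_measurable lebesgue \<and>
     integrable (lebesgue_on (Q_set \<Omega>)) (\<lambda>(x, y). (u x - u y)\<^sup>2 * K (x - y))}"

text \<open>For bounded \<open>\<Omega>\<close> and kernels with \<open>K x \<ge> \<theta> |x| powr - (n + 2 \<sigma>)\<close>, the kernel is bounded below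
  on \<open>\<Omega> \<times> \<Omega>\<close>, so every \<open>u\<close> in \<^term>\<open>X_space \<Omega> K\<close> is square integrable on \<open>\<Omega>\<close> and both integrals
  below are proper.\<close>

definition norm_X ::
    "(real ^ 'n::finite) set \<Rightarrow> (real ^ 'n \<Rightarrow> real) \<Rightarrow> (real ^ 'n \<Rightarrow> real) \<Rightarrow> real" where
  "norm_X \<Omega> K u = sqrt ((\<integral>x. \<bar>u x\<bar>\<^sup>2 \<partial>lebesgue_on \<Omega>) +
     (\<integral>(x, y). \<bar>u x - u y\<bar>\<^sup>2 * K (x - y) \<partial>lebesgue_on (Q_set \<Omega>)))"

definition Z_space ::
    "(real ^ 'n::finite) set \<Rightarrow> (real ^ 'n \<Rightarrow> real) \<Rightarrow> (real ^ 'n \<Rightarrow> real) set" where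
  "Z_space \<Omega> K = {u \<in> X_space \<Omega> K.
     \<forall>\<epsilon>>0. \<exists>\<phi>\<in>test_functions \<Omega>. norm_X \<Omega> K (\<lambda>x. u x - \<phi> x) < \<epsilon>}"

definition inner_Z ::
    "(real ^ 'n::finite) set \<Rightarrow> (real ^ 'n \<Rightarrow> real) \<Rightarrow> (real ^ 'n \<Rightarrow> real) \<Rightarrow> (real ^ 'n \<Rightarrow> real) \<Rightarrow> real"
  where
  "inner_Z \<Omega> K u v =
     (\<integral>(x, y). (u x - u y) * (v x - v y) * K (x - y) \<partial>lebesgue_on (Q_set \<Omega>))"

definition eigenspace ::
    "(real ^ 'n::finite) set \<Rightarrow> (real ^ 'n \<Rightarrow> real) \<Rightarrow> real \<Rightarrow> (real ^ 'n \<Rightarrow> real) set" where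
  "eigenspace \<Omega> K \<mu> = {e \<in> Z_space \<Omega> K.
     \<forall>\<phi>\<in>Z_space \<Omega> K. inner_Z \<Omega> K e \<phi> = \<mu> * (\<integral>x. e x * \<phi> x \<partial>lebesgue_on \<Omega>)}"

definition is_eigenvalue :: "(real ^ 'n::finite) set \<Rightarrow> (real ^ 'n \<Rightarrow> real) \<Rightarrow> real \<Rightarrow> bool" where
  "is_eigenvalue \<Omega> K \<mu> \<longleftrightarrow> (\<exists>e\<in>eigenspace \<Omega> K \<mu>. \<not> (AE x in lebesgue. e x = 0))"

text \<open>\<open>has_ae_dim E m\<close>: the linear space \<open>E\<close>, modulo equality almost everywhere, has a basis of
  \<open>m\<close> elements.\<close>

definition has_ae_dim :: "('a::euclidean_space \<Rightarrow> real) set \<Rightarrow> nat \<Rightarrow> bool" where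
  "has_ae_dim E m \<longleftrightarrow> (\<exists>e :: nat \<Rightarrow> 'a \<Rightarrow> real.
     (\<forall>i<m. e i \<in> E) \<and>
     (\<forall>c :: nat \<Rightarrow> real. (AE x in lebesgue. (\<Sum>i<m. c i * e i x) = 0) \<longrightarrow> (\<forall>i<m. c i = 0)) \<and>
     (\<forall>v\<in>E. \<exists>c :: nat \<Rightarrow> real. AE x in lebesgue. v x = (\<Sum>i<m. c i * e i x)))"

text \<open>\<open>lam 1 \<le> lam 2 \<le> \<dots>\<close> lists exactly the eigenvalues, each one repeated according to its
  multiplicity; \<open>lam 0\<close> is irrelevant. These conditions determine \<open>lam j\<close> for all \<open>j \<ge> 1\<close>.\<close>

definition eigenvalue_sequence ::
    "(real ^ 'n::finite) set \<Rightarrow> (real ^ 'n \<Rightarrow> real) \<Rightarrow> (nat \<Rightarrow> real) \<Rightarrow> bool" where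
  "eigenvalue_sequence \<Omega> K lam \<longleftrightarrow>
     (\<forall>i\<ge>1. \<forall>j\<ge>i. lam i \<le> lam j) \<and>
     (\<forall>j\<ge>1. is_eigenvalue \<Omega> K (lam j)) \<and>
     (\<forall>\<mu>. is_eigenvalue \<Omega> K \<mu> \<longrightarrow>
        finite {j. 1 \<le> j \<and> lam j = \<mu>} \<and>
        has_ae_dim (eigenspace \<Omega> K \<mu>) (card {j. 1 \<le> j \<and> lam j = \<mu>}))"

definition caratheodory :: "'a::euclidean_space set \<Rightarrow> ('a \<Rightarrow> real \<Rightarrow> real) \<Rightarrow> bool" where
  "caratheodory \<Omega> f \<longleftrightarrow>
     (\<forall>t. (\<lambda>x. f x t) \<in> borel_measurable (lebesgue_on \<Omega>)) \<and>
     (AE x in lebesgue_on \<Omega>. continuous_on UNIV (f x))"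

text \<open>On the real line the filter \<^const>\<open>at_infinity\<close> expresses \<open>|t| \<rightarrow> \<infinity>\<close>.\<close>

definition alpha_lower :: "('a \<Rightarrow> real \<Rightarrow> real) \<Rightarrow> 'a \<Rightarrow> ereal" where
  "alpha_lower f x = Liminf at_infinity (\<lambda>t. ereal (f x t / t))"

definition alpha_upper :: "('a \<Rightarrow> real \<Rightarrow> real) \<Rightarrow> 'a \<Rightarrow> ereal" where
  "alpha_upper f x = Limsup at_infinity (\<lambda>t. ereal (f x t / t))"

definition weak_solution ::
    "(real ^ 'n::finite) set \<Rightarrow> (real ^ 'n \<Rightarrow> real) \<Rightarrow> (real ^ 'n \<Rightarrow> real \<Rightarrow> real) \<Rightarrow>
     (real ^ 'n \<Rightarrow> real) \<Rightarrow> bool" where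
  "weak_solution \<Omega> K f u \<longleftrightarrow> u \<in> Z_space \<Omega> K \<and>
     (\<forall>\<phi>\<in>Z_space \<Omega> K.
        (\<integral>(x, y). (u x - u y) * (\<phi> x - \<phi> y) * K (x - y) \<partial>lebesgue_on (Q_set \<Omega>)) =
        (\<integral>x. f x (u x) * \<phi> x \<partial>lebesgue_on \<Omega>))"

end

theory Submission
  imports Defs "HOL-Library.Function_Algebras" "HOL-Library.Diagonal_Subsequence"
begin

text \<open>Let \<open>L\<close> be the operator of the form \<open>\<langle>u, v\<rangle>\<^sub>Z\<close>. Comparing the slopes of \<open>f\<close> with its
  asymptotic slopes excludes the first alternative and forces \<open>h = k\<close>. Let \<open>m\<close> be the midpoint and \<open>d\<close>
  half the length of the gap between \<open>\<lambda>\<^sub>k\<close> and \<open>\<lambda>\<^sub>k\<^sub>+\<^sub>1\<close>; the equation reads \<open>(L - m) u = g(x, u)\<close>, where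
  \<open>g(x, t) = f(x, t) - m t\<close> satisfies \<open>\<bar>g(x, s) - g(x, t)\<bar> < d \<bar>s - t\<bar>\<close> for \<open>s \<noteq> t\<close>. The inverse of \<open>L\<close> is
  compact and selfadjoint on \<open>L\<^sup>2(\<Omega>)\<close> and \<open>L\<close> has no eigenvalue inside the gap, hence
  \<open>\<parallel>(L - m) u\<parallel> \<ge> d \<parallel>u\<parallel>\<close>, which gives uniqueness. For existence, \<open>u \<mapsto> (L - m)\<^sup>-\<^sup>1 (s g(x, u))\<close> is a
  contraction whenever \<open>0 \<le> s < 1\<close>; since the slope of \<open>g\<close> at infinity is pointwise below \<open>d\<close>, the fixed
  points stay bounded as \<open>s \<rightarrow> 1\<close>, and a limit point of them is the solution.\<close>

section \<open>Hilbert spaces given by a semi-inner product\<close>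

text \<open>The strict slope inequalities hold pointwise and without a uniform margin, so for
  \<open>u \<mapsto> g(x, u)\<close> on the \<open>L2\<close> space no Lipschitz constant below
  \<open>d\<close> is available in general. At \<open>s = 1\<close> the iterated map is therefore
  only nonexpansive, which is what makes the damping necessary. Uniqueness does not suffer: it uses
  that equality in an integrated inequality forces equality pointwise.

  The bound on \<open>L - m\<close> is not read off an eigenfunction expansion. With
  \<open>S\<close> the inverse of \<open>L\<close> and \<alpha>, \<beta> the ends of the gap, it
  amounts to nonnegativity of the form of \<open>(1 - \<alpha> S) (1 - \<beta> S)\<close>, which
  minimisation and compactness provide; the list of eigenvalues then matters only through the
  positivity of its members and the absence of eigenvalues inside the gap.

  Functions are not replaced by classes and \<open>S\<close> is obtained by choice. Hence all linear
  algebra is done modulo vectors of length 0, and symmetry of \<open>S\<close> stands in for its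
  linearity.

  That members of \<open>Z\<close> vanish off \<Omega>, the Poincare inequality and compactness all
  come from lower bounds of the kernel on bounded sets of pairs.\<close>

lemma quadratic_nonneg_imp_linear_zero:
  fixes p q :: real
  assumes "\<And>t. 2 * t * p + t\<^sup>2 * q \<ge> 0" and "q \<ge> 0"
  shows "p = 0"
proof (rule ccontr)
  assume "p \<noteq> 0"
  \<comment> \<open>The parabola has its minimum at \<open>- p / q\<close>; the denominator
    \<open>q + 1\<close> serves as well and survives \<open>q = 0\<close>.\<close>
  define t where "t = - p / (q + 1)"
  have p: "p = - t * (q + 1)" using assms(2) by (simp add: t_def)
  with \<open>p \<noteq> 0\<close> have "t \<noteq> 0" by auto
  have "2 * t * p + t\<^sup>2 * q = - (t\<^sup>2 * (q + 2))"
    by (simp add: p power2_eq_square algebra_simps)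
  moreover have "t\<^sup>2 * (q + 2) > 0" using \<open>t \<noteq> 0\<close> assms(2) by simp
  ultimately show False using assms(1)[of t] by linarith
qed

text \<open>Vectors of length \<open>0\<close> are not identified with \<open>0\<close>, as the vectors will be functions; all
  equations between vectors are therefore stated as \<open>nrm (u - v) = 0\<close>.\<close>

locale semi_hilbert =
  fixes V :: "'v::real_vector set" and ip :: "'v \<Rightarrow> 'v \<Rightarrow> real"
  assumes subspace: "subspace V"
    and ip_add_left: "\<And>u v w. u \<in> V \<Longrightarrow> v \<in> V \<Longrightarrow> w \<in> V \<Longrightarrow> ip (u + v) w = ip u w + ip v w"
    and ip_scale_left: "\<And>r u w. u \<in> V \<Longrightarrow> w \<in> V \<Longrightarrow> ip (r *\<^sub>R u) w = r * ip u w"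
    and ip_commute: "\<And>u v. u \<in> V \<Longrightarrow> v \<in> V \<Longrightarrow> ip u v = ip v u"
    and ip_nonneg: "\<And>u. u \<in> V \<Longrightarrow> ip u u \<ge> 0"
    and ip_complete: "\<And>x. (\<And>n. x n \<in> V) \<Longrightarrow>
        (\<And>e. e > 0 \<Longrightarrow> \<exists>N. \<forall>m\<ge>N. \<forall>n\<ge>N. ip (x m - x n) (x m - x n) < e) \<Longrightarrow>
        \<exists>l\<in>V. (\<lambda>n. ip (x n - l) (x n - l)) \<longlonglongrightarrow> 0"
begin

definition nrm :: "'v \<Rightarrow> real" where "nrm u = sqrt (ip u u)"

lemma zero_in [simp, intro]: "0 \<in> V"
  and add_in [simp, intro]: "u \<in> V \<Longrightarrow> v \<in> V \<Longrightarrow> u + v \<in> V"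
  and diff_in [simp, intro]: "u \<in> V \<Longrightarrow> v \<in> V \<Longrightarrow> u - v \<in> V"
  and scale_in [simp, intro]: "u \<in> V \<Longrightarrow> r *\<^sub>R u \<in> V"
  using subspace by (auto intro: subspace_0 subspace_add subspace_diff subspace_scale)

lemma ip_diff_left: "u \<in> V \<Longrightarrow> v \<in> V \<Longrightarrow> w \<in> V \<Longrightarrow> ip (u - v) w = ip u w - ip v w"
  using ip_add_left[of "u - v" v w] by simp

lemma ip_add_right: "u \<in> V \<Longrightarrow> v \<in> V \<Longrightarrow> w \<in> V \<Longrightarrow> ip w (u + v) = ip w u + ip w v"
  by (simp add: ip_commute[of w] ip_add_left)

lemma ip_diff_right: "u \<in> V \<Longrightarrow> v \<in> V \<Longrightarrow> w \<in> V \<Longrightarrow> ip w (u - v) = ip w u - ip w v"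
  by (simp add: ip_commute[of w] ip_diff_left)

lemma ip_scale_right: "u \<in> V \<Longrightarrow> w \<in> V \<Longrightarrow> ip w (r *\<^sub>R u) = r * ip w u"
  by (simp add: ip_commute[of w] ip_scale_left)

lemmas ip_bilinear = ip_add_left ip_diff_left ip_scale_left ip_add_right ip_diff_right ip_scale_right

lemma nrm_nonneg [simp]: "u \<in> V \<Longrightarrow> nrm u \<ge> 0"
  by (simp add: nrm_def ip_nonneg)

lemma nrm_squared: "u \<in> V \<Longrightarrow> (nrm u)\<^sup>2 = ip u u"
  by (simp add: nrm_def ip_nonneg)

lemma cauchy_schwarz:
  assumes u: "u \<in> V" and v: "v \<in> V"
  shows "\<bar>ip u v\<bar> \<le> nrm u * nrm v"
proof -
  have exp: "0 \<le> ip u u - 2 * t * ip u v + t\<^sup>2 * ip v v" for t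
    using ip_nonneg[of "u - t *\<^sub>R v"] u v
    by (simp add: ip_bilinear ip_commute[OF v u] power2_eq_square algebra_simps)
  have "(ip u v)\<^sup>2 \<le> ip u u * ip v v"
  proof (cases "ip v v = 0")
    case True
    \<comment> \<open>A semidefinite form allows \<open>ip v v = 0\<close> for nonzero
      \<open>v\<close>. Then \<open>exp\<close> is affine in \<open>t\<close>, and the
      \<open>t\<close> used below gives it the value -1.\<close>
    have "ip u v = 0"
    proof (rule ccontr)
      assume "ip u v \<noteq> 0"
      then show False using exp[of "(ip u u + 1) / (2 * ip u v)"] True by simp
    qed
    then show ?thesis using True by simp
  next
    case False
    then have pos: "ip v v > 0" using ip_nonneg[OF v] by simp
    have "0 \<le> ip u u - (ip u v)\<^sup>2 / ip v v"
      using exp[of "ip u v / ip v v"] pos by (simp add: power2_eq_square field_simps)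
    then show ?thesis using pos by (simp add: field_simps)
  qed
  then have "(ip u v)\<^sup>2 \<le> (nrm u * nrm v)\<^sup>2"
    using u v by (simp add: power_mult_distrib nrm_squared)
  then show ?thesis using u v by (intro power2_le_imp_le[where x = "\<bar>ip u v\<bar>"]) auto
qed

lemma nrm_triangle: assumes u: "u \<in> V" and v: "v \<in> V" shows "nrm (u + v) \<le> nrm u + nrm v"
proof (rule power2_le_imp_le)
  have "(nrm (u + v))\<^sup>2 = (nrm u)\<^sup>2 + 2 * ip u v + (nrm v)\<^sup>2"
    using u v by (simp add: nrm_squared ip_bilinear ip_commute[OF v u])
  also have "\<dots> \<le> (nrm u + nrm v)\<^sup>2"
    using cauchy_schwarz[OF u v] by (simp add: power2_sum)
  finally show "(nrm (u + v))\<^sup>2 \<le> (nrm u + nrm v)\<^sup>2" .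
qed (use u v in auto)

lemma nrm_scale: "u \<in> V \<Longrightarrow> nrm (r *\<^sub>R u) = \<bar>r\<bar> * nrm u"
  by (simp add: nrm_def ip_bilinear real_sqrt_mult flip: mult.assoc power2_eq_square)

lemma nrm_zero [simp]: "nrm 0 = 0"
  using nrm_scale[of 0 0] by simp

lemma nrm_diff_commute: "u \<in> V \<Longrightarrow> v \<in> V \<Longrightarrow> nrm (u - v) = nrm (v - u)"
  using nrm_scale[of "u - v" "-1"] by simp

lemma nrm_triangle_diff: "u \<in> V \<Longrightarrow> v \<in> V \<Longrightarrow> w \<in> V \<Longrightarrow> nrm (u - w) \<le> nrm (u - v) + nrm (v - w)"
  using nrm_triangle[of "u - v" "v - w"] by simp

lemma nrm_diff_le: "u \<in> V \<Longrightarrow> v \<in> V \<Longrightarrow> nrm (u - v) \<le> nrm u + nrm v"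
  using nrm_triangle_diff[of u 0 v] nrm_diff_commute[of 0 v] by simp

lemma nrm_le_add_diff: "u \<in> V \<Longrightarrow> v \<in> V \<Longrightarrow> nrm u \<le> nrm v + nrm (u - v)"
  using nrm_triangle[of v "u - v"] by simp

lemma nrm_cong_null: "u \<in> V \<Longrightarrow> v \<in> V \<Longrightarrow> nrm (u - v) = 0 \<Longrightarrow> nrm u = nrm v"
  using nrm_le_add_diff[of u v] nrm_le_add_diff[of v u] nrm_diff_commute[of u v] by simp

text \<open>Cauchy-Schwarz puts vectors of length 0 into the radical of the form, so
  \<open>ip\<close> passes to the quotient; all later rewriting modulo null functions rests on
  this.\<close>

lemma ip_null: "u \<in> V \<Longrightarrow> v \<in> V \<Longrightarrow> nrm u = 0 \<Longrightarrow> ip u v = 0"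
  using cauchy_schwarz[of u v] by simp

lemma ip_cong_null: "u \<in> V \<Longrightarrow> v \<in> V \<Longrightarrow> w \<in> V \<Longrightarrow> nrm (u - v) = 0 \<Longrightarrow> ip u w = ip v w"
  using ip_null[of "u - v" w] by (simp add: ip_bilinear)

lemma nrm_complete:
  assumes x: "\<And>n. x n \<in> V"
    and cauchy: "\<And>e. e > 0 \<Longrightarrow> \<exists>N. \<forall>m\<ge>N. \<forall>n\<ge>N. nrm (x m - x n) < e"
  shows "\<exists>l\<in>V. (\<lambda>n. nrm (x n - l)) \<longlonglongrightarrow> 0"
proof -
  have "\<exists>N. \<forall>m\<ge>N. \<forall>n\<ge>N. ip (x m - x n) (x m - x n) < e" if e: "e > 0" for e
  proof -
    obtain N where N: "\<forall>m\<ge>N. \<forall>n\<ge>N. nrm (x m - x n) < sqrt e"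
      using cauchy[of "sqrt e"] e by auto
    show ?thesis using N by (intro exI[of _ N]) (auto simp: nrm_def)
  qed
  then obtain l where "l \<in> V" and l: "(\<lambda>n. ip (x n - l) (x n - l)) \<longlonglongrightarrow> 0"
    using ip_complete[of x] x by blast
  then show ?thesis using tendsto_real_sqrt[OF l] by (auto simp: nrm_def)
qed

lemma ip_tendsto:
  assumes "\<And>n. x n \<in> V" "l \<in> V" "v \<in> V" "(\<lambda>n. nrm (x n - l)) \<longlonglongrightarrow> 0"
  shows "(\<lambda>n. ip (x n) v) \<longlonglongrightarrow> ip l v"
proof -
  have "(\<lambda>n. ip (x n - l) v) \<longlonglongrightarrow> 0"
  proof (rule Lim_null_comparison)
    show "eventually (\<lambda>n. norm (ip (x n - l) v) \<le> nrm (x n - l) * nrm v) sequentially"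
      using assms cauchy_schwarz by auto
    show "(\<lambda>n. nrm (x n - l) * nrm v) \<longlonglongrightarrow> 0" using assms(4) by (rule tendsto_mult_left_zero)
  qed
  then show ?thesis
    using assms by (simp add: ip_bilinear LIM_zero_iff)
qed

text \<open>Direct method: the representing vector is the limit of a minimising sequence of
  \<open>J\<close>, whose first variation at \<open>u\<close> in direction \<open>v\<close> is
  \<open>2 * (ip u v - F v)\<close>. This avoids orthogonal complements modulo null vectors.\<close>

lemma riesz:
  assumes F_add: "\<And>u v. u \<in> V \<Longrightarrow> v \<in> V \<Longrightarrow> F (u + v) = F u + F v"
    and F_scale: "\<And>r u. u \<in> V \<Longrightarrow> F (r *\<^sub>R u) = r * F u"
    and F_bound: "\<And>v. v \<in> V \<Longrightarrow> \<bar>F v\<bar> \<le> C * nrm v"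
  shows "\<exists>u\<in>V. \<forall>v\<in>V. ip u v = F v"
proof -
  define J where "J v = ip v v - 2 * F v" for v
  define m where "m = Inf (J ` V)"
  have "J v \<ge> - C\<^sup>2" if "v \<in> V" for v
  proof -
    have "J v \<ge> (nrm v)\<^sup>2 - 2 * (C * nrm v)"
      using F_bound[OF that] that by (simp add: J_def nrm_squared)
    moreover have "0 \<le> (nrm v - C)\<^sup>2" by simp
    ultimately show ?thesis by (simp add: power2_diff algebra_simps)
  qed
  then have bdd: "bdd_below (J ` V)" by (auto intro!: bdd_belowI[of _ "- C\<^sup>2"])
  then have m_le: "m \<le> J v" if "v \<in> V" for v
    using that by (auto simp: m_def intro: cInf_lower)
  have "\<exists>v\<in>V. J v < m + 1 / Suc n" for n
    using cInf_lessD[of "J ` V" "m + 1 / Suc n"] by (fastforce simp: m_def)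
  then obtain x where x: "\<And>n. x n \<in> V" and Jx: "\<And>n. J (x n) < m + 1 / Suc n" by metis
  \<comment> \<open>Parallelogram law in which the terms with the linear \<open>F\<close> cancel:
    two almost minimal vectors are close because their midpoint cannot go below
    \<open>m\<close>.\<close>
  have half: "ip (u - v) (u - v) = 2 * J u + 2 * J v - 4 * J ((1/2) *\<^sub>R (u + v))"
    if "u \<in> V" "v \<in> V" for u v
    using that by (simp add: J_def ip_bilinear ip_commute[of v u] F_add F_scale algebra_simps)
  have "\<exists>N. \<forall>i\<ge>N. \<forall>j\<ge>N. ip (x i - x j) (x i - x j) < e" if e: "e > 0" for e
  proof -
    obtain N where N: "1 / Suc N < e / 4"
      using e reals_Archimedean[of "e / 4"] by (auto simp: inverse_eq_divide)
    have "ip (x i - x j) (x i - x j) < e" if "i \<ge> N" "j \<ge> N" for i j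
    proof -
      have "1 / real (Suc i) \<le> 1 / Suc N" "1 / real (Suc j) \<le> 1 / Suc N"
        using that by (auto intro!: divide_left_mono)
      then show ?thesis
        using half[OF x x, of i j] m_le[OF scale_in[OF add_in[OF x[of i] x[of j]]], of "1/2"] Jx[of i] Jx[of j] N
        by linarith
    qed
    then show ?thesis by blast
  qed
  then obtain l where l: "l \<in> V" and "(\<lambda>n. ip (x n - l) (x n - l)) \<longlonglongrightarrow> 0"
    using ip_complete[of x] x by blast
  then have lim: "(\<lambda>n. nrm (x n - l)) \<longlonglongrightarrow> 0"
    using tendsto_real_sqrt unfolding nrm_def by force
  have "ip l v = F v" if v: "v \<in> V" for v
  proof -
    have "2 * t * (ip l v - F v) + t\<^sup>2 * ip v v \<ge> 0" for t
    proof -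
      \<comment> \<open>The perturbed value is at least \<open>m\<close>, while
        \<open>J (x n)\<close> exceeds \<open>m\<close> by less than \<open>1 / Suc n\<close>; only
        the pairing with \<open>v\<close> then has to be passed to the limit.\<close>
      have "2 * t * (ip (x n) v - F v) + t\<^sup>2 * ip v v \<ge> - (1 / Suc n)" for n
      proof -
        have "J (x n + t *\<^sub>R v) \<ge> m" using x v by (intro m_le) auto
        moreover have "J (x n + t *\<^sub>R v) = J (x n) + (2 * t * (ip (x n) v - F v) + t\<^sup>2 * ip v v)"
          using x v by (simp add: J_def ip_bilinear F_add F_scale ip_commute[of v "x n"] power2_eq_square algebra_simps)
        ultimately show ?thesis using Jx[of n] by linarith
      qed
      moreover have "(\<lambda>n. 2 * t * (ip (x n) v - F v) + t\<^sup>2 * ip v v) \<longlonglongrightarrow> 2 * t * (ip l v - F v) + t\<^sup>2 * ip v v"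
        using ip_tendsto[OF x l v lim] by (intro tendsto_intros)
      moreover have "(\<lambda>n. - (1 / real (Suc n))) \<longlonglongrightarrow> - 0"
        by (intro tendsto_minus lim_inverse_n'[THEN LIMSEQ_Suc])
      ultimately show ?thesis
        by (metis (no_types, lifting) LIMSEQ_le minus_zero)
    qed
    then have "ip l v - F v = 0"
      using quadratic_nonneg_imp_linear_zero ip_nonneg[OF v] by blast
    then show ?thesis by simp
  qed
  then show ?thesis using l by blast
qed

text \<open>Banach's iteration started at 0. Completeness determines a limit only up to length 0,
  and so is the fixed point.\<close>

lemma contraction_fixpoint:
  assumes in_V: "\<And>u. u \<in> V \<Longrightarrow> \<phi> u \<in> V" and q: "0 \<le> q" "q < 1"
    and contr: "\<And>u v. u \<in> V \<Longrightarrow> v \<in> V \<Longrightarrow> nrm (\<phi> u - \<phi> v) \<le> q * nrm (u - v)"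
  shows "\<exists>u\<in>V. nrm (\<phi> u - u) = 0"
proof -
  define x where "x n = (\<phi> ^^ n) 0" for n
  have x: "x n \<in> V" for n by (induction n) (auto simp: x_def in_V)
  have x_Suc: "x (Suc n) = \<phi> (x n)" for n by (simp add: x_def)
  define D where "D = nrm (x 1 - x 0)"
  have D: "D \<ge> 0" using x by (simp add: D_def)
  have step: "nrm (x (Suc n) - x n) \<le> q ^ n * D" for n
  proof (induction n)
    case (Suc n)
    have "nrm (x (Suc (Suc n)) - x (Suc n)) \<le> q * nrm (x (Suc n) - x n)"
      using contr x x_Suc by metis
    also have "\<dots> \<le> q * (q ^ n * D)" using Suc q by (intro mult_left_mono)
    finally show ?case by simp
  qed (simp add: D_def)
  \<comment> \<open>The geometric sum multiplied through by \<open>1 - q\<close>, which keeps the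
    induction free of division.\<close>
  have tail: "(1 - q) * nrm (x (n + k) - x n) \<le> q ^ n * (1 - q ^ k) * D" for n k
  proof (induction k)
    case (Suc k)
    have "nrm (x (n + Suc k) - x n) \<le> nrm (x (Suc (n + k)) - x (n + k)) + nrm (x (n + k) - x n)"
      using nrm_triangle_diff[OF x x x] by simp
    then have "(1 - q) * nrm (x (n + Suc k) - x n) \<le> (1 - q) * (q ^ (n + k) * D) + (1 - q) * nrm (x (n + k) - x n)"
      using step[of "n + k"] q by (simp flip: distrib_left)
    also have "\<dots> \<le> (1 - q) * (q ^ (n + k) * D) + q ^ n * (1 - q ^ k) * D" using Suc by simp
    also have "\<dots> = q ^ n * (1 - q ^ Suc k) * D" by (simp add: algebra_simps power_add)
    finally show ?case .
  qed simp
  have far: "nrm (x m - x n) \<le> q ^ n * D / (1 - q)" if "m \<ge> n" for m n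
  proof -
    have "q ^ n * (1 - q ^ (m - n)) * D \<le> q ^ n * 1 * D"
      using q D by (intro mult_right_mono mult_left_mono) auto
    then show ?thesis using tail[of n "m - n"] that q by (simp add: field_simps)
  qed
  have "\<exists>N. \<forall>m\<ge>N. \<forall>n\<ge>N. nrm (x m - x n) < e" if e: "e > 0" for e
  proof -
    have "(\<lambda>n. q ^ n * D / (1 - q)) \<longlonglongrightarrow> 0 * D / (1 - q)"
      using q by (intro tendsto_intros LIMSEQ_realpow_zero) auto
    then have "eventually (\<lambda>n. q ^ n * D / (1 - q) < e) sequentially"
      using e by (intro order_tendstoD(2)) auto
    then obtain N where N: "\<And>n. n \<ge> N \<Longrightarrow> q ^ n * D / (1 - q) < e"
      by (auto simp: eventually_sequentially)
    have "nrm (x m - x n) < e" if "m \<ge> N" "n \<ge> N" for m n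
      using far[of n m] far[of m n] N[OF that(1)] N[OF that(2)] nrm_diff_commute[OF x x, of m n]
      by (cases "m \<ge> n") auto
    then show ?thesis by blast
  qed
  then obtain l where l: "l \<in> V" and lim: "(\<lambda>n. nrm (x n - l)) \<longlonglongrightarrow> 0"
    using nrm_complete[of x] x by blast
  have bound: "nrm (\<phi> l - l) \<le> q * nrm (x n - l) + nrm (x (Suc n) - l)" for n
  proof -
    have "nrm (\<phi> l - l) \<le> nrm (\<phi> l - \<phi> (x n)) + nrm (\<phi> (x n) - l)"
      using nrm_triangle_diff in_V l x by blast
    then show ?thesis using contr[OF l x, of n] nrm_diff_commute[OF l x, of n] by (simp add: x_Suc)
  qed
  have "(\<lambda>n. q * nrm (x n - l) + nrm (x (Suc n) - l)) \<longlonglongrightarrow> q * 0 + 0"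
    by (intro tendsto_intros lim LIMSEQ_Suc[OF lim])
  then have "nrm (\<phi> l - l) \<le> 0"
    using bound by (intro LIMSEQ_le_const) auto
  then show ?thesis using l nrm_nonneg[OF diff_in[OF in_V[OF l] l]] by (intro bexI[of _ l]) auto
qed

end

section \<open>Compact selfadjoint operators with a spectral gap\<close>

locale compact_selfadjoint = semi_hilbert V ip
  for V :: "'v::real_vector set" and ip :: "'v \<Rightarrow> 'v \<Rightarrow> real" +
  fixes S :: "'v \<Rightarrow> 'v" and \<kappa> :: real
  assumes S_in [simp, intro]: "\<And>v. v \<in> V \<Longrightarrow> S v \<in> V"
    and S_sym: "\<And>u v. u \<in> V \<Longrightarrow> v \<in> V \<Longrightarrow> ip (S u) v = ip u (S v)"
    and S_bound: "\<And>v. v \<in> V \<Longrightarrow> nrm (S v) \<le> \<kappa> * nrm v"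
    and \<kappa>_pos: "\<kappa> > 0"
    and S_compact: "\<And>w M. (\<And>n. w n \<in> V) \<Longrightarrow> (\<And>n. nrm (w n) \<le> M) \<Longrightarrow>
        \<exists>r l. strict_mono (r :: nat \<Rightarrow> nat) \<and> l \<in> V \<and> (\<lambda>n. nrm (S (w (r n)) - l)) \<longlonglongrightarrow> 0"
begin

lemma null_if_orthogonal:
  assumes "z \<in> V" and "\<And>v. v \<in> V \<Longrightarrow> ip z v = 0"
  shows "nrm z = 0"
  using assms by (simp add: nrm_def)

text \<open>Additivity modulo null vectors: in the pairing of \<open>S u - S v - S (u - v)\<close>
  with any vector, symmetry moves \<open>S\<close> onto that vector, and bilinearity makes the
  result 0.\<close>

lemma S_diff:
  assumes u: "u \<in> V" and v: "v \<in> V"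
  shows "nrm (S u - S v) \<le> \<kappa> * nrm (u - v)"
proof -
  have "nrm ((S u - S v) - S (u - v)) = 0"
    using assms by (intro null_if_orthogonal) (simp_all add: ip_bilinear S_sym)
  then have "nrm (S u - S v) = nrm (S (u - v))" using assms by (intro nrm_cong_null) auto
  then show ?thesis using S_bound[of "u - v"] assms by simp
qed

lemma S_scale_left: "u \<in> V \<Longrightarrow> v \<in> V \<Longrightarrow> ip (S (r *\<^sub>R u)) v = r * ip (S u) v"
  by (simp add: S_sym ip_scale_left)

lemma S_scale_right: "u \<in> V \<Longrightarrow> v \<in> V \<Longrightarrow> ip v (S (r *\<^sub>R u)) = r * ip v (S u)"
  by (simp add: ip_commute[of v] S_scale_left)

text \<open>Upgrades convergence of \<open>S (w n)\<close> to convergence of \<open>w n\<close>: up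
  to a null sequence, \<open>p\<close> times \<open>w n\<close> is a polynomial in \<open>S\<close>
  without constant term applied to \<open>w n\<close>, and both of its terms converge along with
  \<open>S (w n)\<close>.\<close>

lemma limit_if_compact_part:
  assumes w: "\<And>n. w n \<in> V" and l: "l \<in> V"
    and Sw: "(\<lambda>n. nrm (S (w n) - l)) \<longlonglongrightarrow> 0"
    and rest: "(\<lambda>n. nrm (p *\<^sub>R w n - (q *\<^sub>R S (w n) - t *\<^sub>R S (S (w n))))) \<longlonglongrightarrow> 0" and p: "p > 0"
  shows "(\<lambda>n. nrm (w n - (1 / p) *\<^sub>R (q *\<^sub>R l - t *\<^sub>R S l))) \<longlonglongrightarrow> 0"
proof (rule Lim_null_comparison)
  let ?R = "\<lambda>n. nrm (p *\<^sub>R w n - (q *\<^sub>R S (w n) - t *\<^sub>R S (S (w n))))"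
  show "(\<lambda>n. (1 / p) * (?R n + (\<bar>q\<bar> * nrm (S (w n) - l) + \<bar>t\<bar> * (\<kappa> * nrm (S (w n) - l))))) \<longlonglongrightarrow> 0"
    by (rule tendsto_eq_intros rest Sw refl | simp)+
  have "nrm (w n - (1 / p) *\<^sub>R (q *\<^sub>R l - t *\<^sub>R S l))
      \<le> (1 / p) * (?R n + (\<bar>q\<bar> * nrm (S (w n) - l) + \<bar>t\<bar> * (\<kappa> * nrm (S (w n) - l))))" for n
  proof -
    have "w n - (1 / p) *\<^sub>R (q *\<^sub>R l - t *\<^sub>R S l) =
        (1 / p) *\<^sub>R ((p *\<^sub>R w n - (q *\<^sub>R S (w n) - t *\<^sub>R S (S (w n))))
          + (q *\<^sub>R (S (w n) - l) - t *\<^sub>R (S (S (w n)) - S l)))"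
      using p by (simp add: algebra_simps)
    also have "nrm \<dots> = (1 / p) * nrm ((p *\<^sub>R w n - (q *\<^sub>R S (w n) - t *\<^sub>R S (S (w n))))
          + (q *\<^sub>R (S (w n) - l) - t *\<^sub>R (S (S (w n)) - S l)))"
      using p w l by (subst nrm_scale) auto
    also have "\<dots> \<le> (1 / p) * (?R n + (\<bar>q\<bar> * nrm (S (w n) - l) + \<bar>t\<bar> * (\<kappa> * nrm (S (w n) - l))))"
    proof (rule mult_left_mono)
      have "nrm (q *\<^sub>R (S (w n) - l) - t *\<^sub>R (S (S (w n)) - S l))
          \<le> nrm (q *\<^sub>R (S (w n) - l)) + nrm (t *\<^sub>R (S (S (w n)) - S l))"
        using w l by (intro nrm_diff_le) auto
      also have "\<dots> \<le> \<bar>q\<bar> * nrm (S (w n) - l) + \<bar>t\<bar> * (\<kappa> * nrm (S (w n) - l))"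
        using w l S_diff[of "S (w n)" l] by (simp add: nrm_scale mult_left_mono)
      finally show "nrm ((p *\<^sub>R w n - (q *\<^sub>R S (w n) - t *\<^sub>R S (S (w n))))
          + (q *\<^sub>R (S (w n) - l) - t *\<^sub>R (S (S (w n)) - S l)))
        \<le> ?R n + (\<bar>q\<bar> * nrm (S (w n) - l) + \<bar>t\<bar> * (\<kappa> * nrm (S (w n) - l)))"
        using nrm_triangle[of "p *\<^sub>R w n - (q *\<^sub>R S (w n) - t *\<^sub>R S (S (w n)))"
            "q *\<^sub>R (S (w n) - l) - t *\<^sub>R (S (S (w n)) - S l)"] w l by auto
    qed (use p in simp)
    finally show ?thesis .
  qed
  then show "eventually (\<lambda>n. norm (nrm (w n - (1 / p) *\<^sub>R (q *\<^sub>R l - t *\<^sub>R S l)))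
      \<le> (1 / p) * (?R n + (\<bar>q\<bar> * nrm (S (w n) - l) + \<bar>t\<bar> * (\<kappa> * nrm (S (w n) - l))))) sequentially"
    using w l by (intro always_eventually) auto
qed

text \<open>This is \<open>R\<^sup>2 \<le> C R\<close> for a nonnegative symmetric \<open>R\<close>
  of norm at most \<open>C\<close>, obtained by testing nonnegativity at
  \<open>w - (1 / C) R w\<close>. It turns smallness of the form at \<open>w\<close> into smallness
  of \<open>R w\<close>.\<close>

lemma nonneg_selfadjoint_bound:
  assumes R_in: "\<And>v. v \<in> V \<Longrightarrow> R v \<in> V"
    and R_sym: "\<And>u v. u \<in> V \<Longrightarrow> v \<in> V \<Longrightarrow> ip (R u) v = ip u (R v)"
    and R_nonneg: "\<And>v. v \<in> V \<Longrightarrow> ip v (R v) \<ge> 0"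
    and R_bound: "\<And>v. v \<in> V \<Longrightarrow> nrm (R v) \<le> C * nrm v" and C: "C > 0"
    and w: "w \<in> V"
  shows "(nrm (R w))\<^sup>2 \<le> C * ip w (R w)"
proof -
  let ?z = "w - (1 / C) *\<^sub>R R w"
  have "ip (R w) (R (R w)) \<le> nrm (R w) * nrm (R (R w))"
    using cauchy_schwarz[of "R w" "R (R w)"] R_in w by simp
  also have "\<dots> \<le> nrm (R w) * (C * nrm (R w))"
    using R_bound R_in w by (intro mult_left_mono) auto
  also have "\<dots> = C * ip (R w) (R w)" using R_in w by (simp flip: nrm_squared add: power2_eq_square)
  finally have RR: "ip (R w) (R (R w)) \<le> C * ip (R w) (R w)" .
  have "0 \<le> ip ?z (R ?z)" using R_nonneg R_in w by auto
  also have "\<dots> = ip w (R ?z) - (1 / C) * ip (R w) (R ?z)"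
    using R_in w by (simp add: ip_bilinear)
  also have "ip w (R ?z) = ip (R w) ?z" using R_in w by (intro R_sym[symmetric]) auto
  also have "ip (R w) (R ?z) = ip (R (R w)) ?z" using R_in w by (intro R_sym[symmetric]) auto
  also have "ip (R w) ?z = ip (R w) w - (1 / C) * ip (R w) (R w)" using R_in w by (simp add: ip_bilinear)
  also have "ip (R (R w)) ?z = ip (R (R w)) w - (1 / C) * ip (R (R w)) (R w)" using R_in w by (simp add: ip_bilinear)
  also have "ip (R (R w)) w = ip (R w) (R w)" using R_in w by (simp add: R_sym)
  also have "ip (R w) w = ip w (R w)" using R_in w by (simp add: ip_commute)
  also have "ip (R (R w)) (R w) = ip (R w) (R (R w))" using R_in w by (simp add: ip_commute)
  finally have "0 \<le> ip w (R w) - 2 / C * ip (R w) (R w) + (1 / C)\<^sup>2 * ip (R w) (R (R w))"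
    by (simp add: power2_eq_square algebra_simps)
  moreover have "(1 / C)\<^sup>2 * ip (R w) (R (R w)) \<le> (1 / C)\<^sup>2 * (C * ip (R w) (R w))"
    using RR by (intro mult_left_mono) auto
  moreover have "(1 / C)\<^sup>2 * (C * ip (R w) (R w)) = 1 / C * ip (R w) (R w)"
    using C by (simp add: power2_eq_square)
  ultimately have "0 \<le> ip w (R w) - 1 / C * ip (R w) (R w)" by simp
  then have "ip (R w) (R w) \<le> C * ip w (R w)" using C by (simp add: field_simps)
  then show ?thesis using R_in w by (simp add: nrm_squared)
qed

end

text \<open>In the application \<open>S\<close> is the solution operator of \<open>-\<L>\<^sub>K\<close>, so the eigenvalues of \<open>-\<L>\<^sub>K\<close> are the
  reciprocals of those of \<open>S\<close>, and \<open>no_eigenvalue\<close> says that none of them lies strictly between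
  \<open>\<alpha>\<close> and \<open>\<beta>\<close>.\<close>

locale spectral_gap = compact_selfadjoint V ip S \<kappa>
  for V :: "'v::real_vector set" and ip :: "'v \<Rightarrow> 'v \<Rightarrow> real" and S :: "'v \<Rightarrow> 'v" and \<kappa> :: real +
  fixes \<alpha> \<beta> :: real
  assumes \<alpha>_pos: "0 < \<alpha>" and \<alpha>_less_\<beta>: "\<alpha> < \<beta>"
    and no_eigenvalue: "\<And>s w. w \<in> V \<Longrightarrow> (1 - \<alpha> * s) * (1 - \<beta> * s) < 0 \<Longrightarrow>
        nrm (S w - s *\<^sub>R w) = 0 \<Longrightarrow> nrm w = 0"
begin

text \<open>With \<open>P s = (1 - \<alpha> s) (1 - \<beta> s) + \<nu>\<close> the hypothesis reads
  \<open>P(S) w = 0\<close>. Without real roots, \<open>P(S)\<close> is positive definite. Otherwise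
  it splits into \<open>S - s1\<close> and \<open>S - s2\<close>; at a root the product
  \<open>(1 - \<alpha> s) (1 - \<beta> s)\<close> equals \<open>- \<nu>\<close>, so
  \<open>no_eigenvalue\<close> makes both factors injective modulo null vectors.\<close>

lemma quadratic_kernel_null:
  assumes w: "w \<in> V" and \<nu>: "\<nu> > 0"
    and ker: "nrm ((1 + \<nu>) *\<^sub>R w - ((\<alpha> + \<beta>) *\<^sub>R S w - (\<alpha> * \<beta>) *\<^sub>R S (S w))) = 0"
  shows "nrm w = 0"
proof -
  have ab: "\<alpha> * \<beta> > 0" and ab_nz: "\<alpha> \<noteq> 0" "\<beta> \<noteq> 0" using \<alpha>_pos \<alpha>_less_\<beta> by auto
  define D where "D = (\<alpha> + \<beta>)\<^sup>2 - 4 * (\<alpha> * \<beta>) * (1 + \<nu>)"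
  show ?thesis
  proof (cases "D < 0")
    case True
    \<comment> \<open>Half the sum of the two complex roots: completing the square about
      \<open>p\<close> leaves the constant \<open>- D / (4 \<alpha> \<beta>)\<close>, which is
      positive here.\<close>
    define p where "p = (\<alpha> + \<beta>) / (2 * (\<alpha> * \<beta>))"
    have "0 = ip ((1 + \<nu>) *\<^sub>R w - ((\<alpha> + \<beta>) *\<^sub>R S w - (\<alpha> * \<beta>) *\<^sub>R S (S w))) w"
      using ip_null[OF _ _ ker] w by auto
    also have "\<dots> = (1 + \<nu>) * ip w w - (\<alpha> + \<beta>) * ip (S w) w + \<alpha> * \<beta> * ip (S w) (S w)"
      using w by (simp add: ip_bilinear S_sym[of "S w" w])
    also have "\<dots> = \<alpha> * \<beta> * ip (S w - p *\<^sub>R w) (S w - p *\<^sub>R w) + (- D / (4 * (\<alpha> * \<beta>))) * ip w w"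
    proof -
      have p: "\<alpha> * \<beta> * p = (\<alpha> + \<beta>) / 2" using ab unfolding p_def by (metis less_irrefl nonzero_mult_divide_mult_cancel_left times_divide_eq_right mult.commute)
      have D: "- D / (4 * (\<alpha> * \<beta>)) = (1 + \<nu>) - (\<alpha> + \<beta>) / 2 * p"
        using ab_nz by (simp add: p_def D_def power2_eq_square diff_divide_distrib)
      have "\<alpha> * \<beta> * ip (S w - p *\<^sub>R w) (S w - p *\<^sub>R w)
          = \<alpha> * \<beta> * ip (S w) (S w) - 2 * (\<alpha> * \<beta> * p) * ip (S w) w + (\<alpha> * \<beta> * p) * p * ip w w"
        using w by (simp add: ip_bilinear ip_commute[of w "S w"] algebra_simps)
      then show ?thesis unfolding p D by (simp add: field_simps)
    qed
    finally have eq: "0 = \<alpha> * \<beta> * ip (S w - p *\<^sub>R w) (S w - p *\<^sub>R w) + (- D / (4 * (\<alpha> * \<beta>))) * ip w w" .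
    have "ip w w \<le> 0"
    proof (rule ccontr)
      assume "\<not> ip w w \<le> 0"
      moreover have "- D / (4 * (\<alpha> * \<beta>)) > 0" using ab True by (intro divide_pos_pos) auto
      ultimately have "(- D / (4 * (\<alpha> * \<beta>))) * ip w w > 0" by (intro mult_pos_pos) auto
      moreover have "\<alpha> * \<beta> * ip (S w - p *\<^sub>R w) (S w - p *\<^sub>R w) \<ge> 0"
        by (rule mult_nonneg_nonneg) (use ab w in \<open>auto intro: ip_nonneg\<close>)
      ultimately show False using add_nonneg_pos eq by (metis less_irrefl)
    qed
    then show ?thesis using ip_nonneg[OF w] by (simp add: nrm_def)
  next
    case False
    define s1 where "s1 = ((\<alpha> + \<beta>) + sqrt D) / (2 * (\<alpha> * \<beta>))"
    define s2 where "s2 = ((\<alpha> + \<beta>) - sqrt D) / (2 * (\<alpha> * \<beta>))"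
    have "s1 + s2 = (2 * (\<alpha> + \<beta>)) / (2 * (\<alpha> * \<beta>))"
      unfolding s1_def s2_def by (simp flip: add_divide_distrib)
    then have sum: "\<alpha> * \<beta> * (s1 + s2) = \<alpha> + \<beta>" using ab_nz by simp
    have "s1 * s2 = ((\<alpha> + \<beta>)\<^sup>2 - (sqrt D)\<^sup>2) / (4 * (\<alpha> * \<beta>) * (\<alpha> * \<beta>))"
      unfolding s1_def s2_def times_divide_times_eq by (simp add: power2_eq_square algebra_simps)
    also have "\<dots> = (4 * (\<alpha> * \<beta>) * (1 + \<nu>)) / (4 * (\<alpha> * \<beta>) * (\<alpha> * \<beta>))"
      using False by (simp add: D_def)
    finally have prod: "\<alpha> * \<beta> * (s1 * s2) = 1 + \<nu>" using ab_nz by simp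
    have root: "(1 - \<alpha> * s) * (1 - \<beta> * s) < 0" if "s = s1 \<or> s = s2" for s
    proof -
      have "(s - s1) * (s - s2) = 0" using that by auto
      have "\<alpha> * \<beta> * s\<^sup>2 - (\<alpha> * \<beta> * (s1 + s2)) * s + \<alpha> * \<beta> * (s1 * s2) = \<alpha> * \<beta> * ((s - s1) * (s - s2))"
        by (simp add: power2_eq_square algebra_simps)
      also have "\<dots> = 0" using \<open>(s - s1) * (s - s2) = 0\<close> by simp
      finally have "\<alpha> * \<beta> * s\<^sup>2 - (\<alpha> + \<beta>) * s + (1 + \<nu>) = 0" unfolding sum prod .
      moreover have "(1 - \<alpha> * s) * (1 - \<beta> * s) = \<alpha> * \<beta> * s\<^sup>2 - (\<alpha> + \<beta>) * s + 1"
        by (simp add: power2_eq_square algebra_simps)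
      ultimately show ?thesis using \<nu> by linarith
    qed
    \<comment> \<open>The factors are removed one at a time: \<open>?y\<close> is null as a
      candidate eigenvector for \<open>s1\<close>, and then \<open>w\<close> as one for
      \<open>s2\<close>. The factorisation holds only modulo null vectors, hence the detour through
      pairings.\<close>
    let ?y = "S w - s2 *\<^sub>R w"
    define k where "k = (1 + \<nu>) *\<^sub>R w - ((\<alpha> + \<beta>) *\<^sub>R S w - (\<alpha> * \<beta>) *\<^sub>R S (S w))"
    have k: "k \<in> V" and nk: "nrm k = 0" using w ker by (simp_all add: k_def)
    have "nrm ((\<alpha> * \<beta>) *\<^sub>R (S ?y - s1 *\<^sub>R ?y) - k) = 0"
    proof (rule null_if_orthogonal)
      fix v assume v: "v \<in> V"
      have "ip (S ?y - s1 *\<^sub>R ?y) v = ip (S (S w)) v - (s1 + s2) * ip (S w) v + s1 * s2 * ip w v"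
        using w v by (simp add: ip_bilinear S_sym algebra_simps)
      then have "\<alpha> * \<beta> * ip (S ?y - s1 *\<^sub>R ?y) v
          = \<alpha> * \<beta> * ip (S (S w)) v - (\<alpha> * \<beta> * (s1 + s2)) * ip (S w) v + (\<alpha> * \<beta> * (s1 * s2)) * ip w v"
        by (simp only:) (simp only: ring_distribs mult_ac)
      also have "\<dots> = \<alpha> * \<beta> * ip (S (S w)) v - (\<alpha> + \<beta>) * ip (S w) v + (1 + \<nu>) * ip w v"
        unfolding sum prod ..
      also have "\<dots> = ip k v"
        using w v unfolding k_def by (simp add: ip_bilinear)
      finally show "ip ((\<alpha> * \<beta>) *\<^sub>R (S ?y - s1 *\<^sub>R ?y) - k) v = 0"
        using w v k by (simp only: ip_diff_left[of "_ *\<^sub>R _"] ip_scale_left scale_in diff_in S_in)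
    qed (intro diff_in scale_in S_in w k)
    then have "nrm ((\<alpha> * \<beta>) *\<^sub>R (S ?y - s1 *\<^sub>R ?y)) = 0"
      using nrm_cong_null[OF _ k] nk w by (metis diff_in scale_in S_in)
    then have "nrm (S ?y - s1 *\<^sub>R ?y) = 0"
      using w ab_nz by (subst (asm) nrm_scale) (auto simp: ab_nz)
    have "nrm ?y = 0"
      using \<open>nrm (S ?y - s1 *\<^sub>R ?y) = 0\<close> by (rule no_eigenvalue[rotated -1]) (use w root[of s1] in simp_all)
    then show ?thesis by (rule no_eigenvalue[OF w, rotated -1]) (use root[of s2] in simp)
  qed
qed

text \<open>The form \<open>((1 - \<alpha> S) w, (1 - \<beta> S) w)\<close> is nonnegative: otherwise its negative infimum on the unit
  ball is attained, and the minimizer lies in the kernel of a real quadratic polynomial in \<open>S\<close> whose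
  real roots are forbidden eigenvalues.\<close>

lemma form_nonneg:
  assumes w0: "w0 \<in> V"
  shows "ip w0 w0 - (\<alpha> + \<beta>) * ip w0 (S w0) + \<alpha> * \<beta> * ip (S w0) (S w0) \<ge> 0"
proof (rule ccontr)
  define q where "q w = ip w w - (\<alpha> + \<beta>) * ip w (S w) + \<alpha> * \<beta> * ip (S w) (S w)" for w
  assume "\<not> ?thesis"
  then have q0: "q w0 < 0" by (simp add: q_def)
  have ab: "\<alpha> * \<beta> > 0" "\<alpha> + \<beta> > 0" using \<alpha>_pos \<alpha>_less_\<beta> by auto
  have q_scale: "q (r *\<^sub>R w) = r\<^sup>2 * q w" if w: "w \<in> V" for r w
  proof -
    have "ip (r *\<^sub>R w) (S (r *\<^sub>R w)) = r\<^sup>2 * ip w (S w)"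
      using w by (simp add: ip_scale_left S_scale_right power2_eq_square)
    moreover have "ip (S (r *\<^sub>R w)) (S (r *\<^sub>R w)) = r\<^sup>2 * ip (S w) (S w)"
      using w by (simp add: S_scale_left S_scale_right power2_eq_square)
    moreover have "ip (r *\<^sub>R w) (r *\<^sub>R w) = r\<^sup>2 * ip w w"
      using w by (simp add: ip_bilinear power2_eq_square)
    ultimately show ?thesis by (simp add: q_def algebra_simps)
  qed
  define U where "U = {w \<in> V. nrm w \<le> 1}"
  have q_ge: "q w \<ge> - ((\<alpha> + \<beta>) * \<kappa>)" if "w \<in> U" for w
  proof -
    have w: "w \<in> V" and w1: "nrm w \<le> 1" using that by (auto simp: U_def)
    have "ip w (S w) \<le> nrm w * nrm (S w)" using cauchy_schwarz[of w "S w"] w by simp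
    also have "\<dots> \<le> 1 * (\<kappa> * 1)"
      using w w1 S_bound[OF w] \<kappa>_pos by (intro mult_mono order_trans[OF S_bound]) auto
    finally have "(\<alpha> + \<beta>) * ip w (S w) \<le> (\<alpha> + \<beta>) * \<kappa>" using ab by simp
    moreover have "\<alpha> * \<beta> * ip (S w) (S w) \<ge> 0" using ab w ip_nonneg by simp
    ultimately show ?thesis using ip_nonneg[OF w] by (simp add: q_def)
  qed
  define \<nu> where "\<nu> = - Inf (q ` U)"
  have bdd: "bdd_below (q ` U)" using q_ge by (auto intro!: bdd_belowI)
  have q_lower: "q w \<ge> - \<nu>" if "w \<in> U" for w
    using cInf_lower[OF _ bdd, of "q w"] that by (auto simp: \<nu>_def)
  have n0: "nrm w0 > 0"
  proof -
    have "nrm w0 \<noteq> 0"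
    proof
      assume "nrm w0 = 0"
      moreover have "nrm (S w0) = 0" using S_bound[OF w0] \<open>nrm w0 = 0\<close> nrm_nonneg[OF S_in[OF w0]] by simp
      ultimately have "q w0 = 0"
        using w0 by (simp add: q_def ip_null)
      then show False using q0 by simp
    qed
    then show ?thesis using nrm_nonneg[OF w0] by simp
  qed
  have "(1 / nrm w0) *\<^sub>R w0 \<in> U" using w0 n0 by (simp add: U_def nrm_scale)
  from q_lower[OF this] have \<nu>: "\<nu> > 0"
    using q0 n0 w0 mult_pos_neg[of "(1 / nrm w0)\<^sup>2" "q w0"] by (simp add: q_scale)
  have q_lower': "q w \<ge> - \<nu> * ip w w" if w: "w \<in> V" for w
  proof (cases "nrm w = 0")
    case True
    then have "nrm (S w) = 0" using S_bound[OF w] nrm_nonneg[OF S_in[OF w]] by simp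
    then show ?thesis using True w by (simp add: q_def ip_null)
  next
    case False
    then have n: "nrm w > 0" using nrm_nonneg[OF w] by simp
    have "(1 / nrm w) *\<^sub>R w \<in> U" using w n by (simp add: U_def nrm_scale)
    from q_lower[OF this] have "- \<nu> \<le> (1 / nrm w)\<^sup>2 * q w" using w by (simp add: q_scale)
    then have "- \<nu> * (nrm w)\<^sup>2 \<le> q w" using n by (simp add: field_simps power2_eq_square)
    then show ?thesis using w by (simp add: nrm_squared)
  qed
  \<comment> \<open>\<open>R\<close> represents the form \<open>q + \<nu> ip\<close>, nonnegative by
    the choice of \<nu>. Along a minimising sequence this form tends to 0, and then so does
    \<open>R (w n)\<close> itself.\<close>
  define R where "R w = (1 + \<nu>) *\<^sub>R w - ((\<alpha> + \<beta>) *\<^sub>R S w - (\<alpha> * \<beta>) *\<^sub>R S (S w))" for w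
  have R_in: "R w \<in> V" if "w \<in> V" for w using that by (simp add: R_def)
  have R_form: "ip w (R w) = q w + \<nu> * ip w w" if "w \<in> V" for w
    using that by (simp add: R_def q_def ip_bilinear S_sym algebra_simps)
  define C where "C = (1 + \<nu>) + ((\<alpha> + \<beta>) * \<kappa> + \<alpha> * \<beta> * (\<kappa> * \<kappa>))"
  have C: "C > 0" using \<nu> ab \<kappa>_pos by (simp add: C_def add_pos_nonneg)
  have R_bound: "nrm (R w) \<le> C * nrm w" if w: "w \<in> V" for w
  proof -
    have "nrm (R w) \<le> nrm ((1 + \<nu>) *\<^sub>R w) + nrm ((\<alpha> + \<beta>) *\<^sub>R S w - (\<alpha> * \<beta>) *\<^sub>R S (S w))"
      unfolding R_def using w by (intro nrm_diff_le) auto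
    also have "\<dots> \<le> nrm ((1 + \<nu>) *\<^sub>R w) + (nrm ((\<alpha> + \<beta>) *\<^sub>R S w) + nrm ((\<alpha> * \<beta>) *\<^sub>R S (S w)))"
      using w by (intro add_left_mono nrm_diff_le) auto
    also have "\<dots> = (1 + \<nu>) * nrm w + ((\<alpha> + \<beta>) * nrm (S w) + \<alpha> * \<beta> * nrm (S (S w)))"
      using w \<nu> ab by (simp add: nrm_scale)
    also have "\<dots> \<le> (1 + \<nu>) * nrm w + ((\<alpha> + \<beta>) * (\<kappa> * nrm w) + \<alpha> * \<beta> * (\<kappa> * (\<kappa> * nrm w)))"
      using w ab \<kappa>_pos S_bound
      by (intro add_left_mono add_mono mult_left_mono order_trans[OF S_bound]) auto
    also have "\<dots> = C * nrm w" by (simp add: C_def algebra_simps)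
    finally show ?thesis .
  qed
  have R_sq: "(nrm (R w))\<^sup>2 \<le> C * ip w (R w)" if "w \<in> V" for w
  proof (rule nonneg_selfadjoint_bound)
    show "ip (R u) v = ip u (R v)" if "u \<in> V" "v \<in> V" for u v
      using that by (simp add: R_def ip_bilinear S_sym)
    show "ip v (R v) \<ge> 0" if "v \<in> V" for v
      using q_lower'[OF that] R_form[OF that] by simp
  qed (use that C R_in R_bound in auto)
  have "\<exists>w\<in>U. q w < - \<nu> + inverse (real (Suc n))" for n
    using cInf_lessD[of "q ` U" "- \<nu> + inverse (real (Suc n))"] \<open>(1 / nrm w0) *\<^sub>R w0 \<in> U\<close> by (fastforce simp: \<nu>_def)
  then obtain w where wU: "\<And>n. w n \<in> U" and qw: "\<And>n. q (w n) < - \<nu> + inverse (real (Suc n))" by metis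
  have w: "w n \<in> V" and w1: "nrm (w n) \<le> 1" for n using wU[of n] by (auto simp: U_def)
  have ww1: "ip (w n) (w n) \<le> 1" for n
    using w1[of n] w[of n] by (simp flip: nrm_squared add: power_le_one)
  have "(\<lambda>n. (nrm (R (w n)))\<^sup>2) \<longlonglongrightarrow> 0"
  proof (rule Lim_null_comparison)
    have "(nrm (R (w n)))\<^sup>2 \<le> C * inverse (real (Suc n))" for n
    proof -
      have "\<nu> * ip (w n) (w n) \<le> \<nu> * 1" using \<nu> ww1 by (intro mult_left_mono) auto
      then have "ip (w n) (R (w n)) \<le> inverse (real (Suc n))" using qw[of n] w by (simp add: R_form)
      then have "C * ip (w n) (R (w n)) \<le> C * inverse (real (Suc n))" using C by (intro mult_left_mono) auto
      then show ?thesis using R_sq[OF w] by (rule order_trans[rotated])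
    qed
    then show "eventually (\<lambda>n. norm ((nrm (R (w n)))\<^sup>2) \<le> C * inverse (real (Suc n))) sequentially"
      by simp
    show "(\<lambda>n. C * inverse (real (Suc n))) \<longlonglongrightarrow> 0"
      by (intro tendsto_mult_right_zero LIMSEQ_inverse_real_of_nat)
  qed
  from tendsto_real_sqrt[OF this] have Rw: "(\<lambda>n. nrm (R (w n))) \<longlonglongrightarrow> 0" using w R_in by simp
  obtain r l where r: "strict_mono r" and l: "l \<in> V" and Sl: "(\<lambda>n. nrm (S (w (r n)) - l)) \<longlonglongrightarrow> 0"
    using S_compact[of w 1] w w1 by blast
  define z where "z = (1 / (1 + \<nu>)) *\<^sub>R ((\<alpha> + \<beta>) *\<^sub>R l - (\<alpha> * \<beta>) *\<^sub>R S l)"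
  have z: "z \<in> V" using l by (simp add: z_def)
  have lim: "(\<lambda>n. nrm (w (r n) - z)) \<longlonglongrightarrow> 0"
    unfolding z_def
    using LIMSEQ_subseq_LIMSEQ[OF Rw r] \<nu> w l Sl
    by (intro limit_if_compact_part) (auto simp: R_def o_def)
  have "nrm (R z) = 0"
  proof -
    have "ip (R z) v = 0" if v: "v \<in> V" for v
    proof -
      have "(\<lambda>n. ip (w (r n)) (R v)) \<longlonglongrightarrow> ip z (R v)"
        using w z v R_in lim by (intro ip_tendsto) auto
      moreover have "(\<lambda>n. ip (w (r n)) (R v)) \<longlonglongrightarrow> 0"
      proof (rule Lim_null_comparison)
        have "ip (w (r n)) (R v) = ip (R (w (r n))) v" for n
          using w v by (simp add: R_def ip_bilinear S_sym)
        then show "eventually (\<lambda>n. norm (ip (w (r n)) (R v)) \<le> nrm (R (w (r n))) * nrm v) sequentially"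
          using cauchy_schwarz w v R_in by simp
        show "(\<lambda>n. nrm (R (w (r n))) * nrm v) \<longlonglongrightarrow> 0"
          using LIMSEQ_subseq_LIMSEQ[OF Rw r] by (intro tendsto_mult_left_zero) (simp add: o_def)
      qed
      ultimately have "ip z (R v) = 0" using LIMSEQ_unique by blast
      then show ?thesis using z v by (simp add: R_def ip_bilinear S_sym)
    qed
    then show ?thesis using z R_in by (intro null_if_orthogonal) auto
  qed
  then have "nrm z = 0" unfolding R_def using z \<nu> by (rule_tac quadratic_kernel_null) auto
  then have "(\<lambda>n. nrm (w (r n))) \<longlonglongrightarrow> 0"
    using lim z w nrm_cong_null[of "w (r n)" "w (r n) - z" for n] by simp
  \<comment> \<open>A null limit is incompatible with \<open>q (w (r n))\<close> staying near
    \<open>- \<nu>\<close>: the only term of \<open>q\<close> that can be negative is controlled by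
    this product, which tends to 0.\<close>
  then have "(\<lambda>n. (\<alpha> + \<beta>) * (nrm (w (r n)) * (\<kappa> * nrm (w (r n))))) \<longlonglongrightarrow> (\<alpha> + \<beta>) * (0 * (\<kappa> * 0))"
    by (intro tendsto_intros)
  then have "eventually (\<lambda>n. (\<alpha> + \<beta>) * (nrm (w (r n)) * (\<kappa> * nrm (w (r n)))) < \<nu> / 2) sequentially"
    using \<nu> by (intro order_tendstoD(2)) auto
  moreover have "eventually (\<lambda>n. inverse (real (Suc n)) < \<nu> / 2) sequentially"
    using LIMSEQ_inverse_real_of_nat \<nu> by (intro order_tendstoD(2)) auto
  then have "eventually (\<lambda>n. inverse (real (Suc (r n))) < \<nu> / 2) sequentially"
    using eventually_subseq[OF r] by blast
  ultimately have "eventually (\<lambda>n. False) sequentially"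
  proof eventually_elim
    case (elim n)
    let ?w = "w (r n)"
    have "ip ?w (S ?w) \<le> nrm ?w * nrm (S ?w)" using cauchy_schwarz[of ?w "S ?w"] w by simp
    also have "\<dots> \<le> nrm ?w * (\<kappa> * nrm ?w)" using w S_bound by (intro mult_left_mono) auto
    finally have "(\<alpha> + \<beta>) * ip ?w (S ?w) \<le> (\<alpha> + \<beta>) * (nrm ?w * (\<kappa> * nrm ?w))"
      using ab by (intro mult_left_mono) auto
    moreover have "\<alpha> * \<beta> * ip (S ?w) (S ?w) \<ge> 0" using ab w ip_nonneg by simp
    ultimately have "q ?w > - (\<nu> / 2)" using ip_nonneg[OF w, of "r n"] elim by (simp add: q_def)
    then show ?case using qw[of "r n"] elim by simp
  qed
  then show False by simp
qed

section \<open>Inverting the operator at the centre of the gap\<close>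

definition mid :: real where "mid = (\<alpha> + \<beta>) / 2"

definition half_gap :: real where "half_gap = (\<beta> - \<alpha>) / 2"

lemma mid_pos: "mid > 0" and half_gap_pos: "half_gap > 0"
  using \<alpha>_pos \<alpha>_less_\<beta> by (auto simp: mid_def half_gap_def)

text \<open>With \<open>u = S w\<close> this bounds \<open>L - mid\<close> from below while
  mentioning only the bounded \<open>S\<close>. The difference of the squares is exactly the form in
  \<open>form_nonneg\<close>, because \<open>2 * mid = \<alpha> + \<beta>\<close> and
  \<open>mid\<^sup>2 - half_gap\<^sup>2 = \<alpha> * \<beta>\<close>.\<close>

lemma gap_inequality:
  assumes w: "w \<in> V"
  shows "half_gap * nrm (S w) \<le> nrm (w - mid *\<^sub>R S w)"
proof (rule power2_le_imp_le)
  have "(nrm (w - mid *\<^sub>R S w))\<^sup>2 = ip w w - 2 * mid * ip w (S w) + mid\<^sup>2 * ip (S w) (S w)"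
    using w by (simp add: nrm_squared ip_bilinear ip_commute[of "S w" w])
      (simp add: power2_eq_square algebra_simps)
  moreover have "2 * mid = \<alpha> + \<beta>" by (simp add: mid_def)
  moreover have "mid\<^sup>2 = half_gap\<^sup>2 + \<alpha> * \<beta>"
    by (simp add: mid_def half_gap_def power2_eq_square field_simps)
  moreover have "(half_gap * nrm (S w))\<^sup>2 = half_gap\<^sup>2 * ip (S w) (S w)"
    using w by (simp add: power_mult_distrib nrm_squared)
  ultimately show "(half_gap * nrm (S w))\<^sup>2 \<le> (nrm (w - mid *\<^sub>R S w))\<^sup>2"
    using form_nonneg[OF w] by (simp add: distrib_right)
qed (use w in auto)

text \<open>This is \<open>(L - mid) S\<close>, a bounded symmetric substitute for
  \<open>L - mid\<close> that is defined on all of \<open>V\<close>.\<close>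

definition B :: "'v \<Rightarrow> 'v" where "B w = w - mid *\<^sub>R S w"

lemma B_in [simp, intro]: "w \<in> V \<Longrightarrow> B w \<in> V"
  by (simp add: B_def)

lemma B_sym: "u \<in> V \<Longrightarrow> v \<in> V \<Longrightarrow> ip (B u) v = ip u (B v)"
  by (simp add: B_def ip_bilinear S_sym)

text \<open>\<open>w\<close> is the sum of \<open>mid S w\<close> and \<open>B w\<close>, and the
  gap inequality bounds the first summand by the second.\<close>

lemma B_coercive:
  assumes w: "w \<in> V"
  shows "nrm w \<le> (1 + mid / half_gap) * nrm (B w)"
proof -
  have "nrm w \<le> nrm (mid *\<^sub>R S w) + nrm (w - mid *\<^sub>R S w)"
    using w by (intro nrm_le_add_diff) auto
  also have "nrm (mid *\<^sub>R S w) = mid * nrm (S w)"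
    using mid_pos w by (simp add: nrm_scale)
  also have "nrm (S w) \<le> nrm (B w) / half_gap"
    using gap_inequality[OF w] half_gap_pos by (simp add: B_def field_simps)
  finally show ?thesis using mid_pos by (simp add: B_def mult_left_mono algebra_simps)
qed

lemma B_diff:
  assumes "u \<in> V" "v \<in> V"
  shows "nrm (B u - B v) \<le> (1 + mid * \<kappa>) * nrm (u - v)"
proof -
  have "B u - B v = (u - v) - mid *\<^sub>R (S u - S v)" by (simp add: B_def algebra_simps)
  also have "nrm \<dots> \<le> nrm (u - v) + nrm (mid *\<^sub>R (S u - S v))"
    using assms by (intro nrm_diff_le) auto
  also have "nrm (mid *\<^sub>R (S u - S v)) \<le> mid * (\<kappa> * nrm (u - v))"
    using mid_pos S_diff[OF assms] assms by (simp add: nrm_scale)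
  finally show ?thesis by (simp add: algebra_simps)
qed

lemma B_bound:
  assumes "u \<in> V"
  shows "nrm (B u) \<le> (1 + mid * \<kappa>) * nrm u"
proof -
  have "nrm (B u) \<le> nrm u + nrm (mid *\<^sub>R S u)"
    unfolding B_def using assms by (intro nrm_diff_le) auto
  also have "nrm (mid *\<^sub>R S u) \<le> mid * (\<kappa> * nrm u)"
    using mid_pos S_bound[OF assms] assms by (simp add: nrm_scale)
  finally show ?thesis by (simp add: algebra_simps)
qed

text \<open>Boundedness and coercivity of \<open>B\<close> make this product equivalent to
  \<open>ip\<close>, hence complete, so that Riesz representation is available for it.\<close>

lemma semi_hilbert_B: "semi_hilbert V (\<lambda>u v. ip (B u) (B v))"
proof
  fix x :: "nat \<Rightarrow> 'v"
  assume x: "\<And>n. x n \<in> V"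
    and cauchy: "\<And>e. e > 0 \<Longrightarrow> \<exists>N. \<forall>m\<ge>N. \<forall>n\<ge>N. ip (B (x m - x n)) (B (x m - x n)) < e"
  define C where "C = 1 + mid / half_gap"
  have C: "C > 0" using mid_pos half_gap_pos by (simp add: C_def add_pos_pos)
  have "\<exists>N. \<forall>m\<ge>N. \<forall>n\<ge>N. nrm (x m - x n) < e" if e: "e > 0" for e
  proof -
    obtain N where N: "\<forall>m\<ge>N. \<forall>n\<ge>N. ip (B (x m - x n)) (B (x m - x n)) < (e / C)\<^sup>2"
      using cauchy[of "(e / C)\<^sup>2"] e C by auto
    have "nrm (x m - x n) < e" if "m \<ge> N" "n \<ge> N" for m n
    proof -
      have "(nrm (B (x m - x n)))\<^sup>2 < (e / C)\<^sup>2" using N that x by (simp add: nrm_squared)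
      then have "nrm (B (x m - x n)) < e / C" by (rule power_less_imp_less_base) (use e C in simp)
      then have "C * nrm (B (x m - x n)) < e" using C by (simp add: field_simps)
      then show ?thesis using B_coercive[of "x m - x n"] x by (simp add: C_def)
    qed
    then show ?thesis by blast
  qed
  then obtain l where l: "l \<in> V" and lim: "(\<lambda>n. nrm (x n - l)) \<longlonglongrightarrow> 0"
    using nrm_complete[of x] x by blast
  have "(\<lambda>n. (nrm (B (x n - l)))\<^sup>2) \<longlonglongrightarrow> 0"
  proof (rule Lim_null_comparison)
    have "nrm (B (x n - l)) \<le> (1 + mid * \<kappa>) * nrm (x n - l)" for n
      using x l by (intro B_bound) auto
    then show "eventually (\<lambda>n. norm ((nrm (B (x n - l)))\<^sup>2) \<le> ((1 + mid * \<kappa>) * nrm (x n - l))\<^sup>2) sequentially"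
      using x l by (intro always_eventually allI) (simp add: power_mono)
    have "(\<lambda>n. ((1 + mid * \<kappa>) * nrm (x n - l))\<^sup>2) \<longlonglongrightarrow> ((1 + mid * \<kappa>) * 0)\<^sup>2"
      by (intro tendsto_intros lim)
    then show "(\<lambda>n. ((1 + mid * \<kappa>) * nrm (x n - l))\<^sup>2) \<longlonglongrightarrow> 0" by simp
  qed
  then show "\<exists>l\<in>V. (\<lambda>n. ip (B (x n - l)) (B (x n - l))) \<longlonglongrightarrow> 0"
    using l x by (auto simp: nrm_squared)
next
  show "subspace V" by (rule subspace)
  fix u v w :: 'v and r :: real
  assume u: "u \<in> V"
  { assume w: "w \<in> V"
    show "ip (B (r *\<^sub>R u)) (B w) = r * ip (B u) (B w)"
      using u w by (simp add: B_sym ip_scale_left)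
    assume v: "v \<in> V"
    show "ip (B (u + v)) (B w) = ip (B u) (B w) + ip (B v) (B w)"
      using u v w by (simp add: B_sym ip_add_left) }
  { assume v: "v \<in> V"
    show "ip (B u) (B v) = ip (B v) (B u)" using u v by (simp add: ip_commute) }
  show "ip (B u) (B u) \<ge> 0" using u by (simp add: ip_nonneg)
qed

text \<open>Riesz representation in the product twisted by \<open>B\<close> yields \<open>w\<close>
  with \<open>B (B w) = h\<close> modulo null vectors, by symmetry of \<open>B\<close>; the preimage
  is \<open>B w\<close>.\<close>

lemma B_surj:
  assumes h: "h \<in> V"
  shows "\<exists>u\<in>V. nrm (B u - h) = 0"
proof -
  interpret B: semi_hilbert V "\<lambda>u v. ip (B u) (B v)" by (rule semi_hilbert_B)
  have "\<bar>ip h v\<bar> \<le> (nrm h * (1 + mid / half_gap)) * B.nrm v" if v: "v \<in> V" for v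
  proof -
    have "\<bar>ip h v\<bar> \<le> nrm h * nrm v" using cauchy_schwarz h v by simp
    also have "\<dots> \<le> nrm h * ((1 + mid / half_gap) * nrm (B v))"
      using B_coercive[OF v] h by (intro mult_left_mono) auto
    finally show ?thesis by (simp add: B.nrm_def nrm_def mult.assoc)
  qed
  then have "\<exists>w\<in>V. \<forall>v\<in>V. ip (B w) (B v) = ip h v"
    by (intro B.riesz) (auto simp: h ip_add_right ip_scale_right)
  then obtain w where w: "w \<in> V" and eq: "\<And>v. v \<in> V \<Longrightarrow> ip (B w) (B v) = ip h v" by blast
  have "nrm (B (B w) - h) = 0"
  proof (rule null_if_orthogonal)
    fix v assume v: "v \<in> V"
    show "ip (B (B w) - h) v = 0"
      using w h v by (simp add: ip_diff_left B_sym[of "B w" v] eq)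
  qed (use w h in auto)
  then show ?thesis using w by blast
qed

text \<open>\<open>u\<close> solves \<open>-\<L>\<^sub>K u - mid u = w\<close>, the operator being inverted by \<open>S\<close>.\<close>

definition solves :: "'v \<Rightarrow> 'v \<Rightarrow> bool" where
  "solves u w \<longleftrightarrow> nrm (u - S (mid *\<^sub>R u + w)) = 0"

text \<open>Splitting \<open>S (mid u + w)\<close> modulo null vectors turns the implicit relation
  into a linear equation for \<open>B\<close>.\<close>

lemma solves_iff:
  assumes "u \<in> V" "w \<in> V"
  shows "solves u w \<longleftrightarrow> nrm (B u - S w) = 0"
proof -
  have "nrm ((u - S (mid *\<^sub>R u + w)) - (B u - S w)) = 0"
    using assms by (intro null_if_orthogonal diff_in B_in S_in add_in scale_in)
      (use assms in \<open>simp_all add: ip_diff_left ip_add_left ip_scale_left S_sym B_sym\<close>, simp add: B_def ip_bilinear S_sym)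
  then show ?thesis
    using assms nrm_cong_null[of "u - S (mid *\<^sub>R u + w)" "B u - S w"] by (simp add: solves_def)
qed

lemma solves_ex: "w \<in> V \<Longrightarrow> \<exists>u\<in>V. solves u w"
  using B_surj[of "S w"] solves_iff by auto

lemma solves_diff:
  assumes "u \<in> V" "w \<in> V" "solves u w" "u' \<in> V" "w' \<in> V" "solves u' w'"
  shows "solves (u - u') (w - w')"
proof -
  have "nrm ((u - u') - S (mid *\<^sub>R (u - u') + (w - w'))) = 0"
  proof (rule null_if_orthogonal)
    fix v assume v: "v \<in> V"
    have "ip (u - S (mid *\<^sub>R u + w)) v = 0" "ip (u' - S (mid *\<^sub>R u' + w')) v = 0"
      using assms v by (auto intro!: ip_null simp: solves_def)
    then show "ip ((u - u') - S (mid *\<^sub>R (u - u') + (w - w'))) v = 0"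
      using assms v by (simp add: ip_bilinear S_sym algebra_simps)
  qed (use assms in auto)
  then show ?thesis by (simp add: solves_def)
qed

text \<open>At \<open>?z = mid u + w\<close> the equation gives \<open>S ?z = u\<close> and
  \<open>?z - mid S ?z = w\<close> modulo null vectors, so the gap inequality applies directly.
  Together with \<open>solves_diff\<close> it gives the solution map the Lipschitz constant
  \<open>1 / half_gap\<close>.\<close>

lemma solves_bound:
  assumes u: "u \<in> V" and w: "w \<in> V" and sol: "solves u w"
  shows "half_gap * nrm u \<le> nrm w"
proof -
  let ?z = "mid *\<^sub>R u + w"
  have "nrm ((?z - mid *\<^sub>R S ?z) - w) = nrm (mid *\<^sub>R (u - S ?z))"
    by (simp add: algebra_simps)
  also have "\<dots> = 0" using sol u w by (simp add: nrm_scale solves_def)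
  finally have "nrm (?z - mid *\<^sub>R S ?z) = nrm w" using u w by (intro nrm_cong_null) auto
  moreover have "nrm u = nrm (S ?z)"
    using sol u w by (intro nrm_cong_null) (auto simp: solves_def)
  ultimately show ?thesis using gap_inequality[of ?z] u w by simp
qed

lemma solves_argument_bound:
  assumes G_in: "\<And>u. u \<in> V \<Longrightarrow> G u \<in> V"
    and G_growth: "\<And>v. v \<in> V \<Longrightarrow> nrm (G v) \<le> nrm (G 0) + d * nrm v"
    and u: "u \<in> V" and s: "0 \<le> s" "s < 1"
  shows "nrm (mid *\<^sub>R u + s *\<^sub>R G u) \<le> mid * nrm u + (nrm (G 0) + d * nrm u)"
proof -
  have "nrm (mid *\<^sub>R u + s *\<^sub>R G u) \<le> nrm (mid *\<^sub>R u) + nrm (s *\<^sub>R G u)"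
    using u G_in by (intro nrm_triangle) auto
  also have "\<dots> = mid * nrm u + s * nrm (G u)"
    using u G_in mid_pos s by (simp add: nrm_scale)
  also have "\<dots> \<le> mid * nrm u + 1 * (nrm (G 0) + d * nrm u)"
    using s G_growth[OF u] u G_in by (intro add_left_mono mult_mono) auto
  finally show ?thesis by simp
qed

text \<open>The asymptotic hypothesis \<open>nonresonant\<close> yields the a priori bound for the fixed points of the
  contractions \<open>s T \<circ> G\<close> with \<open>s < 1\<close>, where \<open>T\<close> is the solution operator of \<open>solves\<close>; compactness then
  allows the passage to \<open>s = 1\<close>.\<close>

lemma nonlinear_solution:
  assumes G_in: "\<And>u. u \<in> V \<Longrightarrow> G u \<in> V"
    and G_lipschitz: "\<And>u v. u \<in> V \<Longrightarrow> v \<in> V \<Longrightarrow> nrm (G u - G v) \<le> half_gap * nrm (u - v)"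
    and nonresonant: "\<And>u v. (\<And>n. u n \<in> V) \<Longrightarrow> v \<in> V \<Longrightarrow>
        filterlim (\<lambda>n. nrm (u n)) at_top sequentially \<Longrightarrow>
        (\<lambda>n. nrm ((1 / nrm (u n)) *\<^sub>R u n - v)) \<longlonglongrightarrow> 0 \<Longrightarrow>
        (\<And>n. half_gap * nrm (u n) \<le> nrm (G (u n))) \<Longrightarrow> False"
  shows "\<exists>u\<in>V. solves u (G u)"
proof -
  define d where "d = half_gap"
  have d: "d > 0" using half_gap_pos by (simp add: d_def)
  have G_lip: "nrm (G u - G v) \<le> d * nrm (u - v)" if "u \<in> V" "v \<in> V" for u v
    using G_lipschitz that by (simp add: d_def)
  have approx: "\<exists>u\<in>V. solves u (s *\<^sub>R G u)" if s: "0 \<le> s" "s < 1" for s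
  proof -
    \<comment> \<open>A chosen solution, unique up to null vectors. The gap bound and the Lipschitz
      constant of \<open>G\<close> both carry the factor \<open>half_gap\<close>; these cancel and
      leave the contraction factor \<open>s\<close>.\<close>
    define \<phi> where "\<phi> u = (SOME t. t \<in> V \<and> solves t (s *\<^sub>R G u))" for u
    have "\<phi> u \<in> V \<and> solves (\<phi> u) (s *\<^sub>R G u)" if "u \<in> V" for u
      unfolding \<phi>_def by (rule someI_ex) (use solves_ex[OF scale_in[OF G_in[OF that]]] in blast)
    then have \<phi>: "\<And>u. u \<in> V \<Longrightarrow> \<phi> u \<in> V" "\<And>u. u \<in> V \<Longrightarrow> solves (\<phi> u) (s *\<^sub>R G u)"
      by auto
    have "nrm (\<phi> u - \<phi> v) \<le> s * nrm (u - v)" if uv: "u \<in> V" "v \<in> V" for u v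
    proof -
      have "d * nrm (\<phi> u - \<phi> v) \<le> nrm (s *\<^sub>R G u - s *\<^sub>R G v)"
        unfolding d_def using uv \<phi> G_in by (intro solves_bound solves_diff) auto
      also have "\<dots> = s * nrm (G u - G v)"
        using uv G_in s by (simp flip: scaleR_diff_right add: nrm_scale)
      also have "\<dots> \<le> s * (d * nrm (u - v))" using s uv by (intro mult_left_mono G_lip) auto
      also have "\<dots> = d * (s * nrm (u - v))" by simp
      finally show ?thesis using d by simp
    qed
    then obtain u where u: "u \<in> V" and fixp: "nrm (\<phi> u - u) = 0"
      using contraction_fixpoint[of \<phi> s] \<phi>(1) s by blast
    have "solves u (s *\<^sub>R G u)"
    proof -
      \<comment> \<open>\<open>u\<close> and \<open>\<phi> u\<close> agree only up to length 0, so
        \<open>solves\<close> has to be carried from one to the other through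
        \<open>B\<close>.\<close>
      have "nrm (B u - B (\<phi> u)) = 0"
        using B_diff[of u "\<phi> u"] fixp nrm_diff_commute[of u "\<phi> u"] u \<phi>(1)[OF u]
        by (intro antisym nrm_nonneg diff_in B_in) simp_all
      moreover have "nrm (B (\<phi> u) - S (s *\<^sub>R G u)) = 0"
        using \<phi> u G_in by (subst solves_iff[symmetric]) auto
      ultimately have "nrm (B u - S (s *\<^sub>R G u)) = 0"
        using nrm_triangle_diff[of "B u" "B (\<phi> u)" "S (s *\<^sub>R G u)"] u \<phi>(1)[OF u] G_in[OF u]
        by (intro antisym nrm_nonneg diff_in B_in S_in scale_in) simp_all
      then show ?thesis using u G_in by (simp add: solves_iff)
    qed
    then show ?thesis using u by blast
  qed
  define s where "s n = 1 - inverse (real (Suc n))" for n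
  have s: "0 \<le> s n" "s n < 1" for n by (auto simp: s_def field_simps)
  have s_lim: "s \<longlonglongrightarrow> 1"
  proof -
    have "(\<lambda>n. 1 - inverse (real (Suc n))) \<longlonglongrightarrow> 1 - 0"
      by (intro tendsto_intros LIMSEQ_inverse_real_of_nat)
    then show ?thesis by (simp add: s_def[abs_def])
  qed
  obtain u where u: "\<And>n. u n \<in> V" and sol: "\<And>n. solves (u n) (s n *\<^sub>R G (u n))"
    using approx[OF s] by metis
  have G_growth: "nrm (G v) \<le> nrm (G 0) + d * nrm v" if "v \<in> V" for v
    using nrm_le_add_diff[of "G v" "G 0"] G_lip[of v 0] that G_in by auto
  have bounded: "\<exists>M. \<forall>n. nrm (u n) \<le> M"
  proof (rule ccontr)
    assume unbounded: "\<not> ?thesis"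
    \<comment> \<open>The \<open>+ 1\<close> keeps these norms at least 1, so that the constant
      \<open>nrm (G 0)\<close> stays bounded after division by them.\<close>
    have "\<exists>k. real n + 1 < nrm (u k)" for n
      using unbounded not_le by blast
    then obtain k where k: "\<And>n. real n + 1 < nrm (u (k n))" by metis
    define x where "x n = u (k n)" for n
    have x: "x n \<in> V" for n using u by (simp add: x_def)
    have x_big: "nrm (x n) > real n + 1" for n using k by (simp add: x_def)
    have x1: "nrm (x n) \<ge> 1" for n using x_big[of n] by linarith
    have x_top: "filterlim (\<lambda>n. nrm (x n)) at_top sequentially"
    proof (rule filterlim_at_top_mono[OF filterlim_real_sequentially])
      have "real n \<le> nrm (x n)" for n using x_big[of n] by linarith
      then show "eventually (\<lambda>n. real n \<le> nrm (x n)) sequentially" by simp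
    qed
    \<comment> \<open>The normalised solution is \<open>S (w n)\<close> up to length 0. As
      \<open>w n\<close> is bounded, compactness of \<open>S\<close> gives the strong convergence
      that \<open>nonresonant\<close> requires.\<close>
    define w where "w n = (1 / nrm (x n)) *\<^sub>R (mid *\<^sub>R x n + s (k n) *\<^sub>R G (x n))" for n
    have w: "w n \<in> V" for n using x G_in by (simp add: w_def)
    have "nrm (w n) \<le> mid + (nrm (G 0) + d)" for n
    proof -
      have "nrm (mid *\<^sub>R x n + s (k n) *\<^sub>R G (x n)) \<le> mid * nrm (x n) + (nrm (G 0) + d * nrm (x n))"
        by (rule solves_argument_bound[OF G_in G_growth x s])
      also have "\<dots> \<le> mid * nrm (x n) + (nrm (G 0) * nrm (x n) + d * nrm (x n))"
        using mult_left_mono[OF x1[of n] nrm_nonneg[OF G_in[OF zero_in]]] by simp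
      also have "\<dots> = (mid + (nrm (G 0) + d)) * nrm (x n)" by (simp add: algebra_simps)
      finally show ?thesis
        using x1[of n] x G_in by (simp add: w_def nrm_scale divide_simps)
    qed
    then obtain r v where r: "strict_mono r" and v: "v \<in> V" and lim: "(\<lambda>n. nrm (S (w (r n)) - v)) \<longlonglongrightarrow> 0"
      using S_compact[of w] w by blast
    have near: "nrm ((1 / nrm (x n)) *\<^sub>R x n - S (w n)) = 0" for n
    proof (rule null_if_orthogonal)
      fix z assume z: "z \<in> V"
      have "ip (x n - S (mid *\<^sub>R x n + s (k n) *\<^sub>R G (x n))) z = 0"
        using sol[of "k n"] x z G_in by (intro ip_null) (auto simp: x_def solves_def)
      then show "ip ((1 / nrm (x n)) *\<^sub>R x n - S (w n)) z = 0"
        using x G_in z unfolding w_def by (simp add: ip_diff_left S_scale_left ip_scale_left)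
    qed (use x w in auto)
    show False
    proof (rule nonresonant)
      show "x (r n) \<in> V" for n by (rule x)
      show "v \<in> V" by (rule v)
      show "filterlim (\<lambda>n. nrm (x (r n))) at_top sequentially"
        using filterlim_compose[OF x_top filterlim_subseq[OF r]] by simp
      have "nrm ((1 / nrm (x n)) *\<^sub>R x n - v) = nrm (S (w n) - v)" for n
        using near[of n] x w v by (intro nrm_cong_null) auto
      then show "(\<lambda>n. nrm ((1 / nrm (x (r n))) *\<^sub>R x (r n) - v)) \<longlonglongrightarrow> 0" using lim by simp
      show "half_gap * nrm (x (r n)) \<le> nrm (G (x (r n)))" for n
      proof -
        have "half_gap * nrm (x (r n)) \<le> nrm (s (k (r n)) *\<^sub>R G (x (r n)))"
          using x sol G_in by (intro solves_bound) (auto simp: x_def)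
        also have "\<dots> = s (k (r n)) * nrm (G (x (r n)))"
          using s x G_in by (simp add: nrm_scale)
        also have "\<dots> \<le> 1 * nrm (G (x (r n)))"
          using s[of "k (r n)"] by (intro mult_right_mono nrm_nonneg G_in x) simp
        finally show ?thesis by simp
      qed
    qed
  qed
  then obtain M where M: "\<And>n. nrm (u n) \<le> M" by blast
  define w where "w n = mid *\<^sub>R u n + s n *\<^sub>R G (u n)" for n
  have w: "w n \<in> V" for n using u G_in by (simp add: w_def)
  have "nrm (w n) \<le> mid * M + (nrm (G 0) + d * M)" for n
  proof -
    have "nrm (w n) \<le> mid * nrm (u n) + (nrm (G 0) + d * nrm (u n))"
      unfolding w_def by (rule solves_argument_bound[OF G_in G_growth u s])
    also have "\<dots> \<le> mid * M + (nrm (G 0) + d * M)"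
      using M[of n] mid_pos d by (auto intro!: add_mono mult_left_mono)
    finally show ?thesis .
  qed
  then obtain r v where r: "strict_mono r" and v: "v \<in> V" and lim: "(\<lambda>n. nrm (S (w (r n)) - v)) \<longlonglongrightarrow> 0"
    using S_compact[of w] w by blast
  have u_lim: "(\<lambda>n. nrm (u (r n) - v)) \<longlonglongrightarrow> 0"
  proof -
    have "nrm (u n - v) = nrm (S (w n) - v)" for n
      using sol[of n] u w v by (intro nrm_cong_null) (auto simp: solves_def w_def)
    then show ?thesis using lim by simp
  qed
  define W where "W = mid *\<^sub>R v + G v"
  have W: "W \<in> V" using v G_in by (simp add: W_def)
  \<comment> \<open>The first term is the Lipschitz continuity of the right-hand side; the second is
    the effect of the damping \<open>1 - s n\<close>, harmless because the sequence \<open>u\<close>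
    is bounded.\<close>
  have wW: "nrm (w n - W) \<le> (mid + d) * nrm (u n - v) + (1 - s n) * (nrm (G 0) + d * M)" for n
  proof -
    have "w n - W = (mid *\<^sub>R (u n - v) + (G (u n) - G v)) - (1 - s n) *\<^sub>R G (u n)"
      by (simp add: w_def W_def algebra_simps)
    also have "nrm \<dots> \<le> nrm (mid *\<^sub>R (u n - v) + (G (u n) - G v)) + nrm ((1 - s n) *\<^sub>R G (u n))"
      using u v G_in by (intro nrm_diff_le) auto
    also have "\<dots> \<le> (nrm (mid *\<^sub>R (u n - v)) + nrm (G (u n) - G v)) + nrm ((1 - s n) *\<^sub>R G (u n))"
      using u v G_in by (intro add_right_mono nrm_triangle) auto
    also have "\<dots> \<le> (mid * nrm (u n - v) + d * nrm (u n - v)) + (1 - s n) * (nrm (G 0) + d * M)"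
    proof (intro add_mono)
      show "nrm (mid *\<^sub>R (u n - v)) \<le> mid * nrm (u n - v)" using u v mid_pos by (simp add: nrm_scale)
      show "nrm (G (u n) - G v) \<le> d * nrm (u n - v)" using u v by (rule G_lip)
      have "d * nrm (u n) \<le> d * M" using d M by simp
      then have "nrm (G (u n)) \<le> nrm (G 0) + d * M" using G_growth[OF u, of n] by linarith
      then have "(1 - s n) * nrm (G (u n)) \<le> (1 - s n) * (nrm (G 0) + d * M)"
        using s[of n] by (intro mult_left_mono) auto
      then show "nrm ((1 - s n) *\<^sub>R G (u n)) \<le> (1 - s n) * (nrm (G 0) + d * M)"
        using s[of n] u G_in by (simp add: nrm_scale)
    qed
    finally show ?thesis by (simp add: algebra_simps)
  qed
  have main: "nrm (v - S W) \<le> nrm (u (r n) - v) + \<kappa> * ((mid + d) * nrm (u (r n) - v) + (1 - s (r n)) * (nrm (G 0) + d * M))" for n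
  proof -
    have "nrm (v - S W) \<le> nrm (v - u (r n)) + nrm (u (r n) - S W)"
      using u v W by (intro nrm_triangle_diff) auto
    also have "nrm (u (r n) - S W) \<le> nrm (u (r n) - S (w (r n))) + nrm (S (w (r n)) - S W)"
      using u w W by (intro nrm_triangle_diff) auto
    also have "nrm (u (r n) - S (w (r n))) = 0" using sol[of "r n"] by (simp add: solves_def w_def)
    also have "nrm (S (w (r n)) - S W) \<le> \<kappa> * nrm (w (r n) - W)" using w W by (rule S_diff)
    also have "\<dots> \<le> \<kappa> * ((mid + d) * nrm (u (r n) - v) + (1 - s (r n)) * (nrm (G 0) + d * M))"
      using wW \<kappa>_pos by (intro mult_left_mono) auto
    also have "nrm (v - u (r n)) = nrm (u (r n) - v)" using u v by (simp add: nrm_diff_commute)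
    finally show ?thesis by simp
  qed
  have "(\<lambda>n. nrm (u (r n) - v) + \<kappa> * ((mid + d) * nrm (u (r n) - v) + (1 - s (r n)) * (nrm (G 0) + d * M)))
      \<longlonglongrightarrow> 0 + \<kappa> * ((mid + d) * 0 + (1 - 1) * (nrm (G 0) + d * M))"
    using LIMSEQ_subseq_LIMSEQ[OF s_lim r] by (intro tendsto_intros u_lim) (simp add: o_def)
  then have "nrm (v - S W) \<le> 0 + \<kappa> * ((mid + d) * 0 + (1 - 1) * (nrm (G 0) + d * M))"
    using main by (intro LIMSEQ_le_const) auto
  then have "solves v (G v)"
    unfolding solves_def W_def[symmetric] using v W by (intro antisym nrm_nonneg diff_in S_in) auto
  then show ?thesis using v by blast
qed

end

section \<open>Square integrable functions\<close>

text \<open>Pointwise scaling completes the additive structure on functions, so that sets of honest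
  functions can be carriers of \<open>semi_hilbert\<close>.\<close>

instantiation "fun" :: (type, real_vector) real_vector
begin

definition "scaleR_fun r f = (\<lambda>x. r *\<^sub>R f x)"

instance
  by standard (simp_all add: scaleR_fun_def fun_eq_iff scaleR_add_right scaleR_add_left)

end

lemma scaleR_fun_apply [simp]: "(r *\<^sub>R f) x = r *\<^sub>R f x"
  by (simp add: scaleR_fun_def)

section \<open>Diagonal extraction of Cauchy subsequences\<close>

lemma common_convergent_subseq:
  fixes L :: "'i \<Rightarrow> nat \<Rightarrow> real"
  assumes "finite I" "\<And>z. z \<in> I \<Longrightarrow> bounded (range (L z))"
  shows "\<exists>r :: nat \<Rightarrow> nat. strict_mono r \<and> (\<forall>z\<in>I. convergent (L z \<circ> r))"
  using assms
proof (induction I rule: finite_induct)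
  case empty
  show ?case by (intro exI[of _ id]) (auto simp: strict_mono_def)
next
  case (insert z I)
  then have "\<exists>r :: nat \<Rightarrow> nat. strict_mono r \<and> (\<forall>z\<in>I. convergent (L z \<circ> r))" by blast
  then obtain r :: "nat \<Rightarrow> nat" where r: "strict_mono r" "\<forall>z\<in>I. convergent (L z \<circ> r)"
    by blast
  have "bounded (range (L z \<circ> r))"
    by (rule bounded_subset[OF insert.prems[of z]]) auto
  then obtain l and r' :: "nat \<Rightarrow> nat" where r': "strict_mono r'" "((L z \<circ> r) \<circ> r') \<longlonglongrightarrow> l"
    using bounded_imp_convergent_subsequence by blast
  have "\<forall>z'\<in>insert z I. convergent (L z' \<circ> (r \<circ> r'))"
    using r r' by (auto simp: convergent_def comp_assoc intro: LIMSEQ_subseq_LIMSEQ[of "L _ \<circ> r", unfolded comp_assoc])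
  then show ?case using strict_mono_o[OF r(1) r'(1)] by blast
qed

text \<open>Total boundedness in scalar form: up to \<epsilon> the distance \<open>D\<close> is
  controlled by finitely many bounded scalar sequences, which may depend on \<epsilon> and converge
  along a common subsequence. A diagonal sequence serves every \<epsilon>.\<close>

lemma cauchy_subseq:
  fixes D :: "nat \<Rightarrow> nat \<Rightarrow> real"
  assumes "\<And>\<epsilon>. \<epsilon> > 0 \<Longrightarrow> \<exists>(I :: 'i set) c L. finite I \<and> (\<forall>z\<in>I. bounded (range (L z :: nat \<Rightarrow> real))) \<and> c \<ge> 0 \<and>
      (\<forall>i j. D i j \<le> \<epsilon> + c * (\<Sum>z\<in>I. (L z i - L z j)\<^sup>2))"
  shows "\<exists>r :: nat \<Rightarrow> nat. strict_mono r \<and> (\<forall>e>0. \<exists>N. \<forall>m\<ge>N. \<forall>n\<ge>N. D (r m) (r n) < e)"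
proof -
  define P where "P n s \<longleftrightarrow> (\<exists>N. \<forall>i\<ge>N. \<forall>j\<ge>N. D (s i) (s j) < inverse (real (Suc n)))" for n and s :: "nat \<Rightarrow> nat"
  interpret subseqs P
  proof
    fix n and s :: "nat \<Rightarrow> nat" assume s: "strict_mono s"
    define e where "e = inverse (real (Suc n)) / 2"
    have e: "e > 0" by (simp add: e_def)
    from assms[OF this] obtain I :: "'i set" and c L where I: "finite I"
      and L: "\<And>z. z \<in> I \<Longrightarrow> bounded (range (L z :: nat \<Rightarrow> real))" and c: "c \<ge> 0"
      and D: "\<And>i j. D i j \<le> e + c * (\<Sum>z\<in>I. (L z i - L z j)\<^sup>2)" by blast
    have "bounded (range (L z \<circ> s))" if "z \<in> I" for z
      by (rule bounded_subset[OF L[OF that]]) auto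
    then obtain r :: "nat \<Rightarrow> nat" where r: "strict_mono r" "\<And>z. z \<in> I \<Longrightarrow> convergent ((L z \<circ> s) \<circ> r)"
      using common_convergent_subseq[OF I, of "\<lambda>z. L z \<circ> s"] by blast
    \<comment> \<open>Chosen so that \<open>c * card I * \<delta>\<^sup>2 < e\<close>; the two
      \<open>+ 1\<close> admit \<open>c = 0\<close> and an empty \<open>I\<close>, and
      \<open>e\<close> is half of the target.\<close>
    define \<delta> where "\<delta> = sqrt (e / ((c + 1) * (real (card I) + 1)))"
    have q: "e / ((c + 1) * (real (card I) + 1)) > 0" using e c by (intro divide_pos_pos mult_pos_pos) auto
    then have \<delta>: "\<delta> > 0" by (simp add: \<delta>_def)
    have "\<exists>N. \<forall>i\<ge>N. \<forall>j\<ge>N. \<bar>L z (s (r i)) - L z (s (r j))\<bar> < \<delta>" if "z \<in> I" for z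
      using convergent_Cauchy[OF r(2)[OF that]] \<delta> unfolding Cauchy_def by (auto simp: dist_real_def)
    then obtain N where N: "\<And>z i j. z \<in> I \<Longrightarrow> i \<ge> N z \<Longrightarrow> j \<ge> N z \<Longrightarrow> \<bar>L z (s (r i)) - L z (s (r j))\<bar> < \<delta>"
      by metis
    define M where "M = Max (insert 0 (N ` I))"
    have M: "N z \<le> M" if "z \<in> I" for z using I that by (auto simp: M_def)
    have "D (s (r i)) (s (r j)) < inverse (real (Suc n))" if "i \<ge> M" "j \<ge> M" for i j
    proof -
      have "(\<Sum>z\<in>I. (L z (s (r i)) - L z (s (r j)))\<^sup>2) \<le> (\<Sum>z\<in>I. \<delta>\<^sup>2)"
      proof (rule sum_mono)
        fix z assume z: "z \<in> I"
        have "\<bar>L z (s (r i)) - L z (s (r j))\<bar> < \<delta>" using N[OF z] M[OF z] that by force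
        then show "(L z (s (r i)) - L z (s (r j)))\<^sup>2 \<le> \<delta>\<^sup>2"
          using \<delta> by (intro abs_le_square_iff[THEN iffD1]) auto
      qed
      also have "\<dots> = real (card I) * (e / ((c + 1) * (real (card I) + 1)))"
        using q by (simp add: \<delta>_def)
      finally have "c * (\<Sum>z\<in>I. (L z (s (r i)) - L z (s (r j)))\<^sup>2)
          \<le> c * (real (card I) * (e / ((c + 1) * (real (card I) + 1))))"
        using c by (rule mult_left_mono)
      also have "\<dots> = e * (c / (c + 1)) * (real (card I) / (real (card I) + 1))" by simp
      also have "\<dots> \<le> e * (c / (c + 1)) * 1"
        using c e by (intro mult_left_mono) auto
      also have "\<dots> < e" using c e by (simp add: divide_simps)
      finally show ?thesis using D[of "s (r i)" "s (r j)"] by (simp add: e_def)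
    qed
    then show "\<exists>r'. strict_mono r' \<and> P n (s \<circ> r')"
      using r(1) by (auto simp: P_def)
  qed
  \<comment> \<open>Passing to a subsequence preserves \<open>P n\<close> because
    \<open>r n \<ge> n\<close>. This is what the diagonal sequence needs, being a subsequence of
    each extracted one only from some index on.\<close>
  have stable: "P n (s \<circ> r)" if r: "strict_mono r" and s: "P n s" for r s n
  proof -
    obtain N where "\<forall>i\<ge>N. \<forall>j\<ge>N. D (s i) (s j) < inverse (real (Suc n))" using s by (auto simp: P_def)
    then show ?thesis
      unfolding P_def using seq_suble[OF r] by (intro exI[of _ N]) (auto intro: order_trans)
  qed
  have "\<exists>N. \<forall>m\<ge>N. \<forall>n\<ge>N. D (diagseq m) (diagseq n) < e" if e: "e > 0" for e
  proof -
    obtain k where k: "inverse (real (Suc k)) < e" using e reals_Archimedean by blast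
    have "P k (diagseq \<circ> (+) (Suc k))" using stable by (rule diagseq_holds)
    then obtain N where N: "\<And>i j. i \<ge> N \<Longrightarrow> j \<ge> N \<Longrightarrow> D (diagseq (Suc k + i)) (diagseq (Suc k + j)) < inverse (real (Suc k))"
      by (auto simp: P_def)
    have "D (diagseq m) (diagseq n) < e" if "m \<ge> N + Suc k" "n \<ge> N + Suc k" for m n
    proof -
      have "m - Suc k \<ge> N" "n - Suc k \<ge> N" "Suc k + (m - Suc k) = m" "Suc k + (n - Suc k) = n"
        using that by auto
      then show ?thesis using N[of "m - Suc k" "n - Suc k"] k by (metis order.strict_trans)
    qed
    then show ?thesis by blast
  qed
  then show ?thesis using subseq_diagseq by blast
qed

section \<open>Square integrable functions as a semi-Hilbert space\<close>

definition L2 :: "'a measure \<Rightarrow> ('a \<Rightarrow> real) set" where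
  "L2 M = {u \<in> borel_measurable M. integrable M (\<lambda>x. (u x)\<^sup>2)}"

definition L2_ip :: "'a measure \<Rightarrow> ('a \<Rightarrow> real) \<Rightarrow> ('a \<Rightarrow> real) \<Rightarrow> real" where
  "L2_ip M u v = (\<integral>x. u x * v x \<partial>M)"

lemma L2_measurable: "u \<in> L2 M \<Longrightarrow> u \<in> borel_measurable M"
  and L2_integrable_sq: "u \<in> L2 M \<Longrightarrow> integrable M (\<lambda>x. (u x)\<^sup>2)"
  by (auto simp: L2_def)

lemma L2_integrable_mult:
  assumes u: "u \<in> L2 M" and v: "v \<in> L2 M"
  shows "integrable M (\<lambda>x. u x * v x)"
proof (rule Bochner_Integration.integrable_bound)
  show "integrable M (\<lambda>x. (u x)\<^sup>2 + (v x)\<^sup>2)" using u v by (auto simp: L2_def)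
  show "(\<lambda>x. u x * v x) \<in> borel_measurable M" using u v by (auto simp: L2_def)
  have "\<bar>a * b\<bar> \<le> a\<^sup>2 + b\<^sup>2" for a b :: real
  proof -
    have "0 \<le> \<bar>a\<bar> * \<bar>b\<bar>" by simp
    then show ?thesis using sum_squares_bound[of "\<bar>a\<bar>" "\<bar>b\<bar>"] unfolding abs_mult power2_abs by linarith
  qed
  then show "AE x in M. norm (u x * v x) \<le> norm ((u x)\<^sup>2 + (v x)\<^sup>2)" by simp
qed

lemma L2_I_bound:
  assumes "u \<in> borel_measurable M" "v \<in> L2 M" "AE x in M. \<bar>u x\<bar> \<le> \<bar>v x\<bar>"
  shows "u \<in> L2 M"
proof -
  have "integrable M (\<lambda>x. (u x)\<^sup>2)"
  proof (rule Bochner_Integration.integrable_bound[OF L2_integrable_sq[OF assms(2)]])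
    show "AE x in M. norm ((u x)\<^sup>2) \<le> norm ((v x)\<^sup>2)"
      using assms(3) by eventually_elim (simp add: abs_le_square_iff)
  qed (use assms(1) in measurable)
  then show ?thesis using assms(1) by (simp add: L2_def)
qed

lemma L2_add: assumes "u \<in> L2 M" "v \<in> L2 M" shows "(\<lambda>x. u x + v x) \<in> L2 M"
  using assms L2_integrable_mult[OF assms]
  by (auto simp: L2_def power2_sum intro!: Bochner_Integration.integrable_add) (simp add: mult.assoc)

lemma L2_cmult: "u \<in> L2 M \<Longrightarrow> (\<lambda>x. c * u x) \<in> L2 M"
  by (auto simp: L2_def power_mult_distrib)

lemma L2_diff: "u \<in> L2 M \<Longrightarrow> v \<in> L2 M \<Longrightarrow> (\<lambda>x. u x - v x) \<in> L2 M"
  using L2_add[of u M "\<lambda>x. - 1 * v x"] L2_cmult[of v M "-1"] by simp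

lemma L2_abs: "u \<in> L2 M \<Longrightarrow> (\<lambda>x. \<bar>u x\<bar>) \<in> L2 M"
  by (auto simp: L2_def)

lemma subspace_L2: "subspace (L2 M)"
  unfolding subspace_def
  using L2_add[of _ M] L2_cmult[of _ M] by (auto simp: plus_fun_def scaleR_fun_def zero_fun_def L2_def)

lemma (in finite_measure) const_in_L2: "(\<lambda>_. c) \<in> L2 M"
  by (simp add: L2_def)

lemma (in finite_measure) L2_integrable: "u \<in> L2 M \<Longrightarrow> integrable M u"
  using L2_integrable_mult[OF _ const_in_L2[of 1]] by simp

text \<open>Pointwise \<open>\<bar>u x\<bar> \<le> t + (u x)\<^sup>2 / t\<close>; the free
  \<open>t\<close> balances the total measure against the square integral.\<close>

lemma (in finite_measure) L1_le_L2:
  assumes u: "u \<in> L2 M" and t: "t > 0"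
  shows "(\<integral>x. \<bar>u x\<bar> \<partial>M) \<le> t * measure M (space M) + (\<integral>x. (u x)\<^sup>2 \<partial>M) / t"
proof -
  have "(\<integral>x. \<bar>u x\<bar> \<partial>M) \<le> (\<integral>x. t + (u x)\<^sup>2 / t \<partial>M)"
  proof (rule integral_mono)
    show "integrable M (\<lambda>x. \<bar>u x\<bar>)" using L2_integrable[OF u] by simp
    show "integrable M (\<lambda>x. t + (u x)\<^sup>2 / t)" using L2_integrable_sq[OF u] by simp
    fix x
    have "\<bar>u x\<bar> * t \<le> t\<^sup>2 + \<bar>u x\<bar>\<^sup>2"
    proof -
      have "0 \<le> \<bar>u x\<bar> * t" using t by simp
      then show ?thesis using sum_squares_bound[of "\<bar>u x\<bar>" t] by linarith
    qed
    then show "\<bar>u x\<bar> \<le> t + (u x)\<^sup>2 / t" using t by (simp add: field_simps power2_eq_square)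
  qed
  also have "\<dots> = t * measure M (space M) + (\<integral>x. (u x)\<^sup>2 \<partial>M) / t"
    using L2_integrable_sq[OF u] by simp
  finally show ?thesis .
qed

lemma (in finite_measure) L2_cauchy_AE_subseq:
  assumes x: "\<And>n. x n \<in> L2 M"
    and cauchy: "\<And>e. e > 0 \<Longrightarrow> \<exists>N. \<forall>m\<ge>N. \<forall>n\<ge>N. (\<integral>y. (x m y - x n y)\<^sup>2 \<partial>M) < e"
  shows "\<exists>r l. strict_mono (r :: nat \<Rightarrow> nat) \<and> l \<in> borel_measurable M \<and> (AE y in M. (\<lambda>n. x (r n) y) \<longlonglongrightarrow> l y)"
proof -
  have "\<exists>N. \<forall>i\<ge>N. \<forall>j\<ge>N. (LINT y|M. norm (x i y - x j y)) < e" if e: "e > 0" for e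
  proof -
    \<comment> \<open>Half of \<open>e\<close> pays for the measure term; the other half fixes how
      small the square integral must become, namely below \<open>t * (e / 2)\<close>.\<close>
    define t where "t = e / (2 * (measure M (space M) + 1))"
    have t: "t > 0" using e by (auto simp: t_def intro!: divide_pos_pos add_nonneg_pos)
    have t1: "t * measure M (space M) \<le> e / 2"
    proof -
      have "t * measure M (space M) \<le> t * (measure M (space M) + 1)" using t by simp
      also have "\<dots> = e / 2"
      proof -
        have "measure M (space M) + 1 \<noteq> 0" using measure_nonneg[of M "space M"] by linarith
        then show ?thesis unfolding t_def by (metis nonzero_mult_divide_mult_cancel_right times_divide_eq_left)
      qed
      finally show ?thesis .
    qed
    obtain N where N: "\<And>m n. m \<ge> N \<Longrightarrow> n \<ge> N \<Longrightarrow> (\<integral>y. (x m y - x n y)\<^sup>2 \<partial>M) < t * (e / 2)"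
      using cauchy[of "t * (e / 2)"] mult_pos_pos[OF t, of "e / 2"] e by auto
    have "(LINT y|M. norm (x i y - x j y)) < e" if "i \<ge> N" "j \<ge> N" for i j
    proof -
      have "(LINT y|M. norm (x i y - x j y)) \<le> t * measure M (space M) + (\<integral>y. (x i y - x j y)\<^sup>2 \<partial>M) / t"
        using L1_le_L2[OF L2_diff[OF x x] t, of i j] by simp
      moreover have "(\<integral>y. (x i y - x j y)\<^sup>2 \<partial>M) / t < e / 2"
        using N[OF that] t by (simp add: field_simps)
      ultimately show ?thesis using t1 by linarith
    qed
    then show ?thesis by blast
  qed
  then obtain r where r: "strict_mono r" and ae: "AE y in M. Cauchy (\<lambda>i. x (r i) y)"
    using cauchy_L1_AE_cauchy_subseq[of M x] L2_integrable[OF x] by metis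
  have m: "x n \<in> borel_measurable M" for n using L2_measurable[OF x] .
  have "AE y in M. (\<lambda>n. x (r n) y) \<longlonglongrightarrow> lim (\<lambda>n. x (r n) y)"
    using ae by eventually_elim (simp add: Cauchy_convergent_iff convergent_LIMSEQ_iff)
  moreover have "(\<lambda>y. lim (\<lambda>n. x (r n) y)) \<in> borel_measurable M"
    using m by (intro borel_measurable_lim_metric) auto
  ultimately show ?thesis using r by blast
qed

text \<open>Lower semicontinuity of the square integral. It serves both completeness proofs; for the
  energy, the square root of the kernel is made part of the function.\<close>

lemma integrable_sq_Fatou:
  assumes x: "\<And>n. x n \<in> borel_measurable M" and l: "l \<in> borel_measurable M"
    and ae: "AE y in M. (\<lambda>n. x n y) \<longlonglongrightarrow> (l y :: real)"
    and w: "\<And>n. integrable M (\<lambda>y. (x n y)\<^sup>2)"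
    and bound: "eventually (\<lambda>n. (\<integral>y. (x n y)\<^sup>2 \<partial>M) \<le> C) sequentially"
  shows "integrable M (\<lambda>y. (l y)\<^sup>2) \<and> (\<integral>y. (l y)\<^sup>2 \<partial>M) \<le> C"
proof -
  have "(\<integral>\<^sup>+y. ennreal ((l y)\<^sup>2) \<partial>M) = (\<integral>\<^sup>+y. liminf (\<lambda>n. ennreal ((x n y)\<^sup>2)) \<partial>M)"
  proof (rule nn_integral_cong_AE)
    show "AE y in M. ennreal ((l y)\<^sup>2) = liminf (\<lambda>n. ennreal ((x n y)\<^sup>2))"
      using ae
    proof eventually_elim
      case (elim y)
      have "(\<lambda>n. ennreal ((x n y)\<^sup>2)) \<longlonglongrightarrow> ennreal ((l y)\<^sup>2)"
        using elim by (intro tendsto_intros)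
      then show ?case by (intro lim_imp_Liminf[symmetric]) auto
    qed
  qed
  also have "\<dots> \<le> liminf (\<lambda>n. \<integral>\<^sup>+y. ennreal ((x n y)\<^sup>2) \<partial>M)"
    using x by (intro nn_integral_liminf) auto
  also have "(\<lambda>n. \<integral>\<^sup>+y. ennreal ((x n y)\<^sup>2) \<partial>M) = (\<lambda>n. ennreal (\<integral>y. (x n y)\<^sup>2 \<partial>M))"
    using w by (simp add: nn_integral_eq_integral)
  also have "liminf \<dots> \<le> ennreal C"
  proof (rule Liminf_le)
    show "eventually (\<lambda>n. ennreal (\<integral>y. (x n y)\<^sup>2 \<partial>M) \<le> ennreal C) sequentially"
      using bound by eventually_elim (rule ennreal_leI)
  qed simp
  finally have le: "(\<integral>\<^sup>+y. ennreal ((l y)\<^sup>2) \<partial>M) \<le> ennreal C" .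
  then have int: "integrable M (\<lambda>y. (l y)\<^sup>2)"
    using l by (intro integrableI_nonneg) (auto intro: le_less_trans)
  have "0 \<le> C"
    using bound by (auto simp: eventually_sequentially intro: order_trans[rotated] integral_nonneg_AE)
  then have "(\<integral>y. (l y)\<^sup>2 \<partial>M) \<le> C"
    using le int by (simp add: nn_integral_eq_integral)
  then show ?thesis using int by blast
qed

lemma (in finite_measure) semi_hilbert_L2: "semi_hilbert (L2 M) (L2_ip M)"
proof
  show "subspace (L2 M)" by (rule subspace_L2)
next
  fix x :: "nat \<Rightarrow> 'a \<Rightarrow> real"
  assume x: "\<And>n. x n \<in> L2 M"
    and "\<And>e. e > 0 \<Longrightarrow> \<exists>N. \<forall>m\<ge>N. \<forall>n\<ge>N. L2_ip M (x m - x n) (x m - x n) < e"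
  then have cauchy: "\<And>e. e > 0 \<Longrightarrow> \<exists>N. \<forall>m\<ge>N. \<forall>n\<ge>N. (\<integral>y. (x m y - x n y)\<^sup>2 \<partial>M) < e"
    by (simp add: L2_ip_def power2_eq_square)
  obtain r l where r: "strict_mono (r :: nat \<Rightarrow> nat)" and l: "l \<in> borel_measurable M"
    and ae: "AE y in M. (\<lambda>n. x (r n) y) \<longlonglongrightarrow> l y"
    using L2_cauchy_AE_subseq[OF x cauchy] by blast
  have xm: "x n \<in> borel_measurable M" for n using L2_measurable[OF x] .
  \<comment> \<open>Fatou in the second index with \<open>m\<close> fixed: a limit along a
    subsequence thus controls all large \<open>m\<close>, including those the subsequence
    omits.\<close>
  have close: "integrable M (\<lambda>y. (x m y - l y)\<^sup>2) \<and> (\<integral>y. (x m y - l y)\<^sup>2 \<partial>M) \<le> e"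
    if N: "\<forall>m\<ge>N. \<forall>n\<ge>N. (\<integral>y. (x m y - x n y)\<^sup>2 \<partial>M) < e" and "m \<ge> N" for e N m
  proof (rule integrable_sq_Fatou)
    show "(\<lambda>y. x m y - x (r n) y) \<in> borel_measurable M" for n using xm by auto
    show "(\<lambda>y. x m y - l y) \<in> borel_measurable M" using xm l by auto
    show "AE y in M. (\<lambda>n. x m y - x (r n) y) \<longlonglongrightarrow> x m y - l y"
      using ae by eventually_elim (intro tendsto_intros)
    show "integrable M (\<lambda>y. (x m y - x (r n) y)\<^sup>2)" for n
      by (intro L2_integrable_sq L2_diff x)
    have "(\<integral>y. (x m y - x (r n) y)\<^sup>2 \<partial>M) \<le> e" if "n \<ge> N" for n
      using N \<open>m \<ge> N\<close> seq_suble[OF r, of n] that by (meson less_imp_le order_trans)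
    then show "eventually (\<lambda>n. (\<integral>y. (x m y - x (r n) y)\<^sup>2 \<partial>M) \<le> e) sequentially"
      by (auto simp: eventually_sequentially)
  qed
  obtain N1 where N1: "\<forall>m\<ge>N1. \<forall>n\<ge>N1. (\<integral>y. (x m y - x n y)\<^sup>2 \<partial>M) < 1" using cauchy[of 1] by auto
  have "(\<lambda>y. x N1 y - l y) \<in> L2 M"
    using close[OF N1, of N1] xm l by (auto simp: L2_def)
  from L2_diff[OF x[of N1] this] have lL2: "l \<in> L2 M" by simp
  have "(\<lambda>n. \<integral>y. (x n y - l y)\<^sup>2 \<partial>M) \<longlonglongrightarrow> 0"
  proof (rule LIMSEQ_I)
    fix e :: real assume "e > 0"
    then obtain N where N: "\<forall>m\<ge>N. \<forall>n\<ge>N. (\<integral>y. (x m y - x n y)\<^sup>2 \<partial>M) < e / 2"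
      using cauchy[of "e / 2"] by auto
    have "norm ((\<integral>y. (x n y - l y)\<^sup>2 \<partial>M) - 0) < e" if "n \<ge> N" for n
      using close[OF N that] \<open>e > 0\<close> by simp
    then show "\<exists>N. \<forall>n\<ge>N. norm ((\<integral>y. (x n y - l y)\<^sup>2 \<partial>M) - 0) < e" by blast
  qed
  then show "\<exists>l\<in>L2 M. (\<lambda>n. L2_ip M (x n - l) (x n - l)) \<longlonglongrightarrow> 0"
    using lL2 by (auto simp: L2_ip_def power2_eq_square)
next
  fix u v w :: "'a \<Rightarrow> real" and r :: real
  assume u: "u \<in> L2 M"
  show "L2_ip M (u + v) w = L2_ip M u w + L2_ip M v w" if "v \<in> L2 M" "w \<in> L2 M"
    using L2_integrable_mult[OF u that(2)] L2_integrable_mult[OF that] by (simp add: L2_ip_def distrib_right)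
  show "L2_ip M (r *\<^sub>R u) w = r * L2_ip M u w" if "w \<in> L2 M"
    by (simp add: L2_ip_def mult.assoc)
  show "L2_ip M u v = L2_ip M v u" by (simp add: L2_ip_def mult.commute)
  show "0 \<le> L2_ip M u u" by (simp add: L2_ip_def)
qed

text \<open>With total measure \<open>m\<close>, this is \<open>2 m\<^sup>2\<close> times the
  variance of \<open>u\<close>. On a small cube it ties the square integral to the mean and to a
  piece of the energy.\<close>

lemma (in finite_measure) double_integral_difference_sq:
  assumes u: "u \<in> L2 M"
  shows "(\<integral>\<^sup>+x. \<integral>\<^sup>+y. ennreal ((u x - u y)\<^sup>2) \<partial>M \<partial>M)
    = ennreal (2 * measure M (space M) * (\<integral>x. (u x)\<^sup>2 \<partial>M) - 2 * (\<integral>x. u x \<partial>M)\<^sup>2)"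
proof -
  define m a b where "m = measure M (space M)" and "a = (\<integral>x. u x \<partial>M)" and "b = (\<integral>x. (u x)\<^sup>2 \<partial>M)"
  note i1 = L2_integrable[OF u] and i2 = L2_integrable_sq[OF u]
  have "(\<integral>\<^sup>+y. ennreal ((u x - u y)\<^sup>2) \<partial>M) = ennreal (m * (u x)\<^sup>2 - 2 * a * u x + b)" for x
  proof -
    have eq: "(u x - u y)\<^sup>2 = (u x)\<^sup>2 - 2 * u x * u y + (u y)\<^sup>2" for y
      by (simp add: power2_diff)
    have "integrable M (\<lambda>y. (u x - u y)\<^sup>2)" unfolding eq using i1 i2 by auto
    then have "(\<integral>\<^sup>+y. ennreal ((u x - u y)\<^sup>2) \<partial>M) = ennreal (\<integral>y. (u x - u y)\<^sup>2 \<partial>M)"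
      by (intro nn_integral_eq_integral) auto
    also have "(\<integral>y. (u x - u y)\<^sup>2 \<partial>M) = m * (u x)\<^sup>2 - 2 * a * u x + b"
      unfolding eq using i1 i2 by (simp add: m_def a_def b_def)
    finally show ?thesis .
  qed
  note inner = this
  have nonneg: "0 \<le> m * (u x)\<^sup>2 - 2 * a * u x + b" for x
  proof -
    have "(\<integral>y. (u x - u y)\<^sup>2 \<partial>M) = m * (u x)\<^sup>2 - 2 * a * u x + b"
      unfolding power2_diff using i1 i2 by (simp add: m_def a_def b_def)
    moreover have "0 \<le> (\<integral>y. (u x - u y)\<^sup>2 \<partial>M)" by simp
    ultimately show ?thesis by simp
  qed
  have "(\<integral>\<^sup>+x. \<integral>\<^sup>+y. ennreal ((u x - u y)\<^sup>2) \<partial>M \<partial>M) = ennreal (\<integral>x. m * (u x)\<^sup>2 - 2 * a * u x + b \<partial>M)"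
    unfolding inner
  proof (rule nn_integral_eq_integral)
    show "integrable M (\<lambda>x. m * (u x)\<^sup>2 - 2 * a * u x + b)" using i1 i2 by auto
    show "AE x in M. 0 \<le> m * (u x)\<^sup>2 - 2 * a * u x + b" using nonneg by blast
  qed
  also have "(\<integral>x. m * (u x)\<^sup>2 - 2 * a * u x + b \<partial>M) = m * b - 2 * a * a + b * m"
    using i1 i2 by (simp add: a_def b_def m_def)
  also have "\<dots> = 2 * m * b - 2 * a\<^sup>2" by (simp add: power2_eq_square)
  finally show ?thesis by (simp add: m_def a_def b_def)
qed

lemma (in finite_measure) integral_sq_le:
  assumes u: "u \<in> L2 M"
  shows "(\<integral>x. u x \<partial>M)\<^sup>2 \<le> measure M (space M) * (\<integral>x. (u x)\<^sup>2 \<partial>M)"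
proof -
  interpret H: semi_hilbert "L2 M" "L2_ip M" by (rule semi_hilbert_L2)
  have one: "(\<lambda>_. 1) \<in> L2 M" by (rule const_in_L2)
  have "\<bar>L2_ip M u (\<lambda>_. 1)\<bar>\<^sup>2 \<le> (H.nrm u * H.nrm (\<lambda>_. 1))\<^sup>2"
    by (intro power_mono H.cauchy_schwarz u one) simp
  then have "(L2_ip M u (\<lambda>_. 1))\<^sup>2 \<le> L2_ip M u u * L2_ip M (\<lambda>_. 1) (\<lambda>_. 1)"
    by (simp add: power_mult_distrib H.nrm_squared u one)
  then show ?thesis by (simp add: L2_ip_def power2_eq_square mult.commute)
qed

section \<open>Lebesgue measure on products\<close>

text \<open>Composing a Lebesgue measurable function with a Borel map can destroy measurability.
  Here \<open>u\<close> is replaced by a Borel version, and \<open>null\<close> ensures that the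
  exceptional set pulls back to a null set.\<close>

lemma borel_measurable_lebesgue_compose:
  fixes u :: "'a::euclidean_space \<Rightarrow> real" and T :: "'c::euclidean_space \<Rightarrow> 'a"
  assumes u: "u \<in> borel_measurable lebesgue" and T: "T \<in> borel_measurable borel"
    and null: "\<And>N. N \<in> null_sets lborel \<Longrightarrow> AE z in lborel. T z \<notin> N"
  shows "(\<lambda>z. u (T z)) \<in> borel_measurable lebesgue"
proof -
  obtain u' where u': "u' \<in> borel_measurable lborel" and ae: "AE x in lborel. u x = u' x"
    using completion_ex_borel_measurable_real[OF u] by blast
  from ae obtain N where N: "N \<in> null_sets lborel" and eq: "\<And>x. u x \<noteq> u' x \<Longrightarrow> x \<in> N"
    unfolding eventually_ae_filter by auto
  have "AE z in lborel. u' (T z) = u (T z)"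
    using null[OF N] by eventually_elim (metis eq)
  then have "AE z in lebesgue. u' (T z) = u (T z)" by (rule AE_completion)
  moreover have "(\<lambda>z. u' (T z)) \<in> borel_measurable lebesgue"
    using u' T by (intro measurable_completion) (auto intro: measurable_compose)
  ultimately show ?thesis by (rule borel_measurable_AE[rotated])
qed

lemma AE_lborel_prodI:
  fixes N :: "('a::euclidean_space \<times> 'b::euclidean_space) set"
  assumes N: "N \<in> sets borel" and ae: "AE x in lborel. AE y in lborel. (x, y) \<notin> N"
  shows "AE z in lborel. z \<notin> N"
proof -
  have "N \<in> sets (lborel \<Otimes>\<^sub>M lborel)" using N by (simp only: lborel_prod sets_lborel)
  then have "{z \<in> space (lborel \<Otimes>\<^sub>M lborel). z \<notin> N} \<in> sets (lborel \<Otimes>\<^sub>M lborel)"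
    using sets.compl_sets[of N "lborel \<Otimes>\<^sub>M lborel"] by (simp add: set_diff_eq)
  then have "AE z in lborel \<Otimes>\<^sub>M lborel. z \<notin> N"
    using ae by (rule lborel_pair.AE_pair_measure)
  then show ?thesis by (simp only: lborel_prod)
qed

lemma AE_lborel_fst:
  fixes N :: "'a::euclidean_space set"
  assumes N: "N \<in> null_sets lborel"
  shows "AE z in (lborel :: ('a \<times> 'b::euclidean_space) measure). fst z \<notin> N"
proof -
  have "fst -` N \<in> sets (borel :: ('a \<times> 'b) measure)"
    using null_setsD2[OF N] measurable_sets[of fst "borel :: ('a \<times> 'b) measure" borel N]
    by (simp add: borel_measurable_continuous_onI continuous_on_fst)
  then have "AE z in (lborel :: ('a \<times> 'b) measure). z \<notin> fst -` N"
    by (rule AE_lborel_prodI) (use AE_not_in[OF N] in \<open>simp add: eventually_mono\<close>)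
  then show ?thesis by simp
qed

lemma AE_lborel_snd:
  fixes N :: "'b::euclidean_space set"
  assumes N: "N \<in> null_sets lborel"
  shows "AE z in (lborel :: ('a::euclidean_space \<times> 'b) measure). snd z \<notin> N"
proof -
  have "snd -` N \<in> sets (borel :: ('a \<times> 'b) measure)"
    using null_setsD2[OF N] measurable_sets[of snd "borel :: ('a \<times> 'b) measure" borel N]
    by (simp add: borel_measurable_continuous_onI continuous_on_snd)
  then have "AE z in (lborel :: ('a \<times> 'b) measure). z \<notin> snd -` N"
    by (rule AE_lborel_prodI) (use AE_not_in[OF N] in simp)
  then show ?thesis by simp
qed

text \<open>\<open>c = 1\<close> is a translation and \<open>c = -1\<close> the map
  \<open>y \<mapsto> x - y\<close>; these are the substitutions needed for integrands in
  \<open>x - y\<close>.\<close>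

lemma nn_integral_lborel_isometry:
  fixes x :: "'a::euclidean_space"
  assumes "f \<in> borel_measurable borel" and c: "\<bar>c\<bar> = 1"
  shows "(\<integral>\<^sup>+y. f (x + c *\<^sub>R y) \<partial>lborel) = (\<integral>\<^sup>+y. f y \<partial>lborel)"
proof -
  have "lborel = density (distr lborel borel (\<lambda>y. x + c *\<^sub>R y)) (\<lambda>_. 1)"
    using lborel_affine[of c x] c by fastforce
  then have "(\<integral>\<^sup>+y. f y \<partial>lborel) = (\<integral>\<^sup>+y. f y \<partial>density (distr lborel borel (\<lambda>y. x + c *\<^sub>R y)) (\<lambda>_. 1))"
    by simp
  also have "\<dots> = (\<integral>\<^sup>+y. f (x + c *\<^sub>R y) \<partial>lborel)"
    using assms by (subst nn_integral_density) (auto simp: nn_integral_distr)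
  finally show ?thesis by simp
qed

lemma AE_lborel_isometry:
  fixes N :: "'a::euclidean_space set"
  assumes N: "N \<in> null_sets lborel" and c: "\<bar>c\<bar> = 1"
  shows "AE y in lborel. x + c *\<^sub>R y \<notin> N"
proof -
  have Nb: "N \<in> sets borel" using N by auto
  have "(\<integral>\<^sup>+y. indicator N (x + c *\<^sub>R y) \<partial>lborel) = (\<integral>\<^sup>+y. indicator N y \<partial>(lborel :: 'a measure))"
    using Nb c by (intro nn_integral_lborel_isometry) auto
  also have "\<dots> = emeasure lborel N" using Nb by (intro nn_integral_indicator) simp
  also have "\<dots> = 0" using N by auto
  finally have "AE y in lborel. indicator N (x + c *\<^sub>R y) = (0 :: ennreal)"
    using Nb by (subst (asm) nn_integral_0_iff_AE) auto
  then show ?thesis by eventually_elim (auto simp: indicator_def split: if_splits)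
qed

text \<open>Each slice of the preimage of \<open>N\<close> under subtraction is a reflected
  translate of \<open>N\<close>, hence null.\<close>

lemma AE_lborel_diff:
  fixes N :: "'a::euclidean_space set"
  assumes N: "N \<in> null_sets lborel"
  shows "AE z in (lborel :: ('a \<times> 'a) measure). fst z - snd z \<notin> N"
proof -
  have Nb: "N \<in> sets borel" using N by auto
  have meas: "(\<lambda>z :: 'a \<times> 'a. fst z - snd z) \<in> borel_measurable borel"
    by (intro borel_measurable_continuous_onI continuous_intros)
  have "AE z in (lborel :: ('a \<times> 'a) measure). z \<notin> (\<lambda>z. fst z - snd z) -` N"
  proof (rule AE_lborel_prodI)
    show "(\<lambda>z :: 'a \<times> 'a. fst z - snd z) -` N \<in> sets borel"
      using measurable_sets[OF meas Nb] by simp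
    have "AE y in lborel. (x, y) \<notin> (\<lambda>z. fst z - snd z) -` N" for x
      using AE_lborel_isometry[OF N, of "-1" x] by simp
    then show "AE x in lborel. AE y in lborel. (x, y) \<notin> (\<lambda>z. fst z - snd z) -` N" by simp
  qed
  then show ?thesis by simp
qed

lemma lebesgue_measurable_fst:
  assumes "u \<in> borel_measurable lebesgue"
  shows "(\<lambda>z. u (fst z) :: real) \<in> borel_measurable (lebesgue :: ('a::euclidean_space \<times> 'b::euclidean_space) measure)"
  by (rule borel_measurable_lebesgue_compose[OF assms])
    (auto intro!: AE_lborel_fst borel_measurable_continuous_onI continuous_intros)

lemma lebesgue_measurable_snd:
  assumes "u \<in> borel_measurable lebesgue"
  shows "(\<lambda>z. u (snd z) :: real) \<in> borel_measurable (lebesgue :: ('a::euclidean_space \<times> 'b::euclidean_space) measure)"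
  by (rule borel_measurable_lebesgue_compose[OF assms])
    (auto intro!: AE_lborel_snd borel_measurable_continuous_onI continuous_intros)

lemma lebesgue_measurable_diff:
  assumes "u \<in> borel_measurable lebesgue"
  shows "(\<lambda>z. u (fst z - snd z) :: real) \<in> borel_measurable (lebesgue :: ('a::euclidean_space \<times> 'a) measure)"
  by (rule borel_measurable_lebesgue_compose[OF assms])
    (auto intro!: AE_lborel_diff borel_measurable_continuous_onI continuous_intros)

lemma AE_lebesgue_fst:
  assumes "AE x in lebesgue. P x"
  shows "AE z in (lebesgue :: ('a::euclidean_space \<times> 'b::euclidean_space) measure). P (fst z)"
proof -
  have "AE x in lborel. P x" using assms by (simp add: AE_completion_iff)
  then obtain N where N: "N \<in> null_sets lborel" and eq: "\<And>x. \<not> P x \<Longrightarrow> x \<in> N"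
    unfolding eventually_ae_filter by auto
  show ?thesis
    by (rule AE_completion) (use AE_lborel_fst[OF N] in \<open>eventually_elim, use eq in blast\<close>)
qed

lemma AE_lebesgue_snd:
  assumes "AE x in lebesgue. P x"
  shows "AE z in (lebesgue :: ('a::euclidean_space \<times> 'b::euclidean_space) measure). P (snd z)"
proof -
  have "AE x in lborel. P x" using assms by (simp add: AE_completion_iff)
  then obtain N where N: "N \<in> null_sets lborel" and eq: "\<And>x. \<not> P x \<Longrightarrow> x \<in> N"
    unfolding eventually_ae_filter by auto
  show ?thesis
    by (rule AE_completion) (use AE_lborel_snd[OF N] in \<open>eventually_elim, use eq in blast\<close>)
qed

text \<open>Lebesgue measure on the product is the completion of the Borel product measure, not a
  product of completions. A Borel version of \<open>F\<close> obeys Tonelli, and on almost every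
  slice it agrees with \<open>F\<close> almost everywhere.\<close>

lemma lebesgue_Tonelli:
  fixes F :: "'a::euclidean_space \<times> 'b::euclidean_space \<Rightarrow> ennreal"
  assumes "F \<in> borel_measurable lebesgue"
  shows "(\<integral>\<^sup>+z. F z \<partial>lebesgue) = (\<integral>\<^sup>+x. \<integral>\<^sup>+y. F (x, y) \<partial>lebesgue \<partial>lebesgue)" (is ?first)
    and "(\<integral>\<^sup>+z. F z \<partial>lebesgue) = (\<integral>\<^sup>+y. \<integral>\<^sup>+x. F (x, y) \<partial>lebesgue \<partial>lebesgue)" (is ?second)
proof -
  obtain F' where F': "F' \<in> borel_measurable lborel" and ae: "AE z in lborel. F z = F' z"
    using completion_ex_borel_measurable[OF assms] by blast
  from ae obtain N where N: "N \<in> null_sets lborel" and NF: "\<And>z. F z \<noteq> F' z \<Longrightarrow> z \<in> N"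
    unfolding eventually_ae_filter by auto
  have F'm: "F' \<in> borel_measurable (lborel \<Otimes>\<^sub>M lborel)" using F' by (simp only: lborel_prod)
  have "AE z in lborel \<Otimes>\<^sub>M lborel. z \<notin> N" unfolding lborel_prod by (rule AE_not_in[OF N])
  then have ae1: "AE x in lborel. AE y in lborel. (x, y) \<notin> N" by (rule lborel_pair.AE_pair)
  have "N \<in> sets (lborel \<Otimes>\<^sub>M lborel)" using null_setsD2[OF N] by (simp only: lborel_prod)
  then have "{z \<in> space (lborel \<Otimes>\<^sub>M lborel). (fst z, snd z) \<notin> N} \<in> sets (lborel \<Otimes>\<^sub>M lborel)"
    using sets.compl_sets[of N "lborel \<Otimes>\<^sub>M lborel"] by (simp add: set_diff_eq)
  from iffD1[OF lborel_pair.AE_commute[OF this] ae1]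
  have ae2: "AE y in lborel. AE x in lborel. (x, y) \<notin> N" .
  have "(\<integral>\<^sup>+z. F z \<partial>lebesgue) = (\<integral>\<^sup>+z. F' z \<partial>lborel)"
    unfolding nn_integral_completion using ae by (rule nn_integral_cong_AE)
  then have eq: "(\<integral>\<^sup>+z. F z \<partial>lebesgue) = (\<integral>\<^sup>+z. F' z \<partial>(lborel \<Otimes>\<^sub>M lborel))"
    by (simp only: lborel_prod)
  have "(\<integral>\<^sup>+z. F' z \<partial>(lborel \<Otimes>\<^sub>M lborel)) = (\<integral>\<^sup>+x. \<integral>\<^sup>+y. F' (x, y) \<partial>lborel \<partial>lborel)"
    using lborel.nn_integral_fst[OF F'm] by simp
  also have "\<dots> = (\<integral>\<^sup>+x. \<integral>\<^sup>+y. F (x, y) \<partial>lborel \<partial>lborel)"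
  proof (rule nn_integral_cong_AE)
    show "AE x in lborel. (\<integral>\<^sup>+y. F' (x, y) \<partial>lborel) = (\<integral>\<^sup>+y. F (x, y) \<partial>lborel)"
      using ae1
    proof eventually_elim
      case (elim x)
      show ?case by (rule nn_integral_cong_AE) (use elim in \<open>eventually_elim, metis NF\<close>)
    qed
  qed
  finally show ?first unfolding eq by (simp only: nn_integral_completion)
  have "(\<integral>\<^sup>+z. F' z \<partial>(lborel \<Otimes>\<^sub>M lborel)) = (\<integral>\<^sup>+y. \<integral>\<^sup>+x. F' (x, y) \<partial>lborel \<partial>lborel)"
    by (rule lborel_pair.nn_integral_snd[OF F'm, symmetric])
  also have "\<dots> = (\<integral>\<^sup>+y. \<integral>\<^sup>+x. F (x, y) \<partial>lborel \<partial>lborel)"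
  proof (rule nn_integral_cong_AE)
    show "AE y in lborel. (\<integral>\<^sup>+x. F' (x, y) \<partial>lborel) = (\<integral>\<^sup>+x. F (x, y) \<partial>lborel)"
      using ae2
    proof eventually_elim
      case (elim y)
      show ?case by (rule nn_integral_cong_AE) (use elim in \<open>eventually_elim, metis NF\<close>)
    qed
  qed
  finally show ?second unfolding eq by (simp only: nn_integral_completion)
qed

lemma nn_integral_lebesgue_isometry:
  fixes x :: "'a::euclidean_space" and h :: "'a \<Rightarrow> ennreal"
  assumes h: "h \<in> borel_measurable lebesgue" and c: "\<bar>c\<bar> = 1"
  shows "(\<integral>\<^sup>+y. h (x + c *\<^sub>R y) \<partial>lebesgue) = (\<integral>\<^sup>+y. h y \<partial>lebesgue)"
proof -
  obtain h' where h': "h' \<in> borel_measurable lborel" and ae: "AE z in lborel. h z = h' z"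
    using completion_ex_borel_measurable[OF h] by blast
  from ae obtain N where N: "N \<in> null_sets lborel" and Nh: "\<And>z. h z \<noteq> h' z \<Longrightarrow> z \<in> N"
    unfolding eventually_ae_filter by auto
  have "AE y in lborel. h (x + c *\<^sub>R y) = h' (x + c *\<^sub>R y)"
    using AE_lborel_isometry[OF N c, of x] by eventually_elim (metis Nh)
  then have "(\<integral>\<^sup>+y. h (x + c *\<^sub>R y) \<partial>lebesgue) = (\<integral>\<^sup>+y. h' (x + c *\<^sub>R y) \<partial>lborel)"
    unfolding nn_integral_completion by (rule nn_integral_cong_AE)
  also have "\<dots> = (\<integral>\<^sup>+y. h' y \<partial>lborel)" using h' c by (intro nn_integral_lborel_isometry) auto
  also have "\<dots> = (\<integral>\<^sup>+y. h y \<partial>lebesgue)"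
    unfolding nn_integral_completion using ae by (intro nn_integral_cong_AE) (auto simp: eq_commute)
  finally show ?thesis .
qed

section \<open>The space \<open>X\<close>\<close>

locale fractional_setting =
  fixes \<Omega> :: "(real ^ 'n::finite) set"
    and K :: "real ^ 'n \<Rightarrow> real"
    and \<theta> \<sigma> :: real
  assumes \<Omega>_nonempty: "\<Omega> \<noteq> {}" and \<Omega>_open: "open \<Omega>" and \<Omega>_bounded: "bounded \<Omega>"
    and K_measurable: "K \<in> borel_measurable (lebesgue_on (- {0}))"
    and K_pos: "\<And>x. x \<noteq> 0 \<Longrightarrow> K x > 0"
    and K_integrable: "integrable lebesgue (\<lambda>x. min ((norm x)\<^sup>2) 1 * K x)"
    and \<theta>_pos: "\<theta> > 0" and \<sigma>_pos: "0 < \<sigma>"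
    and K_lower: "\<And>x. x \<noteq> 0 \<Longrightarrow> K x \<ge> \<theta> * norm x powr (- (real CARD('n) + 2 * \<sigma>))"
begin

abbreviation "Q \<equiv> Q_set \<Omega>"
abbreviation "X \<equiv> X_space \<Omega> K"
abbreviation "Z \<equiv> Z_space \<Omega> K"
abbreviation "ipZ \<equiv> inner_Z \<Omega> K"
abbreviation "M\<Omega> \<equiv> lebesgue_on \<Omega>"
abbreviation "MQ \<equiv> lebesgue_on Q"

lemma mem_Q: "z \<in> Q \<longleftrightarrow> fst z \<in> \<Omega> \<or> snd z \<in> \<Omega>"
  by (auto simp: Q_set_def mem_Times_iff)

lemma \<Omega>_sets [measurable, simp]: "\<Omega> \<in> sets lebesgue"
  using \<Omega>_open by (simp add: borel_open)

lemma \<Omega>_lmeasurable: "\<Omega> \<in> lmeasurable"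
  using \<Omega>_open \<Omega>_bounded by (rule lmeasurable_open[rotated])

lemma finite_M\<Omega>: "finite_measure M\<Omega>"
  by (rule finite_measure_lebesgue_on[OF \<Omega>_lmeasurable])

lemma Q_sets [measurable, simp]: "Q \<in> sets lebesgue"
proof -
  have "open Q" unfolding Q_set_def using \<Omega>_open by (intro open_Compl closed_Times) auto
  then show ?thesis by (simp add: borel_open)
qed

lemma \<Omega>_measure_pos: "measure lebesgue \<Omega> > 0"
proof -
  obtain x e where "e > 0" "ball x e \<subseteq> \<Omega>"
    using \<Omega>_open \<Omega>_nonempty open_contains_ball by blast
  then have "measure lebesgue (ball x e) \<le> measure lebesgue \<Omega>"
    by (intro measure_mono_fmeasurable \<Omega>_lmeasurable) auto
  moreover have "measure lebesgue (ball x e) > 0"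
    using content_ball_pos[OF \<open>e > 0\<close>, of x] by simp
  ultimately show ?thesis by linarith
qed

lemma K_lebesgue: "K \<in> borel_measurable lebesgue"
proof -
  have "(\<lambda>x. if x \<in> - {0} then K x else 0) \<in> borel_measurable lebesgue"
    using K_measurable by (subst borel_measurable_if) auto
  moreover have "AE x in lebesgue. (if x \<in> - {0} then K x else 0) = K x"
  proof -
    have "{0 :: real ^ 'n} \<in> null_sets lebesgue" by (simp add: null_sets_def)
    from AE_not_in[OF this] show ?thesis by eventually_elim auto
  qed
  ultimately show ?thesis by (rule borel_measurable_AE)
qed

text \<open>The energy density. On the diagonal it is 0 whatever the value \<open>K 0\<close>, so
  its sign is settled by positivity of \<open>K\<close> off the origin.\<close>

definition D :: "(real ^ 'n \<Rightarrow> real) \<Rightarrow> (real ^ 'n \<Rightarrow> real) \<Rightarrow> (real ^ 'n) \<times> (real ^ 'n) \<Rightarrow> real" where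
  "D u v z = (u (fst z) - u (snd z)) * (v (fst z) - v (snd z)) * K (fst z - snd z)"

lemma ipZ_eq: "ipZ u v = (\<integral>z. D u v z \<partial>MQ)"
  by (simp add: inner_Z_def D_def case_prod_unfold)

lemma D_measurable:
  assumes "u \<in> borel_measurable lebesgue" "v \<in> borel_measurable lebesgue"
  shows "D u v \<in> borel_measurable lebesgue" "D u v \<in> borel_measurable MQ"
proof -
  show *: "D u v \<in> borel_measurable lebesgue"
    unfolding D_def[abs_def]
    by (intro borel_measurable_times borel_measurable_diff lebesgue_measurable_fst
        lebesgue_measurable_snd lebesgue_measurable_diff assms K_lebesgue)
  show "D u v \<in> borel_measurable MQ" by (rule measurable_restrict_space1[OF *])
qed

lemma D_nonneg: "D u u z \<ge> 0"
  using K_pos[of "fst z - snd z"] by (cases "fst z = snd z") (auto simp: D_def)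

lemma D_abs_le: "\<bar>D u v z\<bar> \<le> D u u z + D v v z"
proof (cases "fst z = snd z")
  case True
  then show ?thesis by (simp add: D_def)
next
  case False
  define p q k where "p = u (fst z) - u (snd z)" and "q = v (fst z) - v (snd z)" and "k = K (fst z - snd z)"
  have k: "k > 0" using False K_pos by (simp add: k_def)
  have "0 \<le> \<bar>p\<bar> * \<bar>q\<bar>" by simp
  then have "\<bar>p * q\<bar> \<le> p\<^sup>2 + q\<^sup>2"
    using sum_squares_bound[of "\<bar>p\<bar>" "\<bar>q\<bar>"] unfolding abs_mult power2_abs by linarith
  then have "\<bar>p * q\<bar> * k \<le> (p\<^sup>2 + q\<^sup>2) * k" using k by simp
  then show ?thesis using k
    by (simp add: D_def p_def[symmetric] q_def[symmetric] k_def[symmetric] abs_mult power2_eq_square distrib_right)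
qed

lemma X_iff: "u \<in> X \<longleftrightarrow> u \<in> borel_measurable lebesgue \<and> integrable MQ (D u u)"
  by (simp add: X_space_def D_def[abs_def] case_prod_unfold power2_eq_square)

lemma X_measurable: "u \<in> X \<Longrightarrow> u \<in> borel_measurable lebesgue"
  and X_integrable: "u \<in> X \<Longrightarrow> integrable MQ (D u u)"
  by (simp_all add: X_iff)

lemma X_measurable_on: "u \<in> X \<Longrightarrow> u \<in> borel_measurable (lebesgue_on A)"
  by (rule measurable_restrict_space1[OF X_measurable])

lemma D_integrable:
  assumes u: "u \<in> X" and v: "v \<in> X"
  shows "integrable MQ (D u v)"
proof (rule Bochner_Integration.integrable_bound)
  show "integrable MQ (\<lambda>z. D u u z + D v v z)" using u v X_integrable by auto
  show "D u v \<in> borel_measurable MQ" using u v X_measurable D_measurable by blast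
  show "AE z in MQ. norm (D u v z) \<le> norm (D u u z + D v v z)"
    using D_abs_le[of u v] by (intro AE_I2) (auto intro: order_trans[OF _ abs_ge_self])
qed

lemma D_add_left: "D (u + v) w z = D u w z + D v w z"
  and D_scale_left: "D (r *\<^sub>R u) w z = r * D u w z"
  and D_commute: "D u v z = D v u z"
  by (simp_all add: D_def algebra_simps)

lemma D_add_sq: "D (u + v) (u + v) = (\<lambda>z. D u u z + 2 * D u v z + D v v z)"
  by (rule ext) (simp add: D_def algebra_simps)

lemma D_scale_sq: "D (r *\<^sub>R u) (r *\<^sub>R u) = (\<lambda>z. r\<^sup>2 * D u u z)"
  by (rule ext) (simp add: D_def algebra_simps power2_eq_square)

lemma X_add: assumes "u \<in> X" "v \<in> X" shows "u + v \<in> X"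
proof -
  have "integrable MQ (D (u + v) (u + v))"
    unfolding D_add_sq using D_integrable assms by auto
  moreover have "u + v \<in> borel_measurable lebesgue"
    unfolding plus_fun_def using assms X_measurable by auto
  ultimately show ?thesis by (simp add: X_iff)
qed

lemma X_scale: assumes "u \<in> X" shows "r *\<^sub>R u \<in> X"
proof -
  have "integrable MQ (D (r *\<^sub>R u) (r *\<^sub>R u))"
    unfolding D_scale_sq using D_integrable assms by auto
  moreover have "r *\<^sub>R u \<in> borel_measurable lebesgue"
    unfolding scaleR_fun_def using assms X_measurable by auto
  ultimately show ?thesis by (simp add: X_iff)
qed

lemma X_zero: "0 \<in> X"
proof -
  have "D 0 0 = (\<lambda>_. 0)" by (rule ext) (simp add: D_def)
  then show ?thesis by (simp add: X_iff zero_fun_def)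
qed

lemma X_diff: "u \<in> X \<Longrightarrow> v \<in> X \<Longrightarrow> u - v \<in> X"
  using X_add[of u "(-1) *\<^sub>R v"] X_scale[of v "-1"] by simp

lemma ipZ_add_left: "u \<in> X \<Longrightarrow> v \<in> X \<Longrightarrow> w \<in> X \<Longrightarrow> ipZ (u + v) w = ipZ u w + ipZ v w"
  using D_integrable by (simp add: ipZ_eq D_add_left)

lemma ipZ_scale_left: "ipZ (r *\<^sub>R u) w = r * ipZ u w"
  by (simp add: ipZ_eq D_scale_left)

lemma ipZ_commute: "ipZ u v = ipZ v u"
  by (simp add: ipZ_eq D_commute[of u])

lemma ipZ_nonneg: "ipZ u u \<ge> 0"
  by (simp add: ipZ_eq D_nonneg)

section \<open>Lower bounds for the energy over products of sets\<close>

lemma nn_integral_D: "u \<in> X \<Longrightarrow> (\<integral>\<^sup>+z. ennreal (D u u z) \<partial>MQ) = ennreal (ipZ u u)"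
  unfolding ipZ_eq using D_nonneg by (intro nn_integral_eq_integral X_integrable) auto

text \<open>Tonelli turns the pointwise comparison into iterated integrals. The comparison is
  assumed only almost everywhere with a view to grid cubes that leave \<Omega>: off \<open>Q\<close>
  the right side is 0, and the left side is 0 there because \<open>u\<close> vanishes almost
  everywhere outside \<Omega>.\<close>

lemma rectangles_lower_bound:
  fixes A B :: "'i \<Rightarrow> (real ^ 'n) set"
  assumes u: "u \<in> X" and I: "finite I" and \<kappa>: "\<kappa> \<ge> 0"
    and A: "\<And>i. i \<in> I \<Longrightarrow> A i \<in> sets lebesgue" and B: "\<And>i. i \<in> I \<Longrightarrow> B i \<in> sets lebesgue"
    and le: "AE z in lebesgue. (\<Sum>i\<in>I. indicator (A i) (fst z) * indicator (B i) (snd z) *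
        (\<kappa> * (u (fst z) - u (snd z))\<^sup>2)) \<le> indicator Q z * D u u z"
  shows "(\<Sum>i\<in>I. ennreal \<kappa> * (\<integral>\<^sup>+x. \<integral>\<^sup>+y. ennreal ((u x - u y)\<^sup>2) \<partial>lebesgue_on (B i) \<partial>lebesgue_on (A i)))
    \<le> ennreal (ipZ u u)"
proof -
  define F where "F i z = indicator (A i) (fst z) * (indicator (B i) (snd z) * ennreal ((u (fst z) - u (snd z))\<^sup>2))" for i z
  have um: "u \<in> borel_measurable lebesgue" using u by (rule X_measurable)
  have F_meas: "F i \<in> borel_measurable lebesgue" if i: "i \<in> I" for i
  proof -
    have iA: "indicat_real (A i) \<in> borel_measurable lebesgue" and iB: "indicat_real (B i) \<in> borel_measurable lebesgue"
      using A[OF i] B[OF i] by simp_all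
    have "(\<lambda>z. ennreal (indicat_real (A i) (fst z) * (indicat_real (B i) (snd z) * (u (fst z) - u (snd z))\<^sup>2)))
        \<in> borel_measurable lebesgue"
      using lebesgue_measurable_fst[OF iA] lebesgue_measurable_snd[OF iB] lebesgue_measurable_fst[OF um]
        lebesgue_measurable_snd[OF um]
      by (intro measurable_compose[OF _ measurable_ennreal] borel_measurable_times borel_measurable_power
          borel_measurable_diff)
    also have "(\<lambda>z. ennreal (indicat_real (A i) (fst z) * (indicat_real (B i) (snd z) * (u (fst z) - u (snd z))\<^sup>2))) = F i"
      by (rule ext) (simp add: F_def indicator_def)
    finally show ?thesis .
  qed
  have F_int: "(\<integral>\<^sup>+z. F i z \<partial>lebesgue) =
      (\<integral>\<^sup>+x. \<integral>\<^sup>+y. ennreal ((u x - u y)\<^sup>2) \<partial>lebesgue_on (B i) \<partial>lebesgue_on (A i))" if i: "i \<in> I" for i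
  proof -
    have "(\<integral>\<^sup>+z. F i z \<partial>lebesgue) = (\<integral>\<^sup>+x. \<integral>\<^sup>+y. F i (x, y) \<partial>lebesgue \<partial>lebesgue)"
      by (rule lebesgue_Tonelli(1)[OF F_meas[OF i]])
    also have "\<dots> = (\<integral>\<^sup>+x. (\<integral>\<^sup>+y. ennreal ((u x - u y)\<^sup>2) \<partial>lebesgue_on (B i)) * indicator (A i) x \<partial>lebesgue)"
    proof (rule nn_integral_cong)
      fix x
      have "(\<integral>\<^sup>+y. F i (x, y) \<partial>lebesgue) = (if x \<in> A i then \<integral>\<^sup>+y. ennreal ((u x - u y)\<^sup>2) * indicator (B i) y \<partial>lebesgue else 0)"
        by (auto simp: F_def mult.commute)
      also have "\<dots> = (\<integral>\<^sup>+y. ennreal ((u x - u y)\<^sup>2) \<partial>lebesgue_on (B i)) * indicator (A i) x"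
        using B[OF i] by (simp add: nn_integral_restrict_space)
      finally show "(\<integral>\<^sup>+y. F i (x, y) \<partial>lebesgue) = (\<integral>\<^sup>+y. ennreal ((u x - u y)\<^sup>2) \<partial>lebesgue_on (B i)) * indicator (A i) x" .
    qed
    also have "\<dots> = (\<integral>\<^sup>+x. \<integral>\<^sup>+y. ennreal ((u x - u y)\<^sup>2) \<partial>lebesgue_on (B i) \<partial>lebesgue_on (A i))"
      using A[OF i] by (simp add: nn_integral_restrict_space)
    finally show ?thesis .
  qed
  have "(\<Sum>i\<in>I. ennreal \<kappa> * (\<integral>\<^sup>+x. \<integral>\<^sup>+y. ennreal ((u x - u y)\<^sup>2) \<partial>lebesgue_on (B i) \<partial>lebesgue_on (A i)))
      = (\<Sum>i\<in>I. \<integral>\<^sup>+z. ennreal \<kappa> * F i z \<partial>lebesgue)"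
    using F_int F_meas by (intro sum.cong refl) (simp add: nn_integral_cmult)
  also have "\<dots> = (\<integral>\<^sup>+z. (\<Sum>i\<in>I. ennreal \<kappa> * F i z) \<partial>lebesgue)"
    using F_meas by (intro nn_integral_sum[symmetric]) auto
  also have "\<dots> \<le> (\<integral>\<^sup>+z. ennreal (D u u z) * indicator Q z \<partial>lebesgue)"
  proof (rule nn_integral_mono_AE)
    have "(\<Sum>i\<in>I. ennreal \<kappa> * F i z) = ennreal (\<Sum>i\<in>I. indicator (A i) (fst z) * indicator (B i) (snd z) *
        (\<kappa> * (u (fst z) - u (snd z))\<^sup>2))" for z
    proof -
      have "ennreal \<kappa> * F i z = ennreal (indicator (A i) (fst z) * indicator (B i) (snd z) *
        (\<kappa> * (u (fst z) - u (snd z))\<^sup>2))" for i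
        using \<kappa> by (simp add: F_def indicator_def ennreal_mult)
      then show ?thesis using \<kappa> by (simp add: sum_ennreal)
    qed
    moreover have "ennreal (D u u z) * indicator Q z = ennreal (indicator Q z * D u u z)" for z
      by (simp add: indicator_def)
    ultimately show "AE z in lebesgue. (\<Sum>i\<in>I. ennreal \<kappa> * F i z) \<le> ennreal (D u u z) * indicator Q z"
      using le by (auto elim!: eventually_mono intro!: ennreal_leI)
  qed
  also have "\<dots> = ennreal (ipZ u u)"
    using nn_integral_D[OF u] by (simp add: nn_integral_restrict_space)
  finally show ?thesis .
qed

lemma rectangle_lower_bound:
  assumes u: "u \<in> X" and \<kappa>: "\<kappa> \<ge> 0"
    and A: "A \<in> sets lebesgue" and B: "B \<in> sets lebesgue"
    and sub: "A \<subseteq> \<Omega> \<or> B \<subseteq> \<Omega>"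
    and K: "\<And>x y. x \<in> A \<Longrightarrow> y \<in> B \<Longrightarrow> x \<noteq> y \<Longrightarrow> \<kappa> \<le> K (x - y)"
  shows "ennreal \<kappa> * (\<integral>\<^sup>+x. \<integral>\<^sup>+y. ennreal ((u x - u y)\<^sup>2) \<partial>lebesgue_on B \<partial>lebesgue_on A) \<le> ennreal (ipZ u u)"
proof -
  have "(\<Sum>i\<in>{()}. ennreal \<kappa> * (\<integral>\<^sup>+x. \<integral>\<^sup>+y. ennreal ((u x - u y)\<^sup>2) \<partial>lebesgue_on B \<partial>lebesgue_on A))
      \<le> ennreal (ipZ u u)"
  proof (rule rectangles_lower_bound[OF u _ \<kappa>])
    show "AE z in lebesgue. (\<Sum>i\<in>{()}. indicator A (fst z) * indicator B (snd z) *
        (\<kappa> * (u (fst z) - u (snd z))\<^sup>2)) \<le> indicator Q z * D u u z"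
    proof (rule AE_I2)
      fix z :: "(real ^ 'n) \<times> (real ^ 'n)"
      have "\<kappa> * (u (fst z) - u (snd z))\<^sup>2 \<le> D u u z" if "fst z \<in> A" "snd z \<in> B"
        using K[OF that] unfolding D_def power2_eq_square
        by (cases "fst z = snd z") (auto simp: mult.commute[of \<kappa>] intro!: mult_left_mono)
      moreover have "z \<in> Q" if "fst z \<in> A" "snd z \<in> B"
        using that sub by (auto simp: mem_Q)
      ultimately show "(\<Sum>i\<in>{()}. indicator A (fst z) * indicator B (snd z) *
        (\<kappa> * (u (fst z) - u (snd z))\<^sup>2)) \<le> indicator Q z * D u u z"
        using D_nonneg[of u z] by (auto simp: indicator_def)
    qed
  qed (use A B in auto)
  then show ?thesis by simp
qed

lemma kernel_lower_bound_explicit: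
  assumes "x \<noteq> y" "norm (x - y) \<le> R"
  shows "\<theta> * R powr (- (real CARD('n) + 2 * \<sigma>)) \<le> K (x - y)"
proof -
  have "R powr (- (real CARD('n) + 2 * \<sigma>)) \<le> norm (x - y) powr (- (real CARD('n) + 2 * \<sigma>))"
    using assms \<sigma>_pos by (intro powr_mono2') auto
  then have "\<theta> * R powr (- (real CARD('n) + 2 * \<sigma>)) \<le> \<theta> * norm (x - y) powr (- (real CARD('n) + 2 * \<sigma>))"
    using \<theta>_pos by simp
  also have "\<dots> \<le> K (x - y)" using K_lower[of "x - y"] assms by simp
  finally show ?thesis .
qed

lemma kernel_lower_bound:
  assumes "R > 0"
  shows "\<exists>\<kappa>>0. \<forall>x y. x \<noteq> y \<longrightarrow> norm (x - y) \<le> R \<longrightarrow> \<kappa> \<le> K (x - y)"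
  using kernel_lower_bound_explicit[of _ _ R] \<theta>_pos assms
  by (intro exI[of _ "\<theta> * R powr (- (real CARD('n) + 2 * \<sigma>))"]) auto

text \<open>The double integral of \<open>(u x - u y)\<^sup>2\<close> over
  \<open>\<Omega> \<times> \<Omega>\<close> is finite and \<Omega> has positive measure, so some
  \<open>x\<close> has a finite inner integral. Subtracting \<open>u x - u y\<close> from the
  constant \<open>u x\<close> recovers \<open>u\<close>.\<close>

lemma X_subset_L2:
  assumes u: "u \<in> X"
  shows "u \<in> L2 M\<Omega>"
proof -
  interpret finite_measure M\<Omega> by (rule finite_M\<Omega>)
  obtain R where R: "R > 0" "\<And>x. x \<in> \<Omega> \<Longrightarrow> norm x \<le> R"
    using \<Omega>_bounded unfolding bounded_pos by blast
  obtain \<kappa> where \<kappa>: "\<kappa> > 0" and \<kappa>K: "\<And>x y. x \<noteq> y \<Longrightarrow> norm (x - y) \<le> R + R \<Longrightarrow> \<kappa> \<le> K (x - y)"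
    using kernel_lower_bound[of "R + R"] R by auto
  have "ennreal \<kappa> * (\<integral>\<^sup>+x. \<integral>\<^sup>+y. ennreal ((u x - u y)\<^sup>2) \<partial>M\<Omega> \<partial>M\<Omega>) \<le> ennreal (ipZ u u)"
  proof (rule rectangle_lower_bound[OF u])
    fix x y assume "x \<in> \<Omega>" "y \<in> \<Omega>" "x \<noteq> y"
    then show "\<kappa> \<le> K (x - y)"
      using R(2)[of x] R(2)[of y] norm_triangle_ineq4[of x y] by (intro \<kappa>K) auto
  qed (use \<kappa> in auto)
  have "\<exists>x\<in>\<Omega>. (\<integral>\<^sup>+y. ennreal ((u x - u y)\<^sup>2) \<partial>M\<Omega>) < \<infinity>"
  proof (rule ccontr)
    assume "\<not> ?thesis"
    then have "(\<integral>\<^sup>+x. \<integral>\<^sup>+y. ennreal ((u x - u y)\<^sup>2) \<partial>M\<Omega> \<partial>M\<Omega>) = (\<integral>\<^sup>+x. \<infinity> \<partial>M\<Omega>)"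
      by (intro nn_integral_cong) (auto simp flip: less_top)
    also have "\<dots> = \<infinity> * emeasure lebesgue \<Omega>" by (simp add: emeasure_restrict_space)
    also have "\<dots> = \<infinity>" using \<Omega>_measure_pos by (auto simp: measure_def ennreal_top_mult)
    finally show False
      using \<open>ennreal \<kappa> * _ \<le> _\<close> \<kappa> by (simp add: ennreal_mult_top top_unique)
  qed
  then obtain x where x: "(\<integral>\<^sup>+y. ennreal ((u x - u y)\<^sup>2) \<partial>M\<Omega>) < \<infinity>" by blast
  have "(\<lambda>y. u x - u y) \<in> L2 M\<Omega>"
    unfolding L2_def using x X_measurable_on[OF u, of \<Omega>] by (auto intro!: integrableI_nonneg)
  from L2_diff[OF const_in_L2[of "u x"] this] show ?thesis by simp
qed

end

section \<open>Test functions and the space \<open>Z\<close>\<close>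

lemma Ck_add: "Ck k f \<Longrightarrow> Ck k g \<Longrightarrow> Ck k (\<lambda>x. f x + g x)"
proof (induction k arbitrary: f g)
  case 0
  then show ?case by (simp add: continuous_on_add)
next
  case (Suc k)
  have fd: "f differentiable (at x)" and gd: "g differentiable (at x)" for x
    using Suc.prems by (auto simp: differentiable_on_def)
  have "frechet_derivative (\<lambda>x. f x + g x) (at x) = (\<lambda>h. frechet_derivative f (at x) h + frechet_derivative g (at x) h)" for x
    using fd gd by (intro frechet_derivative_at[symmetric] has_derivative_add) (auto simp: frechet_derivative_works)
  moreover have "(\<lambda>x. f x + g x) differentiable_on UNIV"
    using Suc.prems by (simp add: differentiable_on_def)
  ultimately show ?case using Suc by simp
qed

lemma Ck_cmult: "Ck k f \<Longrightarrow> Ck k (\<lambda>x. c * f x)"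
proof (induction k arbitrary: f)
  case 0
  then show ?case by (simp add: continuous_on_mult_left)
next
  case (Suc k)
  have fd: "f differentiable (at x)" for x
    using Suc.prems by (auto simp: differentiable_on_def)
  have "frechet_derivative (\<lambda>x. c * f x) (at x) = (\<lambda>h. c * frechet_derivative f (at x) h)" for x
    using fd by (intro frechet_derivative_at[symmetric] has_derivative_mult_right) (auto simp: frechet_derivative_works)
  moreover have "(\<lambda>x. c * f x) differentiable_on UNIV"
    using Suc.prems by (simp add: differentiable_on_def)
  ultimately show ?case using Suc by simp
qed

lemma Ck_zero: "Ck k (\<lambda>x. 0)"
  by (induction k) simp_all

lemma test_functions_zero: "0 \<in> test_functions \<Omega>"
  by (simp add: test_functions_def smooth_def zero_fun_def Ck_zero)

lemma test_functions_add:
  assumes "\<phi> \<in> test_functions \<Omega>" "\<psi> \<in> test_functions \<Omega>"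
  shows "\<phi> + \<psi> \<in> test_functions \<Omega>"
proof -
  let ?S = "\<lambda>\<phi> :: real ^ 'a \<Rightarrow> real. closure {x. \<phi> x \<noteq> 0}"
  have "?S (\<phi> + \<psi>) \<subseteq> closure ({x. \<phi> x \<noteq> 0} \<union> {x. \<psi> x \<noteq> 0})"
    by (intro closure_mono) auto
  then have sub: "?S (\<phi> + \<psi>) \<subseteq> ?S \<phi> \<union> ?S \<psi>" by (simp add: closure_Un)
  have "compact (?S \<phi> \<union> ?S \<psi>)" using assms by (intro compact_Un) (auto simp: test_functions_def)
  then have "compact (?S (\<phi> + \<psi>))"
    using sub by (metis closed_closure compact_Int_closed inf.absorb_iff2)
  moreover have "smooth (\<phi> + \<psi>)"
    using assms unfolding smooth_def test_functions_def plus_fun_def by (auto intro!: Ck_add)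
  ultimately show ?thesis using assms sub unfolding test_functions_def by blast
qed

lemma test_functions_scale:
  assumes "\<phi> \<in> test_functions \<Omega>"
  shows "r *\<^sub>R \<phi> \<in> test_functions \<Omega>"
proof (cases "r = 0")
  case True
  then show ?thesis using test_functions_zero by simp
next
  case False
  moreover have "smooth (r *\<^sub>R \<phi>)"
    using assms unfolding smooth_def test_functions_def scaleR_fun_def by (auto intro!: Ck_cmult)
  ultimately show ?thesis using assms by (simp add: test_functions_def)
qed

text \<open>The right side is the weight against which the kernel is integrable. The Lipschitz half
  comes from partial derivatives that are continuous with compact support, the constant half from
  boundedness.\<close>

lemma test_function_bounds:
  fixes \<phi> :: "real ^ 'n::finite \<Rightarrow> real"
  assumes \<phi>: "\<phi> \<in> test_functions \<Omega>"
  shows "\<exists>C>0. \<forall>x y. (\<phi> x - \<phi> y)\<^sup>2 \<le> C * min ((norm (x - y))\<^sup>2) 1"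
proof -
  let ?S = "closure {x. \<phi> x \<noteq> 0}"
  have S: "compact ?S" and sm: "\<And>k. Ck k \<phi>" using \<phi> by (auto simp: test_functions_def smooth_def)
  have bounded_if: "\<exists>B. \<forall>x. \<bar>g x\<bar> \<le> B" if "continuous_on UNIV g" "\<And>x. x \<notin> ?S \<Longrightarrow> g x = 0" for g :: "real ^ 'n \<Rightarrow> real"
  proof -
    have "bounded (g ` ?S)"
      using S that(1) by (intro compact_imp_bounded compact_continuous_image) (auto intro: continuous_on_subset)
    then obtain B where "\<And>x. x \<in> ?S \<Longrightarrow> \<bar>g x\<bar> \<le> B" unfolding bounded_iff by auto
    then have "\<bar>g x\<bar> \<le> max B 0" for x using that(2)[of x] by (cases "x \<in> ?S") fastforce+
    then show ?thesis by blast
  qed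
  have zero: "\<phi> x = 0" if "x \<notin> ?S" for x using that closure_subset[of "{x. \<phi> x \<noteq> 0}"] by auto
  have "\<exists>M. \<forall>x. \<bar>\<phi> x\<bar> \<le> M" by (rule bounded_if[OF _ zero]) (use sm[of 0] in simp)
  then obtain M where M: "\<And>x. \<bar>\<phi> x\<bar> \<le> M" by blast
  have fd: "\<phi> differentiable (at x)" for x using sm[of "Suc 0"] by (simp add: differentiable_on_def)
  have "\<exists>B. \<forall>x. \<bar>frechet_derivative \<phi> (at x) (axis i 1)\<bar> \<le> B" for i
  proof (rule bounded_if)
    show "continuous_on UNIV (\<lambda>x. frechet_derivative \<phi> (at x) (axis i 1))" using sm[of "Suc 0"] by simp
    fix x assume x: "x \<notin> ?S"
    \<comment> \<open>Outside the closed support \<open>\<phi>\<close> is 0 on a whole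
      neighbourhood, so its derivative is that of the zero function.\<close>
    have "frechet_derivative \<phi> (at x) = frechet_derivative (\<lambda>_. 0) (at x)"
      by (rule frechet_derivative_transform_within_open[OF fd, of "- ?S"]) (use x in \<open>auto intro: zero\<close>)
    then show "frechet_derivative \<phi> (at x) (axis i 1) = 0" by simp
  qed
  then obtain B where B: "\<And>i x. \<bar>frechet_derivative \<phi> (at x) (axis i 1)\<bar> \<le> B i" by metis
  define L where "L = (\<Sum>i\<in>UNIV. B i)"
  have lip: "norm (\<phi> x - \<phi> y) \<le> L * norm (x - y)" for x y
  proof (rule differentiable_bound[of UNIV \<phi> "\<lambda>x. frechet_derivative \<phi> (at x)"])
    fix x
    show "(\<phi> has_derivative frechet_derivative \<phi> (at x)) (at x within UNIV)"
      using fd by (simp add: frechet_derivative_works)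
    show "onorm (frechet_derivative \<phi> (at x)) \<le> L"
    proof (rule onorm_le)
      fix h :: "real ^ 'n"
      have lin: "linear (frechet_derivative \<phi> (at x))"
        by (rule linear_frechet_derivative[OF fd])
      have "h = (\<Sum>i\<in>UNIV. (h $ i) *\<^sub>R axis i 1)"
        using basis_expansion[of h] by (simp add: scalar_mult_eq_scaleR)
      then have "frechet_derivative \<phi> (at x) h = frechet_derivative \<phi> (at x) (\<Sum>i\<in>UNIV. (h $ i) *\<^sub>R axis i 1)"
        by (rule arg_cong)
      also have "\<dots> = (\<Sum>i\<in>UNIV. (h $ i) * frechet_derivative \<phi> (at x) (axis i 1))"
        by (simp add: linear_sum[OF lin] linear_scale[OF lin])
      also have "norm \<dots> \<le> (\<Sum>i\<in>UNIV. norm h * B i)"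
        by (rule sum_norm_le) (auto simp: abs_mult intro!: mult_mono B component_le_norm_cart)
      also have "\<dots> = L * norm h" by (simp add: L_def sum_distrib_left mult.commute)
      finally show "norm (frechet_derivative \<phi> (at x) h) \<le> L * norm h" .
    qed
  qed auto
  define C where "C = L\<^sup>2 + 4 * M\<^sup>2 + 1"
  have "(\<phi> x - \<phi> y)\<^sup>2 \<le> C * min ((norm (x - y))\<^sup>2) 1" for x y
  proof -
    have "(\<phi> x - \<phi> y)\<^sup>2 \<le> (L * norm (x - y))\<^sup>2"
      using lip[of x y] by (metis abs_le_square_iff abs_ge_self order_trans real_norm_def)
    also have "\<dots> \<le> C * (norm (x - y))\<^sup>2"
      unfolding power_mult_distrib by (intro mult_right_mono) (auto simp: C_def)
    finally have 1: "(\<phi> x - \<phi> y)\<^sup>2 \<le> C * (norm (x - y))\<^sup>2" .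
    have "\<bar>\<phi> x - \<phi> y\<bar> \<le> 2 * M" using M[of x] M[of y] by linarith
    then have "(\<phi> x - \<phi> y)\<^sup>2 \<le> (2 * M)\<^sup>2" by (metis abs_le_square_iff abs_ge_self order_trans)
    also have "\<dots> \<le> C" by (simp add: C_def power_mult_distrib)
    finally show ?thesis using 1 by (simp add: min_def)
  qed
  moreover have "C > 0" by (simp add: C_def add_nonneg_pos)
  ultimately show ?thesis by blast
qed

context fractional_setting
begin

text \<open>\<open>Q\<close> is the union of \<open>\<Omega> \<times> UNIV\<close> and
  \<open>UNIV \<times> \<Omega>\<close>. On each, integrating first in the unbounded variable and
  translating leaves the integral of the weighted kernel times the measure of \<Omega>.\<close>

lemma test_functions_subset_X:
  assumes \<phi>: "\<phi> \<in> test_functions \<Omega>"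
  shows "\<phi> \<in> X"
proof -
  obtain C where C: "C > 0" and bound: "\<And>x y. (\<phi> x - \<phi> y)\<^sup>2 \<le> C * min ((norm (x - y))\<^sup>2) 1"
    using test_function_bounds[OF \<phi>] by blast
  have "continuous_on UNIV \<phi>" using \<phi> by (auto simp: test_functions_def smooth_def dest: spec[of _ 0])
  then have "\<phi> \<in> borel_measurable lborel" using borel_measurable_continuous_onI by simp
  then have \<phi>m: "\<phi> \<in> borel_measurable lebesgue" by (rule measurable_completion)
  define h where "h x = ennreal (min ((norm x)\<^sup>2) 1 * K x)" for x
  have hr: "(\<lambda>x. min ((norm x)\<^sup>2) 1 * K x) \<in> borel_measurable lebesgue" using K_integrable by auto
  then have hm: "h \<in> borel_measurable lebesgue" by (simp add: h_def[abs_def])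
  have h_fin: "(\<integral>\<^sup>+x. h x \<partial>lebesgue) < \<infinity>"
  proof -
    have "(\<integral>\<^sup>+x. h x \<partial>lebesgue) \<le> (\<integral>\<^sup>+x. ennreal (norm (min ((norm x)\<^sup>2) 1 * K x)) \<partial>lebesgue)"
      unfolding h_def real_norm_def by (intro nn_integral_mono ennreal_leI abs_ge_self)
    also have "\<dots> < \<infinity>" using K_integrable by (simp add: integrable_iff_bounded)
    finally show ?thesis .
  qed
  have i\<Omega>: "indicat_real \<Omega> \<in> borel_measurable lebesgue" by simp
  define F1 where "F1 z = indicator \<Omega> (fst z) * h (fst z - snd z)" for z
  define F2 where "F2 z = indicator \<Omega> (snd z) * h (fst z - snd z)" for z
  have F1m: "F1 \<in> borel_measurable lebesgue"
  proof -
    have "(\<lambda>z. ennreal (indicat_real \<Omega> (fst z) * (min ((norm (fst z - snd z))\<^sup>2) 1 * K (fst z - snd z)))) \<in> borel_measurable lebesgue"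
      by (rule measurable_compose[OF borel_measurable_times[OF lebesgue_measurable_fst[OF i\<Omega>]
              lebesgue_measurable_diff[OF hr]] measurable_ennreal])
    also have "(\<lambda>z. ennreal (indicat_real \<Omega> (fst z) * (min ((norm (fst z - snd z))\<^sup>2) 1 * K (fst z - snd z)))) = F1"
      by (rule ext) (simp add: F1_def h_def indicator_def)
    finally show ?thesis .
  qed
  have F2m: "F2 \<in> borel_measurable lebesgue"
  proof -
    have "(\<lambda>z. ennreal (indicat_real \<Omega> (snd z) * (min ((norm (fst z - snd z))\<^sup>2) 1 * K (fst z - snd z)))) \<in> borel_measurable lebesgue"
      by (rule measurable_compose[OF borel_measurable_times[OF lebesgue_measurable_snd[OF i\<Omega>]
              lebesgue_measurable_diff[OF hr]] measurable_ennreal])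
    also have "(\<lambda>z. ennreal (indicat_real \<Omega> (snd z) * (min ((norm (fst z - snd z))\<^sup>2) 1 * K (fst z - snd z)))) = F2"
      by (rule ext) (simp add: F2_def h_def indicator_def)
    finally show ?thesis .
  qed
  have h1: "(\<integral>\<^sup>+y. h (x - y) \<partial>lebesgue) = (\<integral>\<^sup>+y. h y \<partial>lebesgue)"
    and h2: "(\<integral>\<^sup>+x'. h (x' - x) \<partial>lebesgue) = (\<integral>\<^sup>+y. h y \<partial>lebesgue)" for x
    using nn_integral_lebesgue_isometry[OF hm, of "-1" x] nn_integral_lebesgue_isometry[OF hm, of 1 "- x"] by simp_all
  have "(\<integral>\<^sup>+z. F1 z \<partial>lebesgue) = (\<integral>\<^sup>+x. (\<integral>\<^sup>+y. h y \<partial>lebesgue) * indicator \<Omega> x \<partial>lebesgue)"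
    by (subst lebesgue_Tonelli(1)[OF F1m]) (intro nn_integral_cong, auto simp: F1_def h1 indicator_def)
  also have "\<dots> = (\<integral>\<^sup>+y. h y \<partial>lebesgue) * emeasure lebesgue \<Omega>"
    by (rule nn_integral_cmult_indicator) simp
  also have "\<dots> < \<infinity>" using h_fin fmeasurableD2[OF \<Omega>_lmeasurable] by (simp add: ennreal_mult_less_top less_top)
  finally have F1i: "(\<integral>\<^sup>+z. F1 z \<partial>lebesgue) < \<infinity>" .
  have "(\<integral>\<^sup>+z. F2 z \<partial>lebesgue) = (\<integral>\<^sup>+x. (\<integral>\<^sup>+y. h y \<partial>lebesgue) * indicator \<Omega> x \<partial>lebesgue)"
    by (subst lebesgue_Tonelli(2)[OF F2m]) (intro nn_integral_cong, auto simp: F2_def h2 indicator_def)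
  also have "\<dots> = (\<integral>\<^sup>+y. h y \<partial>lebesgue) * emeasure lebesgue \<Omega>"
    by (rule nn_integral_cmult_indicator) simp
  also have "\<dots> < \<infinity>" using h_fin fmeasurableD2[OF \<Omega>_lmeasurable] by (simp add: ennreal_mult_less_top less_top)
  finally have F2i: "(\<integral>\<^sup>+z. F2 z \<partial>lebesgue) < \<infinity>" .
  have "(\<integral>\<^sup>+z. ennreal (D \<phi> \<phi> z) \<partial>MQ) = (\<integral>\<^sup>+z. ennreal (D \<phi> \<phi> z) * indicator Q z \<partial>lebesgue)"
    by (simp add: nn_integral_restrict_space)
  also have "\<dots> \<le> (\<integral>\<^sup>+z. ennreal C * (F1 z + F2 z) \<partial>lebesgue)"
  proof (rule nn_integral_mono)
    fix z :: "(real ^ 'n) \<times> (real ^ 'n)"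
    have "D \<phi> \<phi> z \<le> C * (min ((norm (fst z - snd z))\<^sup>2) 1 * K (fst z - snd z))"
    proof (cases "fst z = snd z")
      case False
      then show ?thesis
        using mult_right_mono[OF bound[of "fst z" "snd z"], of "K (fst z - snd z)"] K_pos[of "fst z - snd z"]
        by (simp add: D_def power2_eq_square mult.assoc)
    qed (simp add: D_def)
    then have "ennreal (D \<phi> \<phi> z) \<le> ennreal C * h (fst z - snd z)"
      using C by (simp add: h_def ennreal_leI flip: ennreal_mult')
    then show "ennreal (D \<phi> \<phi> z) * indicator Q z \<le> ennreal C * (F1 z + F2 z)"
    proof (cases "z \<in> Q")
      case True
      then have "h (fst z - snd z) \<le> F1 z + F2 z"
        by (auto simp: mem_Q F1_def F2_def)
      then have "ennreal C * h (fst z - snd z) \<le> ennreal C * (F1 z + F2 z)" by (rule mult_left_mono) simp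
      then show ?thesis using True \<open>ennreal (D \<phi> \<phi> z) \<le> _\<close> by simp
    qed simp
  qed
  also have "\<dots> = ennreal C * ((\<integral>\<^sup>+z. F1 z \<partial>lebesgue) + (\<integral>\<^sup>+z. F2 z \<partial>lebesgue))"
    using F1m F2m by (simp add: nn_integral_cmult nn_integral_add)
  also have "\<dots> < \<infinity>" using F1i F2i by (simp add: ennreal_mult_less_top)
  finally have "integrable MQ (D \<phi> \<phi>)"
    using D_nonneg D_measurable(2)[OF \<phi>m \<phi>m] by (intro integrableI_nonneg) auto
  then show ?thesis using \<phi>m by (simp add: X_iff)
qed

section \<open>\<open>Z\<close> as a closed subspace of \<open>X\<close>\<close>

lemma ipZ_add_right: "u \<in> X \<Longrightarrow> v \<in> X \<Longrightarrow> w \<in> X \<Longrightarrow> ipZ w (u + v) = ipZ w u + ipZ w v"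
  using ipZ_add_left[of u v w] by (simp add: ipZ_commute[of w])

lemma ipZ_diff_left: "u \<in> X \<Longrightarrow> v \<in> X \<Longrightarrow> w \<in> X \<Longrightarrow> ipZ (u - v) w = ipZ u w - ipZ v w"
  using ipZ_add_left[of "u - v" v w] X_diff[of u v] by simp

lemma ipZ_diff_right: "u \<in> X \<Longrightarrow> v \<in> X \<Longrightarrow> w \<in> X \<Longrightarrow> ipZ w (u - v) = ipZ w u - ipZ w v"
  using ipZ_diff_left[of u v w] by (simp add: ipZ_commute[of w])

text \<open>The norm of \<open>X\<close> squared, for which the parallelogram bound
  \<open>N_add_le\<close> replaces a triangle inequality between roots.\<close>

definition N :: "(real ^ 'n \<Rightarrow> real) \<Rightarrow> real" where "N u = L2_ip M\<Omega> u u + ipZ u u"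

lemma norm_X_eq: "norm_X \<Omega> K u = sqrt (N u)"
  by (simp add: norm_X_def N_def L2_ip_def ipZ_eq D_def case_prod_unfold power2_eq_square abs_mult_self)

lemma N_nonneg: "N u \<ge> 0"
  unfolding N_def using ipZ_nonneg[of u] by (auto simp: L2_ip_def intro!: add_nonneg_nonneg)

lemma Z_iff: "u \<in> Z \<longleftrightarrow> u \<in> X \<and> (\<forall>\<epsilon>>0. \<exists>\<phi>\<in>test_functions \<Omega>. N (u - \<phi>) < \<epsilon>)"
proof -
  have "(\<forall>\<epsilon>>0. \<exists>\<phi>\<in>test_functions \<Omega>. sqrt (N (u - \<phi>)) < \<epsilon>) \<longleftrightarrow> (\<forall>\<epsilon>>0. \<exists>\<phi>\<in>test_functions \<Omega>. N (u - \<phi>) < \<epsilon>)" (is "?L \<longleftrightarrow> ?R")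
  proof
    assume ?L
    show ?R
    proof (intro allI impI)
      fix \<epsilon> :: real assume "\<epsilon> > 0"
      then show "\<exists>\<phi>\<in>test_functions \<Omega>. N (u - \<phi>) < \<epsilon>"
        using \<open>?L\<close>[rule_format, of "sqrt \<epsilon>"] by simp
    qed
  next
    assume ?R
    show ?L
    proof (intro allI impI)
      fix \<epsilon> :: real assume e: "\<epsilon> > 0"
      then obtain \<phi> where "\<phi> \<in> test_functions \<Omega>" "N (u - \<phi>) < \<epsilon>\<^sup>2"
        using \<open>?R\<close>[rule_format, of "\<epsilon>\<^sup>2"] by auto
      then show "\<exists>\<phi>\<in>test_functions \<Omega>. sqrt (N (u - \<phi>)) < \<epsilon>"
        using e by (intro bexI[of _ \<phi>]) (auto intro: real_less_lsqrt)
    qed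
  qed
  then show ?thesis by (simp add: Z_space_def norm_X_eq fun_diff_def)
qed

lemma Z_subset_X: "u \<in> Z \<Longrightarrow> u \<in> X"
  by (simp add: Z_iff)

lemma Z_L2: "u \<in> Z \<Longrightarrow> u \<in> L2 M\<Omega>"
  by (intro X_subset_L2 Z_subset_X)

lemma N_add_le:
  assumes u: "u \<in> X" and v: "v \<in> X"
  shows "N (u + v) \<le> 2 * N u + 2 * N v"
proof -
  interpret H: semi_hilbert "L2 M\<Omega>" "L2_ip M\<Omega>" by (rule finite_measure.semi_hilbert_L2[OF finite_M\<Omega>])
  have "L2_ip M\<Omega> (u - v) (u - v) \<ge> 0" "ipZ (u - v) (u - v) \<ge> 0"
    by (simp_all add: L2_ip_def ipZ_nonneg)
  moreover have "L2_ip M\<Omega> (u + v) (u + v) + L2_ip M\<Omega> (u - v) (u - v) = 2 * L2_ip M\<Omega> u u + 2 * L2_ip M\<Omega> v v"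
    using u v X_subset_L2 by (simp add: H.ip_bilinear)
  moreover have "ipZ (u + v) (u + v) + ipZ (u - v) (u - v) = 2 * ipZ u u + 2 * ipZ v v"
  proof -
    have "ipZ (u + v) (u + v) = ipZ u u + ipZ u v + (ipZ v u + ipZ v v)"
      using u v by (simp only: ipZ_add_left ipZ_add_right X_add)
    moreover have "ipZ (u - v) (u - v) = (ipZ u u - ipZ u v) - (ipZ v u - ipZ v v)"
      using u v by (simp only: ipZ_diff_left ipZ_diff_right X_diff)
    ultimately show ?thesis by simp
  qed
  ultimately show ?thesis by (simp add: N_def)
qed

lemma N_scale: "N (r *\<^sub>R u) = r\<^sup>2 * N u"
proof -
  have "L2_ip M\<Omega> (r *\<^sub>R u) (r *\<^sub>R u) = r\<^sup>2 * L2_ip M\<Omega> u u"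
  proof -
    have "(\<lambda>x. (r *\<^sub>R u) x * (r *\<^sub>R u) x) = (\<lambda>x. r\<^sup>2 * (u x * u x))"
      by (rule ext) (simp add: power2_eq_square)
    then show ?thesis by (simp add: L2_ip_def)
  qed
  moreover have "ipZ (r *\<^sub>R u) (r *\<^sub>R u) = r\<^sup>2 * ipZ u u"
    by (simp add: ipZ_eq D_scale_sq)
  ultimately show ?thesis by (simp add: N_def distrib_left)
qed

lemma Z_closed:
  assumes u: "u \<in> X" and approx: "\<And>\<epsilon>. \<epsilon> > 0 \<Longrightarrow> \<exists>v\<in>Z. N (u - v) < \<epsilon>"
  shows "u \<in> Z"
  unfolding Z_iff
proof (intro conjI allI impI)
  fix \<epsilon> :: real assume e: "\<epsilon> > 0"
  obtain v where v: "v \<in> Z" "N (u - v) < \<epsilon> / 4" using approx[of "\<epsilon> / 4"] e by auto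
  obtain \<phi> where \<phi>: "\<phi> \<in> test_functions \<Omega>" "N (v - \<phi>) < \<epsilon> / 4"
    using v(1) e unfolding Z_iff by (meson divide_pos_pos zero_less_numeral)
  have "N ((u - v) + (v - \<phi>)) \<le> 2 * N (u - v) + 2 * N (v - \<phi>)"
    using u v \<phi> Z_subset_X test_functions_subset_X by (intro N_add_le X_diff) auto
  also have "(u - v) + (v - \<phi>) = u - \<phi>" by simp
  finally have "N (u - \<phi>) < \<epsilon>" using v(2) \<phi>(2) by linarith
  then show "\<exists>\<phi>\<in>test_functions \<Omega>. N (u - \<phi>) < \<epsilon>" using \<phi>(1) by (rule bexI)
qed (rule u)

lemma subspace_Z: "subspace Z"
  unfolding subspace_def
proof (intro conjI ballI allI)
  have "N (0 - 0) = 0" using N_scale[of 0 0] by simp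
  then show "0 \<in> Z" using X_zero test_functions_zero by (auto simp: Z_iff intro!: bexI[of _ 0])
next
  fix u v assume u: "u \<in> Z" and v: "v \<in> Z"
  show "u + v \<in> Z"
    unfolding Z_iff
  proof (intro conjI allI impI)
    show "u + v \<in> X" using u v by (intro X_add Z_subset_X)
    fix \<epsilon> :: real assume "\<epsilon> > 0"
    then have e: "\<epsilon> / 4 > 0" by simp
    obtain \<phi> \<psi> where \<phi>: "\<phi> \<in> test_functions \<Omega>" "N (u - \<phi>) < \<epsilon> / 4" and \<psi>: "\<psi> \<in> test_functions \<Omega>" "N (v - \<psi>) < \<epsilon> / 4"
      using u v e unfolding Z_iff by meson
    have "N ((u - \<phi>) + (v - \<psi>)) \<le> 2 * N (u - \<phi>) + 2 * N (v - \<psi>)"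
      using u v \<phi> \<psi> Z_subset_X test_functions_subset_X by (intro N_add_le X_diff) auto
    also have "(u - \<phi>) + (v - \<psi>) = (u + v) - (\<phi> + \<psi>)" by (rule add_diff_add[symmetric])
    finally have "N (u + v - (\<phi> + \<psi>)) < \<epsilon>" using \<phi>(2) \<psi>(2) by linarith
    then show "\<exists>\<phi>\<in>test_functions \<Omega>. N (u + v - \<phi>) < \<epsilon>"
      using test_functions_add[OF \<phi>(1) \<psi>(1)] by (rule bexI)
  qed
next
  fix u r assume u: "u \<in> Z"
  show "r *\<^sub>R u \<in> Z"
    unfolding Z_iff
  proof (intro conjI allI impI)
    show "r *\<^sub>R u \<in> X" using u by (intro X_scale Z_subset_X)
    fix \<epsilon> :: real assume e: "\<epsilon> > 0"
    have "\<epsilon> / (r\<^sup>2 + 1) > 0" using e by (intro divide_pos_pos) (auto intro: add_nonneg_pos)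
    then obtain \<phi> where \<phi>: "\<phi> \<in> test_functions \<Omega>" "N (u - \<phi>) < \<epsilon> / (r\<^sup>2 + 1)"
      using u unfolding Z_iff by meson
    have "N (r *\<^sub>R u - r *\<^sub>R \<phi>) = r\<^sup>2 * N (u - \<phi>)"
      unfolding scaleR_diff_right[symmetric] by (rule N_scale)
    also have "\<dots> \<le> (r\<^sup>2 + 1) * N (u - \<phi>)" using N_nonneg by (intro mult_right_mono) auto
    also have "\<dots> < (r\<^sup>2 + 1) * (\<epsilon> / (r\<^sup>2 + 1))" using \<phi> by (intro mult_strict_left_mono) (auto intro: add_nonneg_pos)
    also have "\<dots> = \<epsilon>" using add_nonneg_pos[of "r\<^sup>2" 1] by simp
    finally show "\<exists>\<phi>\<in>test_functions \<Omega>. N (r *\<^sub>R u - \<phi>) < \<epsilon>"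
      using test_functions_scale[OF \<phi>(1)] by (rule bexI)
  qed
qed

text \<open>The norm of \<open>X\<close> contains no integral of \<open>u\<^sup>2\<close> outside
  \<Omega>, so vanishing there is not immediate. For a test function \<open>\<phi>\<close> the
  difference \<open>w = u - \<phi>\<close> equals \<open>u\<close> off \<Omega>, and
  \<open>(w y)\<^sup>2 \<le> 2 (w x - w y)\<^sup>2 + 2 (w x)\<^sup>2\<close> with \<open>x\<close>
  in \<Omega> bounds its square integral by the energy and the \<open>L2\<close> norm of
  \<open>w\<close>, both arbitrarily small. Staying inside a ball keeps the kernel bounded
  below.\<close>

lemma Z_zero_on_bounded:
  assumes u: "u \<in> Z" and R: "R > 0"
  shows "AE x in lebesgue. x \<in> cball 0 R - \<Omega> \<longrightarrow> u x = 0"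
proof -
  define B where "B = cball 0 R - \<Omega>"
  define MB where "MB = lebesgue_on B"
  have B: "B \<in> lmeasurable" unfolding B_def by (intro fmeasurable_Diff) auto
  have Bs: "B \<in> sets lebesgue" using B by auto
  interpret MB: finite_measure MB unfolding MB_def by (rule finite_measure_lebesgue_on[OF B])
  interpret MO: finite_measure M\<Omega> by (rule finite_M\<Omega>)
  obtain r where r: "r > 0" "\<And>x. x \<in> \<Omega> \<Longrightarrow> norm x \<le> r"
    using \<Omega>_bounded unfolding bounded_pos by blast
  obtain \<kappa> where \<kappa>: "\<kappa> > 0" and \<kappa>K: "\<And>x y. x \<noteq> y \<Longrightarrow> norm (x - y) \<le> r + R \<Longrightarrow> \<kappa> \<le> K (x - y)"
    using kernel_lower_bound[of "r + R"] r R by auto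
  define S where "S = (\<integral>\<^sup>+y. ennreal ((u y)\<^sup>2) \<partial>MB)"
  define m where "m = measure lebesgue B"
  have space_MB: "emeasure MB (space MB) = ennreal m"
    using Bs B by (simp add: MB_def m_def emeasure_restrict_space emeasure_eq_measure2)
  \<comment> \<open>The part \<open>2 / \<kappa>\<close> comes from the energy of \<open>w\<close>
    over \<open>\<Omega> \<times> B\<close>, the part \<open>2 * m\<close> from integrating
    \<open>(w x)\<^sup>2\<close> over \<open>y\<close> in \<open>B\<close>.\<close>
  have bound: "S * emeasure lebesgue \<Omega> \<le> ennreal ((2 / \<kappa> + 2 * m) * \<epsilon>)" if \<epsilon>: "\<epsilon> > 0" for \<epsilon>
  proof -
    obtain \<phi> where \<phi>: "\<phi> \<in> test_functions \<Omega>" and N: "N (u - \<phi>) < \<epsilon>"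
      using u \<epsilon> unfolding Z_iff by meson
    define w where "w = u - \<phi>"
    have w: "w \<in> X" using u \<phi> Z_subset_X test_functions_subset_X unfolding w_def by (intro X_diff) auto
    have wL2: "w \<in> L2 M\<Omega>" by (rule X_subset_L2[OF w])
    have [measurable]: "w \<in> borel_measurable M\<Omega>" "w \<in> borel_measurable MB"
      unfolding MB_def using X_measurable_on[OF w] by auto
    have wu: "w y = u y" if "y \<in> B" for y
    proof -
      have "y \<notin> \<Omega>" using that by (simp add: B_def)
      then have "\<phi> y = 0" using \<phi> closure_subset[of "{x. \<phi> x \<noteq> 0}"] by (auto simp: test_functions_def)
      then show ?thesis by (simp add: w_def)
    qed
    have parts: "ipZ w w \<le> \<epsilon>" "L2_ip M\<Omega> w w \<le> \<epsilon>"
    proof -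
      have "L2_ip M\<Omega> w w \<ge> 0" by (simp add: L2_ip_def)
      then show "ipZ w w \<le> \<epsilon>" "L2_ip M\<Omega> w w \<le> \<epsilon>"
        using N ipZ_nonneg[of w] unfolding N_def w_def[symmetric] by linarith+
    qed
    define J where "J x = (\<integral>\<^sup>+y. ennreal ((w x - w y)\<^sup>2) \<partial>MB)" for x
    have Jm: "J \<in> borel_measurable M\<Omega>"
      unfolding J_def[abs_def] by (rule MB.borel_measurable_nn_integral) measurable
    have "ennreal \<kappa> * (\<integral>\<^sup>+x. J x \<partial>M\<Omega>) \<le> ennreal (ipZ w w)"
      unfolding J_def MB_def
    proof (rule rectangle_lower_bound[OF w])
      fix x y assume "x \<in> \<Omega>" "y \<in> B" "x \<noteq> y"
      then show "\<kappa> \<le> K (x - y)"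
        using r(2)[of x] norm_triangle_ineq4[of x y] by (intro \<kappa>K) (auto simp: B_def)
    qed (use \<kappa> Bs in auto)
    also have "\<dots> \<le> ennreal \<epsilon>" using parts by (intro ennreal_leI)
    finally have "ennreal (1 / \<kappa>) * (ennreal \<kappa> * (\<integral>\<^sup>+x. J x \<partial>M\<Omega>)) \<le> ennreal (1 / \<kappa>) * ennreal \<epsilon>"
      by (rule mult_left_mono) simp
    then have J_int: "(\<integral>\<^sup>+x. J x \<partial>M\<Omega>) \<le> ennreal (\<epsilon> / \<kappa>)"
      using \<kappa> by (simp add: mult.assoc[symmetric] flip: ennreal_mult')
    have "S * emeasure lebesgue \<Omega> = (\<integral>\<^sup>+x. S \<partial>M\<Omega>)" by (simp add: emeasure_restrict_space)
    also have "\<dots> \<le> (\<integral>\<^sup>+x. 2 * J x + ennreal (2 * m) * ennreal ((w x)\<^sup>2) \<partial>M\<Omega>)"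
    proof (rule nn_integral_mono)
      fix x
      have "S \<le> (\<integral>\<^sup>+y. 2 * ennreal ((w x - w y)\<^sup>2) + ennreal (2 * (w x)\<^sup>2) \<partial>MB)"
        unfolding S_def
      proof (rule nn_integral_mono)
        fix y assume "y \<in> space MB"
        then have "u y = w y" using wu by (simp add: MB_def)
        moreover have "(w y)\<^sup>2 \<le> 2 * (w x - w y)\<^sup>2 + 2 * (w x)\<^sup>2"
        proof -
          have "0 \<le> (2 * w x - w y)\<^sup>2" by simp
          then show ?thesis by (simp add: power2_eq_square algebra_simps)
        qed
        ultimately have "ennreal ((u y)\<^sup>2) \<le> ennreal (2 * (w x - w y)\<^sup>2 + 2 * (w x)\<^sup>2)"
          by (intro ennreal_leI) simp
        also have "\<dots> = 2 * ennreal ((w x - w y)\<^sup>2) + ennreal (2 * (w x)\<^sup>2)"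
          by (simp add: ennreal_plus ennreal_mult' )
        finally show "ennreal ((u y)\<^sup>2) \<le> 2 * ennreal ((w x - w y)\<^sup>2) + ennreal (2 * (w x)\<^sup>2)" .
      qed
      also have "\<dots> = 2 * J x + ennreal (2 * (w x)\<^sup>2) * ennreal m"
        unfolding J_def by (subst nn_integral_add) (auto simp: nn_integral_cmult space_MB)
      also have "ennreal (2 * (w x)\<^sup>2) * ennreal m = ennreal (2 * m) * ennreal ((w x)\<^sup>2)"
        by (simp add: m_def mult_ac flip: ennreal_mult)
      finally show "S \<le> 2 * J x + ennreal (2 * m) * ennreal ((w x)\<^sup>2)" .
    qed
    also have "\<dots> = 2 * (\<integral>\<^sup>+x. J x \<partial>M\<Omega>) + ennreal (2 * m) * (\<integral>\<^sup>+x. ennreal ((w x)\<^sup>2) \<partial>M\<Omega>)"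
      using Jm by (subst nn_integral_add) (auto simp: nn_integral_cmult)
    finally have le1: "S * emeasure lebesgue \<Omega> \<le> 2 * (\<integral>\<^sup>+x. J x \<partial>M\<Omega>) + ennreal (2 * m) * (\<integral>\<^sup>+x. ennreal ((w x)\<^sup>2) \<partial>M\<Omega>)" .
    have w_int: "(\<integral>\<^sup>+x. ennreal ((w x)\<^sup>2) \<partial>M\<Omega>) = ennreal (L2_ip M\<Omega> w w)"
      using L2_integrable_sq[OF wL2] by (simp add: nn_integral_eq_integral L2_ip_def power2_eq_square)
    have le2: "2 * (\<integral>\<^sup>+x. J x \<partial>M\<Omega>) + ennreal (2 * m) * ennreal (L2_ip M\<Omega> w w)
        \<le> 2 * ennreal (\<epsilon> / \<kappa>) + ennreal (2 * m) * ennreal \<epsilon>"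
      using J_int parts by (intro add_mono mult_left_mono ennreal_leI) auto
    have eq: "2 * ennreal (\<epsilon> / \<kappa>) + ennreal (2 * m) * ennreal \<epsilon> = ennreal ((2 / \<kappa> + 2 * m) * \<epsilon>)"
    proof -
      have m0: "m \<ge> 0" by (simp add: m_def)
      have "(2 / \<kappa> + 2 * m) * \<epsilon> = 2 * (\<epsilon> / \<kappa>) + 2 * m * \<epsilon>" by (simp add: algebra_simps)
      then have "ennreal ((2 / \<kappa> + 2 * m) * \<epsilon>) = ennreal (2 * (\<epsilon> / \<kappa>)) + ennreal (2 * m * \<epsilon>)"
        using m0 \<kappa> \<epsilon> by (simp only:) (rule ennreal_plus, auto)
      moreover have "ennreal (2 * (\<epsilon> / \<kappa>)) = ennreal 2 * ennreal (\<epsilon> / \<kappa>)"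
        using \<kappa> \<epsilon> by (intro ennreal_mult) auto
      moreover have "ennreal (2 * m * \<epsilon>) = ennreal (2 * m) * ennreal \<epsilon>"
        using m0 \<epsilon> by (intro ennreal_mult) auto
      ultimately show ?thesis by (simp only: ennreal_numeral)
    qed
    show ?thesis using order_trans[OF le1[unfolded w_int] le2] unfolding eq .
  qed
  have C: "2 / \<kappa> + 2 * m > 0" using \<kappa> by (intro add_pos_nonneg) (auto simp: m_def)
  have "S * emeasure lebesgue \<Omega> \<le> 0"
  proof (rule ennreal_le_epsilon)
    fix e :: real assume "e > 0"
    then show "S * emeasure lebesgue \<Omega> \<le> 0 + ennreal e"
      using bound[OF divide_pos_pos[OF _ C], of e] C by simp
  qed
  moreover have "emeasure lebesgue \<Omega> \<noteq> 0"
    using \<Omega>_measure_pos by (auto simp: measure_def)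
  ultimately have "S = 0" by auto
  then have "AE y in MB. ennreal ((u y)\<^sup>2) = 0"
    unfolding S_def using X_measurable_on[OF Z_subset_X[OF u], of B]
    by (subst (asm) nn_integral_0_iff_AE) (auto simp: MB_def)
  then have "AE y in lebesgue. y \<in> B \<longrightarrow> ennreal ((u y)\<^sup>2) = 0"
    using Bs unfolding MB_def by (subst (asm) AE_restrict_space_iff) auto
  then show ?thesis by eventually_elim (auto simp: B_def)
qed

lemma Z_zero_outside:
  assumes u: "u \<in> Z"
  shows "AE x in lebesgue. x \<notin> \<Omega> \<longrightarrow> u x = 0"
proof -
  have "AE x in lebesgue. \<forall>n. x \<in> cball 0 (real (Suc n)) - \<Omega> \<longrightarrow> u x = 0"
    unfolding AE_all_countable using Z_zero_on_bounded[OF u] by simp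
  then show ?thesis
  proof eventually_elim
    case (elim x)
    obtain n where "norm x \<le> real n" using real_arch_simple by blast
    then have "x \<in> cball 0 (real (Suc n))" by simp
    then show ?case using elim by blast
  qed
qed

text \<open>Take a ball \<open>B\<close> outside \<Omega> but at bounded distance. For almost every
  \<open>y\<close> in \<open>B\<close> the value \<open>u y\<close> is 0, so the energy density on
  \<open>\<Omega> \<times> B\<close> dominates \<open>\<kappa> (u x)\<^sup>2\<close>; integrating
  over \<open>B\<close> produces the constant \<open>1 / (\<kappa> * m)\<close>.\<close>

lemma poincare: "\<exists>C>0. \<forall>u\<in>Z. L2_ip M\<Omega> u u \<le> C * ipZ u u"
proof -
  obtain r where r: "r > 0" "\<And>x. x \<in> \<Omega> \<Longrightarrow> norm x \<le> r"
    using \<Omega>_bounded unfolding bounded_pos by blast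
  \<comment> \<open>The open unit ball around a point of norm \<open>r + 1\<close> just misses the
    ball of radius \<open>r\<close> that contains \<Omega>.\<close>
  obtain p :: "real ^ 'n" where p: "norm p = r + 1" using vector_choose_size[of "r + 1"] r by auto
  define B where "B = ball p 1"
  have Bnorm: "norm y < r + 2 \<and> y \<notin> \<Omega>" if "y \<in> B" for y
  proof -
    have "norm (y - p) < 1" using that by (simp add: B_def dist_norm norm_minus_commute)
    then have "norm y > r" "norm y < r + 2"
      using p norm_triangle_ineq2[of p y] norm_triangle_ineq2[of y p] by (auto simp: norm_minus_commute)
    then show ?thesis using r(2)[of y] by auto
  qed
  define m where "m = measure lebesgue B"
  have m: "m > 0" unfolding m_def B_def using content_ball_pos[of 1 p] by simp
  have B: "B \<in> lmeasurable" by (simp add: B_def)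
  have Bs: "B \<in> sets lebesgue" using B by auto
  have emB: "emeasure lebesgue B = ennreal m" using B by (simp add: m_def emeasure_eq_measure2)
  obtain \<kappa> where \<kappa>: "\<kappa> > 0" and \<kappa>K: "\<And>x y. x \<noteq> y \<Longrightarrow> norm (x - y) \<le> r + (r + 2) \<Longrightarrow> \<kappa> \<le> K (x - y)"
    using kernel_lower_bound[of "r + (r + 2)"] r by auto
  have "L2_ip M\<Omega> u u \<le> 1 / (\<kappa> * m) * ipZ u u" if u: "u \<in> Z" for u
  proof -
    have ux: "u \<in> X" by (rule Z_subset_X[OF u])
    have zero: "AE y in lebesgue_on B. u y = 0"
      using Z_zero_outside[OF u] Bs Bnorm by (auto simp: AE_restrict_space_iff elim!: eventually_mono)
    have "(\<integral>\<^sup>+x. \<integral>\<^sup>+y. ennreal ((u x - u y)\<^sup>2) \<partial>lebesgue_on B \<partial>M\<Omega>) = (\<integral>\<^sup>+x. ennreal m * ennreal ((u x)\<^sup>2) \<partial>M\<Omega>)"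
    proof (rule nn_integral_cong)
      fix x
      have "(\<integral>\<^sup>+y. ennreal ((u x - u y)\<^sup>2) \<partial>lebesgue_on B) = (\<integral>\<^sup>+y. ennreal ((u x)\<^sup>2) \<partial>lebesgue_on B)"
        using zero by (intro nn_integral_cong_AE) (auto elim!: eventually_mono)
      then show "(\<integral>\<^sup>+y. ennreal ((u x - u y)\<^sup>2) \<partial>lebesgue_on B) = ennreal m * ennreal ((u x)\<^sup>2)"
        using Bs by (simp add: emeasure_restrict_space emB mult.commute)
    qed
    also have "\<dots> = ennreal m * (\<integral>\<^sup>+x. ennreal ((u x)\<^sup>2) \<partial>M\<Omega>)"
      using X_measurable_on[OF ux, of \<Omega>] by (intro nn_integral_cmult) simp
    also have "(\<integral>\<^sup>+x. ennreal ((u x)\<^sup>2) \<partial>M\<Omega>) = ennreal (L2_ip M\<Omega> u u)"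
      using L2_integrable_sq[OF Z_L2[OF u]] by (simp add: nn_integral_eq_integral L2_ip_def power2_eq_square)
    finally have eq: "(\<integral>\<^sup>+x. \<integral>\<^sup>+y. ennreal ((u x - u y)\<^sup>2) \<partial>lebesgue_on B \<partial>M\<Omega>) = ennreal m * ennreal (L2_ip M\<Omega> u u)" .
    have "ennreal \<kappa> * (\<integral>\<^sup>+x. \<integral>\<^sup>+y. ennreal ((u x - u y)\<^sup>2) \<partial>lebesgue_on B \<partial>M\<Omega>) \<le> ennreal (ipZ u u)"
    proof (rule rectangle_lower_bound[OF ux])
      fix x y assume "x \<in> \<Omega>" "y \<in> B" "x \<noteq> y"
      then show "\<kappa> \<le> K (x - y)"
        using r(2)[of x] Bnorm[of y] norm_triangle_ineq4[of x y] by (intro \<kappa>K) auto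
    qed (use \<kappa> Bs in auto)
    then have "ennreal (\<kappa> * m * L2_ip M\<Omega> u u) \<le> ennreal (ipZ u u)"
      unfolding eq using \<kappa> m by (simp add: ennreal_mult' mult.assoc)
    then have "\<kappa> * m * L2_ip M\<Omega> u u \<le> ipZ u u"
      using ipZ_nonneg by (subst (asm) ennreal_le_iff) auto
    then show ?thesis using \<kappa> m by (simp add: field_simps)
  qed
  moreover have "1 / (\<kappa> * m) > 0" using \<kappa> m by simp
  ultimately show ?thesis by blast
qed

section \<open>Completeness of \<open>Z\<close>\<close>

lemma Z_diff: "u \<in> Z \<Longrightarrow> v \<in> Z \<Longrightarrow> u - v \<in> Z"
  by (rule subspace_diff[OF subspace_Z])

lemma semi_hilbert_Z: "semi_hilbert Z ipZ"
proof
  show "subspace Z" by (rule subspace_Z)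
next
  fix x :: "nat \<Rightarrow> real ^ 'n \<Rightarrow> real"
  assume x: "\<And>n. x n \<in> Z"
    and cauchy: "\<And>e. e > 0 \<Longrightarrow> \<exists>N. \<forall>m\<ge>N. \<forall>n\<ge>N. ipZ (x m - x n) (x m - x n) < e"
  obtain C where C: "C > 0" and poinc: "\<And>u. u \<in> Z \<Longrightarrow> L2_ip M\<Omega> u u \<le> C * ipZ u u"
    using poincare by blast
  interpret MO: finite_measure M\<Omega> by (rule finite_M\<Omega>)
  have "\<exists>N. \<forall>m\<ge>N. \<forall>n\<ge>N. (\<integral>y. (x m y - x n y)\<^sup>2 \<partial>M\<Omega>) < e" if e: "e > 0" for e
  proof -
    obtain N where N: "\<And>m n. m \<ge> N \<Longrightarrow> n \<ge> N \<Longrightarrow> ipZ (x m - x n) (x m - x n) < e / C"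
      using cauchy[of "e / C"] divide_pos_pos[OF e C] by blast
    have "(\<integral>y. (x m y - x n y)\<^sup>2 \<partial>M\<Omega>) < e" if "m \<ge> N" "n \<ge> N" for m n
    proof -
      have "L2_ip M\<Omega> (x m - x n) (x m - x n) \<le> C * ipZ (x m - x n) (x m - x n)"
        by (intro poinc Z_diff x)
      also have "\<dots> < C * (e / C)" using C by (intro mult_strict_left_mono N that)
      finally show ?thesis using C by (simp add: L2_ip_def power2_eq_square)
    qed
    then show ?thesis by blast
  qed
  from MO.L2_cauchy_AE_subseq[OF Z_L2[OF x] this] obtain r l
    where r: "strict_mono (r :: nat \<Rightarrow> nat)" and l: "l \<in> borel_measurable M\<Omega>"
      and ae: "AE y in M\<Omega>. (\<lambda>n. x (r n) y) \<longlonglongrightarrow> l y" by blast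
  \<comment> \<open>Extension by 0 matches the sequence off \<Omega>, so convergence holds almost
    everywhere on the whole space; the energy over \<open>Q\<close> involves points outside
    \<Omega>.\<close>
  define u where "u y = (if y \<in> \<Omega> then l y else 0)" for y
  have um: "u \<in> borel_measurable lebesgue"
    unfolding u_def[abs_def] using l by (subst borel_measurable_if) auto
  have "AE y in lebesgue. \<forall>n. y \<notin> \<Omega> \<longrightarrow> x (r n) y = 0"
    unfolding AE_all_countable using Z_zero_outside[OF x] by simp
  moreover have "AE y in lebesgue. y \<in> \<Omega> \<longrightarrow> (\<lambda>n. x (r n) y) \<longlonglongrightarrow> l y"
    using ae by (simp add: AE_restrict_space_iff)
  ultimately have ae_u: "AE y in lebesgue. (\<lambda>n. x (r n) y) \<longlonglongrightarrow> u y"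
    by eventually_elim (auto simp: u_def)
  have xm: "x n \<in> borel_measurable lebesgue" for n using x Z_subset_X X_measurable by blast
  have close: "x m - u \<in> X \<and> N (x m - u) \<le> (C + 1) * e"
    if N0: "\<And>m n. m \<ge> N0 \<Longrightarrow> n \<ge> N0 \<Longrightarrow> ipZ (x m - x n) (x m - x n) < e" and m: "m \<ge> N0" for e N0 m
  proof -
    \<comment> \<open>A square root of the energy density, so that
      \<open>integrable_sq_Fatou\<close> applies on \<open>Q\<close>. The absolute value can matter
      only on the diagonal, where the first factor is 0.\<close>
    define G where "G v z = (v (fst z) - v (snd z)) * sqrt (\<bar>K (fst z - snd z)\<bar>)" for v z
    have G_sq: "(G v z)\<^sup>2 = D v v z" for v z
    proof (cases "fst z = snd z")
      case False
      then show ?thesis using K_pos[of "fst z - snd z"]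
        by (simp add: G_def D_def power_mult_distrib power2_eq_square)
    qed (simp add: G_def D_def)
    have sqrt_K: "(\<lambda>x. sqrt \<bar>K x\<bar>) \<in> borel_measurable lebesgue" using K_lebesgue by measurable
    have G_meas: "G v \<in> borel_measurable MQ" if "v \<in> borel_measurable lebesgue" for v
      unfolding G_def[abs_def]
      by (intro measurable_restrict_space1 borel_measurable_times borel_measurable_diff lebesgue_measurable_fst
          lebesgue_measurable_snd lebesgue_measurable_diff[OF sqrt_K] that)
    have le_e: "ipZ (x m - x (r n)) (x m - x (r n)) \<le> e" if "n \<ge> N0" for n
      using N0[OF m, of "r n"] seq_suble[OF r, of n] that by simp
    have "integrable MQ (\<lambda>z. (G (x m - u) z)\<^sup>2) \<and> (\<integral>z. (G (x m - u) z)\<^sup>2 \<partial>MQ) \<le> e"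
    proof (rule integrable_sq_Fatou)
      show "G (x m - x (r n)) \<in> borel_measurable MQ" for n
        by (intro G_meas) (use xm in \<open>simp add: fun_diff_def\<close>)
      show "G (x m - u) \<in> borel_measurable MQ"
        by (intro G_meas) (use xm um in \<open>simp add: fun_diff_def\<close>)
      have "AE z in (lebesgue :: ((real ^ 'n) \<times> (real ^ 'n)) measure). (\<lambda>n. G (x m - x (r n)) z) \<longlonglongrightarrow> G (x m - u) z"
        using AE_lebesgue_fst[OF ae_u] AE_lebesgue_snd[OF ae_u]
        by eventually_elim (auto simp: G_def intro!: tendsto_intros)
      then show "AE z in MQ. (\<lambda>n. G (x m - x (r n)) z) \<longlonglongrightarrow> G (x m - u) z"
        by (auto simp: AE_restrict_space_iff elim: eventually_mono)
      show "integrable MQ (\<lambda>z. (G (x m - x (r n)) z)\<^sup>2)" for n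
        unfolding G_sq using X_integrable[OF Z_subset_X[OF Z_diff[OF x x]]] by simp
      show "eventually (\<lambda>n. (\<integral>z. (G (x m - x (r n)) z)\<^sup>2 \<partial>MQ) \<le> e) sequentially"
        unfolding G_sq ipZ_eq[symmetric] eventually_sequentially using le_e by blast
    qed
    then have Q: "integrable MQ (D (x m - u) (x m - u))" "ipZ (x m - u) (x m - u) \<le> e"
      unfolding G_sq ipZ_eq by simp_all
    have X: "x m - u \<in> X" using Q(1) xm[of m] um by (simp add: X_iff fun_diff_def)
    have "integrable M\<Omega> (\<lambda>y. (x m y - u y)\<^sup>2) \<and> (\<integral>y. (x m y - u y)\<^sup>2 \<partial>M\<Omega>) \<le> C * e"
    proof (rule integrable_sq_Fatou)
      show "(\<lambda>y. x m y - x (r n) y) \<in> borel_measurable M\<Omega>" for n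
        using measurable_restrict_space1[OF xm] by auto
      show "(\<lambda>y. x m y - u y) \<in> borel_measurable M\<Omega>"
        using measurable_restrict_space1[OF xm] measurable_restrict_space1[OF um] by auto
      have "AE y in lebesgue. (\<lambda>n. x m y - x (r n) y) \<longlonglongrightarrow> x m y - u y"
        using ae_u by eventually_elim (intro tendsto_intros)
      then show "AE y in M\<Omega>. (\<lambda>n. x m y - x (r n) y) \<longlonglongrightarrow> x m y - u y"
        by (auto simp: AE_restrict_space_iff elim: eventually_mono)
      show "integrable M\<Omega> (\<lambda>y. (x m y - x (r n) y)\<^sup>2)" for n
        using L2_integrable_sq[OF Z_L2[OF Z_diff[OF x x]]] by simp
      have "(\<integral>y. (x m y - x (r n) y)\<^sup>2 \<partial>M\<Omega>) \<le> C * e" if "n \<ge> N0" for n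
      proof -
        have "L2_ip M\<Omega> (x m - x (r n)) (x m - x (r n)) \<le> C * ipZ (x m - x (r n)) (x m - x (r n))"
          by (intro poinc Z_diff x)
        also have "\<dots> \<le> C * e" using C le_e[OF that] by simp
        finally show ?thesis by (simp add: L2_ip_def power2_eq_square)
      qed
      then show "eventually (\<lambda>n. (\<integral>y. (x m y - x (r n) y)\<^sup>2 \<partial>M\<Omega>) \<le> C * e) sequentially"
        unfolding eventually_sequentially by blast
    qed
    then have "L2_ip M\<Omega> (x m - u) (x m - u) \<le> C * e" by (simp add: L2_ip_def power2_eq_square)
    then show ?thesis using X Q(2) by (simp add: N_def distrib_right)
  qed
  have pos: "C + 1 > 0" using C by simp
  have close': "\<exists>N0. \<forall>m\<ge>N0. x m - u \<in> X \<and> N (x m - u) < e" if e: "e > 0" for e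
  proof -
    have e': "e / (2 * (C + 1)) > 0" using e pos by simp
    then obtain N0 where N0: "\<And>m n. m \<ge> N0 \<Longrightarrow> n \<ge> N0 \<Longrightarrow> ipZ (x m - x n) (x m - x n) < e / (2 * (C + 1))"
      using cauchy by meson
    have "(C + 1) * (e / (2 * (C + 1))) = e / 2" using pos by (simp add: divide_simps)
    then show ?thesis using close[OF N0] e by (intro exI[of _ N0]) force
  qed
  obtain N0 where "x N0 - u \<in> X" using close'[of 1] by auto
  from X_diff[OF Z_subset_X[OF x[of N0]] this] have uX: "u \<in> X" by simp
  have "u \<in> Z"
  proof (rule Z_closed[OF uX])
    fix \<epsilon> :: real assume "\<epsilon> > 0"
    then obtain N0 where N0: "N (x N0 - u) < \<epsilon>" using close'[of \<epsilon>] by auto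
    have "u - x N0 = (-1) *\<^sub>R (x N0 - u)" by simp
    then have "N (u - x N0) = N (x N0 - u)" using N_scale[of "-1" "x N0 - u"] by simp
    then show "\<exists>v\<in>Z. N (u - v) < \<epsilon>" using N0 x by (intro bexI[of _ "x N0"]) auto
  qed
  moreover have "(\<lambda>n. ipZ (x n - u) (x n - u)) \<longlonglongrightarrow> 0"
  proof (rule LIMSEQ_I)
    fix e :: real assume "e > 0"
    then obtain N0 where N0: "\<And>m. m \<ge> N0 \<Longrightarrow> N (x m - u) < e" using close'[of e] by blast
    have "ipZ v v \<le> N v" for v
      by (simp add: N_def L2_ip_def)
    then have "norm (ipZ (x n - u) (x n - u) - 0) < e" if "n \<ge> N0" for n
      using N0[OF that] ipZ_nonneg[of "x n - u"] by (smt (verit) real_norm_def)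
    then show "\<exists>N0. \<forall>n\<ge>N0. norm (ipZ (x n - u) (x n - u) - 0) < e" by blast
  qed
  ultimately show "\<exists>l\<in>Z. (\<lambda>n. ipZ (x n - l) (x n - l)) \<longlonglongrightarrow> 0" by blast
next
  fix u v w :: "real ^ 'n \<Rightarrow> real" and r :: real
  assume u: "u \<in> Z"
  show "ipZ (u + v) w = ipZ u w + ipZ v w" if "v \<in> Z" "w \<in> Z"
    using u that Z_subset_X by (intro ipZ_add_left) auto
  show "ipZ (r *\<^sub>R u) w = r * ipZ u w" if "w \<in> Z" by (rule ipZ_scale_left)
  show "ipZ u v = ipZ v u" if "v \<in> Z" by (rule ipZ_commute)
  show "0 \<le> ipZ u u" by (rule ipZ_nonneg)
qed

end

section \<open>Compactness of the embedding of \<open>Z\<close> into \<open>L\<^sup>2\<close>\<close>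

text \<open>Floors give half-open cubes, so that every point lies in exactly one of them when
  \<delta> is positive.\<close>

definition grid_cube :: "real \<Rightarrow> ('n::finite \<Rightarrow> int) \<Rightarrow> (real ^ 'n) set" where
  "grid_cube \<delta> z = {x. \<forall>i. \<lfloor>x $ i / \<delta>\<rfloor> = z i}"

lemma grid_cube_eq:
  assumes \<delta>: "\<delta> > 0"
  shows "x \<in> grid_cube \<delta> z \<longleftrightarrow> (\<forall>i. real_of_int (z i) * \<delta> \<le> x $ i \<and> x $ i < (real_of_int (z i) + 1) * \<delta>)"
  using \<delta> by (simp add: grid_cube_def floor_eq_iff field_simps)

lemma grid_cube_lmeasurable:
  fixes z :: "'n::finite \<Rightarrow> int"
  assumes \<delta>: "\<delta> > 0"
  shows "grid_cube \<delta> z \<in> lmeasurable" and "measure lebesgue (grid_cube \<delta> z) = \<delta> ^ CARD('n)"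
proof -
  define a b :: "real ^ 'n" where "a = (\<chi> i. real_of_int (z i) * \<delta>)" and "b = (\<chi> i. (real_of_int (z i) + 1) * \<delta>)"
  have sub: "box a b \<subseteq> grid_cube \<delta> z" "grid_cube \<delta> z \<subseteq> cbox a b"
    using \<delta> by (auto simp: grid_cube_eq mem_box_cart a_def b_def less_imp_le)
  have ab: "a $ i < b $ i" for i using \<delta> by (simp add: a_def b_def algebra_simps)
  have "grid_cube \<delta> z = (\<Inter>i\<in>UNIV. {x. \<lfloor>x $ i / \<delta>\<rfloor> = z i})" by (auto simp: grid_cube_def)
  also have "\<dots> \<in> sets borel"
  proof (intro sets.finite_INT)
    fix i :: 'n
    have "(\<lambda>x :: real ^ 'n. x $ i) \<in> borel_measurable borel"
      by (intro borel_measurable_continuous_onI continuous_intros)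
    then have "(\<lambda>x :: real ^ 'n. x $ i / \<delta>) \<in> borel_measurable borel" by simp
    from measurable_compose[OF this, of floor "count_space UNIV"]
    have m: "(\<lambda>x :: real ^ 'n. \<lfloor>x $ i / \<delta>\<rfloor>) \<in> measurable borel (count_space UNIV)" by simp
    show "{x :: real ^ 'n. \<lfloor>x $ i / \<delta>\<rfloor> = z i} \<in> sets borel"
      using measurable_sets[OF m, of "{z i}"] by (simp add: vimage_def)
  qed auto
  finally have sets: "grid_cube \<delta> z \<in> sets lebesgue" by simp
  have cb: "cbox a b \<in> lmeasurable" and bx: "box a b \<in> lmeasurable" by auto
  show lm: "grid_cube \<delta> z \<in> lmeasurable" by (rule fmeasurableI2[OF cb sub(2) sets])
  have "measure lebesgue (cbox a b) = (\<Prod>i\<in>UNIV. b $ i - a $ i)"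
  proof -
    have "cbox a b \<noteq> {}" using ab by (auto simp: interval_ne_empty_cart less_imp_le)
    then show ?thesis by (simp add: content_cbox_cart)
  qed
  also have "\<dots> = \<delta> ^ CARD('n)" by (simp add: a_def b_def algebra_simps)
  finally have m1: "measure lebesgue (cbox a b) = \<delta> ^ CARD('n)" .
  have m2: "measure lebesgue (box a b) = \<delta> ^ CARD('n)"
    using m1 by (simp add: measure_lborel_cbox_eq measure_lborel_box_eq)
  have "measure lebesgue (box a b) \<le> measure lebesgue (grid_cube \<delta> z)"
    using sub lm bx by (intro measure_mono_fmeasurable) auto
  moreover have "measure lebesgue (grid_cube \<delta> z) \<le> measure lebesgue (cbox a b)"
    using sub lm cb by (intro measure_mono_fmeasurable) auto
  ultimately show "measure lebesgue (grid_cube \<delta> z) = \<delta> ^ CARD('n)" using m1 m2 by simp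
qed

lemma grid_cube_diameter:
  fixes x y :: "real ^ 'n::finite"
  assumes \<delta>: "\<delta> > 0" and "x \<in> grid_cube \<delta> z" "y \<in> grid_cube \<delta> z"
  shows "norm (x - y) \<le> real CARD('n) * \<delta>"
proof -
  have "norm (x - y) \<le> (\<Sum>i\<in>UNIV. \<bar>(x - y) $ i\<bar>)" by (rule norm_le_l1_cart)
  also have "\<dots> \<le> (\<Sum>i\<in>(UNIV :: 'n set). \<delta>)"
  proof (rule sum_mono)
    fix i
    have "real_of_int (z i) * \<delta> \<le> x $ i \<and> x $ i < (real_of_int (z i) + 1) * \<delta>"
      "real_of_int (z i) * \<delta> \<le> y $ i \<and> y $ i < (real_of_int (z i) + 1) * \<delta>"
      using assms by (auto simp: grid_cube_eq)
    then show "\<bar>(x - y) $ i\<bar> \<le> \<delta>" by (auto simp: abs_le_iff algebra_simps)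
  qed
  finally show ?thesis by simp
qed

lemma finite_grid_cover:
  fixes S :: "(real ^ 'n::finite) set"
  assumes "bounded S" and \<delta>: "\<delta> > 0"
  shows "\<exists>I. finite I \<and> S \<subseteq> (\<Union>z\<in>I. grid_cube \<delta> z)"
proof -
  obtain r where r: "\<And>x. x \<in> S \<Longrightarrow> norm x \<le> r" using assms(1) unfolding bounded_iff by auto
  define k where "k = \<lceil>r / \<delta>\<rceil> + 1"
  define I :: "('n \<Rightarrow> int) set" where "I = PiE UNIV (\<lambda>_. {-k..k})"
  have "finite I" unfolding I_def by (intro finite_PiE) auto
  moreover have "S \<subseteq> (\<Union>z\<in>I. grid_cube \<delta> z)"
  proof
    fix x assume x: "x \<in> S"
    have "\<lfloor>x $ i / \<delta>\<rfloor> \<in> {-k..k}" for i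
    proof -
      have "\<bar>x $ i\<bar> \<le> r" using r[OF x] component_le_norm_cart[of x i] by linarith
      then have "\<bar>x $ i / \<delta>\<bar> \<le> r / \<delta>" using \<delta> divide_right_mono[of "\<bar>x $ i\<bar>" r \<delta>] by simp
      then have "\<bar>x $ i / \<delta>\<bar> \<le> of_int \<lceil>r / \<delta>\<rceil>" by linarith
      then have "- of_int \<lceil>r / \<delta>\<rceil> \<le> x $ i / \<delta>" "x $ i / \<delta> \<le> of_int \<lceil>r / \<delta>\<rceil>" by linarith+
      then show ?thesis unfolding k_def by (auto; linarith)
    qed
    then have "(\<lambda>i. \<lfloor>x $ i / \<delta>\<rfloor>) \<in> I" by (auto simp: I_def)
    then show "x \<in> (\<Union>z\<in>I. grid_cube \<delta> z)" by (auto simp: grid_cube_def)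
  qed
  ultimately show ?thesis by blast
qed

context fractional_setting
begin

lemma Z_sq_integrable:
  assumes u: "u \<in> Z"
  shows "integrable lebesgue (\<lambda>x. (u x)\<^sup>2)" and "(\<integral>x. (u x)\<^sup>2 \<partial>lebesgue) = L2_ip M\<Omega> u u"
proof -
  have um: "u \<in> borel_measurable lebesgue" by (rule X_measurable[OF Z_subset_X[OF u]])
  have int: "integrable lebesgue (\<lambda>x. indicator \<Omega> x *\<^sub>R (u x)\<^sup>2)"
    using L2_integrable_sq[OF Z_L2[OF u]] by (simp add: integrable_restrict_space)
  have ae: "AE x in lebesgue. indicator \<Omega> x *\<^sub>R (u x)\<^sup>2 = (u x)\<^sup>2"
    using Z_zero_outside[OF u] by eventually_elim (auto simp: indicator_def)
  have m1: "(\<lambda>x. indicator \<Omega> x *\<^sub>R (u x)\<^sup>2) \<in> borel_measurable lebesgue" using int by auto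
  have m2: "(\<lambda>x. (u x)\<^sup>2) \<in> borel_measurable lebesgue" using um by auto
  show "integrable lebesgue (\<lambda>x. (u x)\<^sup>2)"
    using int integrable_cong_AE[OF m1 m2 ae] by simp
  have "L2_ip M\<Omega> u u = (\<integral>x. indicator \<Omega> x *\<^sub>R (u x)\<^sup>2 \<partial>lebesgue)"
    by (simp add: L2_ip_def integral_restrict_space power2_eq_square)
  also have "\<dots> = (\<integral>x. (u x)\<^sup>2 \<partial>lebesgue)" by (rule integral_cong_AE[OF m1 m2 ae])
  finally show "(\<integral>x. (u x)\<^sup>2 \<partial>lebesgue) = L2_ip M\<Omega> u u" by simp
qed

text \<open>Grid cubes may stick out of \<Omega>. As \<open>u\<close> vanishes almost everywhere
  outside, the square integral over any measurable set is still controlled by the one over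
  \<Omega>.\<close>

lemma Z_L2_on:
  assumes u: "u \<in> Z" and A: "A \<in> sets lebesgue"
  shows "u \<in> L2 (lebesgue_on A)" and "(\<integral>x. (u x)\<^sup>2 \<partial>lebesgue_on A) \<le> L2_ip M\<Omega> u u"
proof -
  have um: "u \<in> borel_measurable (lebesgue_on A)" by (rule X_measurable_on[OF Z_subset_X[OF u]])
  have int: "integrable lebesgue (\<lambda>x. indicator A x *\<^sub>R (u x)\<^sup>2)"
    using integrable_mult_indicator[OF A Z_sq_integrable(1)[OF u]] by simp
  then show "u \<in> L2 (lebesgue_on A)" using um A by (simp add: L2_def integrable_restrict_space)
  have "(\<integral>x. (u x)\<^sup>2 \<partial>lebesgue_on A) = (\<integral>x. indicator A x *\<^sub>R (u x)\<^sup>2 \<partial>lebesgue)"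
    using A by (simp add: integral_restrict_space)
  also have "\<dots> \<le> (\<integral>x. (u x)\<^sup>2 \<partial>lebesgue)"
    using int Z_sq_integrable(1)[OF u] by (intro integral_mono) (auto simp: indicator_def)
  finally show "(\<integral>x. (u x)\<^sup>2 \<partial>lebesgue_on A) \<le> L2_ip M\<Omega> u u" using Z_sq_integrable(2)[OF u] by simp
qed

text \<open>The compactness estimate: on a cube \<open>q\<close> the variance of \<open>u\<close> is a double integral of
  \<open>(u x - u y)\<^sup>2\<close> over \<open>q \<times> q\<close>, and there the kernel is at least of order \<open>\<delta> powr - (n + 2 \<sigma>)\<close>,
  while \<open>q\<close> has measure \<open>\<delta> ^ n\<close>.\<close>

lemma grid_estimate:
  assumes \<epsilon>: "\<epsilon> > 0"
  shows "\<exists>(I :: ('n \<Rightarrow> int) set) c q. finite I \<and> c \<ge> 0 \<and> (\<forall>z\<in>I. q z \<in> lmeasurable) \<and>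
    (\<forall>u\<in>Z. L2_ip M\<Omega> u u \<le> \<epsilon> * ipZ u u + c * (\<Sum>z\<in>I. (\<integral>x. u x \<partial>lebesgue_on (q z))\<^sup>2))"
proof -
  define n where "n = real CARD('n)"
  define p where "p = n + 2 * \<sigma>"
  have n: "n > 0" by (simp add: n_def)
  have p: "p > 0" using n \<sigma>_pos by (simp add: p_def)
  \<comment> \<open>Solves \<open>1 / (2 * \<kappa> * m) = \<epsilon>\<close> for the side length:
    \<open>\<kappa> * m\<close> equals
    \<open>\<theta> * n powr (- p) * \<delta> powr (- 2 * \<sigma>)\<close>, which grows as the
    cubes shrink because \<open>\<sigma> > 0\<close>.\<close>
  define \<delta> where "\<delta> = (2 * \<theta> * \<epsilon> / n powr p) powr (1 / (2 * \<sigma>))"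
  have \<delta>: "\<delta> > 0" using \<theta>_pos \<epsilon> n by (simp add: \<delta>_def)
  have \<delta>_powr: "\<delta> powr (2 * \<sigma>) = 2 * \<theta> * \<epsilon> / n powr p"
    using \<sigma>_pos \<theta>_pos \<epsilon> n by (simp add: \<delta>_def powr_powr)
  define \<kappa> where "\<kappa> = \<theta> * (n * \<delta>) powr (- p)"
  have \<kappa>: "\<kappa> > 0" using \<theta>_pos n \<delta> by (simp add: \<kappa>_def)
  define m where "m = \<delta> ^ CARD('n)"
  have m: "m > 0" using \<delta> by (simp add: m_def)
  have m_powr: "m = \<delta> powr n" using \<delta> by (simp add: m_def n_def powr_realpow)
  have choice: "1 / (2 * \<kappa> * m) = \<epsilon>"
  proof -
    have "(n * \<delta>) powr p = n powr p * (\<delta> powr n * \<delta> powr (2 * \<sigma>))"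
      using n \<delta> by (simp add: powr_mult p_def powr_add)
    also have "\<dots> = \<delta> powr n * (2 * \<theta> * \<epsilon>)" using n by (simp add: \<delta>_powr)
    finally have eq: "(n * \<delta>) powr p = m * (2 * \<theta> * \<epsilon>)" by (simp add: m_powr)
    have "\<kappa> = \<theta> / (m * (2 * \<theta> * \<epsilon>))" by (simp add: \<kappa>_def powr_minus_divide eq)
    then have "\<kappa> = 1 / (m * (2 * \<epsilon>))" using \<theta>_pos by simp
    then show ?thesis using m \<epsilon> by simp
  qed
  let ?q = "grid_cube \<delta> :: ('n \<Rightarrow> int) \<Rightarrow> _"
  have qs: "?q z \<in> sets lebesgue" for z using grid_cube_lmeasurable(1)[OF \<delta>, of z] by auto
  obtain I where I: "finite I" and cover: "\<Omega> \<subseteq> (\<Union>z\<in>I. ?q z)"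
    using finite_grid_cover[OF \<Omega>_bounded \<delta>] by blast
  have main: "L2_ip M\<Omega> u u \<le> \<epsilon> * ipZ u u + (1 / m) * (\<Sum>z\<in>I. (\<integral>x. u x \<partial>lebesgue_on (?q z))\<^sup>2)" if u: "u \<in> Z" for u
  proof -
    define a b where "a z = (\<integral>x. u x \<partial>lebesgue_on (?q z))" and "b z = (\<integral>x. (u x)\<^sup>2 \<partial>lebesgue_on (?q z))" for z
    have dbl: "(\<integral>\<^sup>+x. \<integral>\<^sup>+y. ennreal ((u x - u y)\<^sup>2) \<partial>lebesgue_on (?q z) \<partial>lebesgue_on (?q z))
        = ennreal (2 * m * b z - 2 * (a z)\<^sup>2)" for z
      using finite_measure.double_integral_difference_sq[OF finite_measure_lebesgue_on[OF grid_cube_lmeasurable(1)[OF \<delta>]] Z_L2_on(1)[OF u qs], of z]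
      by (simp add: a_def b_def measure_restrict_space qs grid_cube_lmeasurable(2)[OF \<delta>] m_def)
    have nonneg: "0 \<le> 2 * m * b z - 2 * (a z)\<^sup>2" for z
      using finite_measure.integral_sq_le[OF finite_measure_lebesgue_on[OF grid_cube_lmeasurable(1)[OF \<delta>]] Z_L2_on(1)[OF u qs], of z]
      by (simp add: a_def b_def measure_restrict_space qs grid_cube_lmeasurable(2)[OF \<delta>] m_def)
    have "(\<Sum>z\<in>I. ennreal \<kappa> * (\<integral>\<^sup>+x. \<integral>\<^sup>+y. ennreal ((u x - u y)\<^sup>2) \<partial>lebesgue_on (?q z) \<partial>lebesgue_on (?q z))) \<le> ennreal (ipZ u u)"
    proof (rule rectangles_lower_bound[OF Z_subset_X[OF u] I])
      show "AE w in lebesgue. (\<Sum>z\<in>I. indicator (?q z) (fst w) * indicator (?q z) (snd w) *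
        (\<kappa> * (u (fst w) - u (snd w))\<^sup>2)) \<le> indicator Q w * D u u w"
        using AE_lebesgue_fst[OF Z_zero_outside[OF u]] AE_lebesgue_snd[OF Z_zero_outside[OF u]]
      proof eventually_elim
        case (elim w)
        \<comment> \<open>The only index whose cube contains \<open>fst w\<close>; the sum over
          cubes collapses to at most this term.\<close>
        define zf where "zf = (\<lambda>i. \<lfloor>fst w $ i / \<delta>\<rfloor>)"
        have ind: "indicator (?q z) (fst w) = (if z = zf then 1 else 0 :: real)" for z
          by (auto simp: grid_cube_def zf_def indicator_def)
        have fw: "fst w \<in> ?q zf" by (simp add: grid_cube_def zf_def)
        have "(\<Sum>z\<in>I. indicator (?q z) (fst w) * indicator (?q z) (snd w) * (\<kappa> * (u (fst w) - u (snd w))\<^sup>2))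
          = (\<Sum>z\<in>I. if z = zf then indicator (?q zf) (snd w) * (\<kappa> * (u (fst w) - u (snd w))\<^sup>2) else 0)"
          unfolding ind by (intro sum.cong) auto
        also have "\<dots> \<le> indicator (?q zf) (snd w) * (\<kappa> * (u (fst w) - u (snd w))\<^sup>2)"
          using I \<kappa> by simp
        also have "\<dots> \<le> indicator Q w * D u u w"
        proof (cases "snd w \<in> ?q zf \<and> fst w \<noteq> snd w \<and> w \<in> Q")
          case True
          have "norm (fst w - snd w) \<le> n * \<delta>"
            unfolding n_def using grid_cube_diameter[OF \<delta> fw] True by simp
          then have "\<kappa> \<le> K (fst w - snd w)"
            using kernel_lower_bound_explicit[of "fst w" "snd w" "n * \<delta>"] True by (simp add: \<kappa>_def p_def n_def)
          from mult_right_mono[OF this, of "(u (fst w) - u (snd w))\<^sup>2"]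
          show ?thesis using True by (simp add: D_def power2_eq_square mult.commute)
        next
          case False
          \<comment> \<open>Off \<open>Q\<close> both points lie outside \<Omega> and
            \<open>u\<close> is 0 at each of them; in the remaining cases another factor is
            0.\<close>
          have "indicator (?q zf) (snd w) * (\<kappa> * (u (fst w) - u (snd w))\<^sup>2) = 0"
          proof (cases "w \<in> Q")
            case True
            then show ?thesis using False by (auto simp: indicator_def)
          next
            case False
            then show ?thesis using elim by (simp add: mem_Q)
          qed
          moreover have "0 \<le> indicator Q w * D u u w" using D_nonneg[of u w] by simp
          ultimately show ?thesis by linarith
        qed
        finally show ?case .
      qed
    qed (use \<kappa> qs in auto)
    then have "(\<Sum>z\<in>I. ennreal (\<kappa> * (2 * m * b z - 2 * (a z)\<^sup>2))) \<le> ennreal (ipZ u u)"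
      unfolding dbl using \<kappa> by (simp add: ennreal_mult')
    then have "ennreal (\<Sum>z\<in>I. \<kappa> * (2 * m * b z - 2 * (a z)\<^sup>2)) \<le> ennreal (ipZ u u)"
      using \<kappa> nonneg by (subst (asm) sum_ennreal) auto
    then have "(\<Sum>z\<in>I. \<kappa> * (2 * m * b z - 2 * (a z)\<^sup>2)) \<le> ipZ u u"
      using ipZ_nonneg by (subst (asm) ennreal_le_iff) auto
    then have le: "2 * \<kappa> * m * (\<Sum>z\<in>I. b z) - 2 * \<kappa> * (\<Sum>z\<in>I. (a z)\<^sup>2) \<le> ipZ u u"
    proof -
      have "2 * \<kappa> * m * (\<Sum>z\<in>I. b z) - 2 * \<kappa> * (\<Sum>z\<in>I. (a z)\<^sup>2) = (\<Sum>z\<in>I. \<kappa> * (2 * m * b z - 2 * (a z)\<^sup>2))"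
        unfolding sum_distrib_left sum_subtractf[symmetric] by (intro sum.cong refl) (simp add: algebra_simps)
      with \<open>_ \<le> ipZ u u\<close> show ?thesis by simp
    qed
    have "(\<Sum>z\<in>I. b z) - (1 / m) * (\<Sum>z\<in>I. (a z)\<^sup>2)
        = 1 / (2 * \<kappa> * m) * (2 * \<kappa> * m * (\<Sum>z\<in>I. b z) - 2 * \<kappa> * (\<Sum>z\<in>I. (a z)\<^sup>2))"
      using \<kappa> m by (simp add: field_simps)
    also have "\<dots> \<le> \<epsilon> * ipZ u u" unfolding choice using le \<epsilon> by (intro mult_left_mono) auto
    finally have sum_b: "(\<Sum>z\<in>I. b z) \<le> \<epsilon> * ipZ u u + (1 / m) * (\<Sum>z\<in>I. (a z)\<^sup>2)" by simp
    have int: "integrable lebesgue (\<lambda>x. indicator A x *\<^sub>R (u x)\<^sup>2)" if "A \<in> sets lebesgue" for A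
      using integrable_mult_indicator[OF that Z_sq_integrable(1)[OF u]] by simp
    have "L2_ip M\<Omega> u u = (\<integral>x. indicator \<Omega> x *\<^sub>R (u x)\<^sup>2 \<partial>lebesgue)"
      by (simp add: L2_ip_def integral_restrict_space power2_eq_square)
    also have "\<dots> \<le> (\<integral>x. (\<Sum>z\<in>I. indicator (?q z) x *\<^sub>R (u x)\<^sup>2) \<partial>lebesgue)"
    proof (rule integral_mono)
      fix x :: "real ^ 'n"
      show "indicator \<Omega> x *\<^sub>R (u x)\<^sup>2 \<le> (\<Sum>z\<in>I. indicator (?q z) x *\<^sub>R (u x)\<^sup>2)"
      proof (cases "x \<in> \<Omega>")
        case True
        then obtain z where z: "z \<in> I" "x \<in> ?q z" using cover by auto
        have "(\<Sum>z\<in>{z}. indicator (?q z) x *\<^sub>R (u x)\<^sup>2) \<le> (\<Sum>z\<in>I. indicator (?q z) x *\<^sub>R (u x)\<^sup>2)"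
          using z I by (intro sum_mono2) auto
        then show ?thesis using True z by simp
      qed (simp add: sum_nonneg)
    qed (auto intro!: int qs Bochner_Integration.integrable_sum simp del: real_scaleR_def)
    also have "\<dots> = (\<Sum>z\<in>I. \<integral>x. indicator (?q z) x *\<^sub>R (u x)\<^sup>2 \<partial>lebesgue)"
      by (rule Bochner_Integration.integral_sum) (rule int[OF qs])
    also have "\<dots> = (\<Sum>z\<in>I. b z)"
      by (simp add: b_def integral_restrict_space qs)
    finally show ?thesis using sum_b by (simp add: a_def)
  qed
  show ?thesis
    by (intro exI[of _ I] exI[of _ "1 / m"] exI[of _ ?q] conjI ballI I main)
      (use m grid_cube_lmeasurable(1)[OF \<delta>] in auto)
qed

text \<open>An instance of \<open>cauchy_subseq\<close>: \<open>D\<close> is the squared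
  \<open>L2\<close> distance, and the scalar sequences are the integrals over the grid
  cubes.\<close>

lemma Z_compact_embedding:
  assumes v: "\<And>n. v n \<in> Z" and M: "\<And>n. ipZ (v n) (v n) \<le> M"
  shows "\<exists>r l. strict_mono (r :: nat \<Rightarrow> nat) \<and> l \<in> L2 M\<Omega> \<and>
    (\<lambda>n. L2_ip M\<Omega> (v (r n) - l) (v (r n) - l)) \<longlonglongrightarrow> 0"
proof -
  interpret H: semi_hilbert "L2 M\<Omega>" "L2_ip M\<Omega>" by (rule finite_measure.semi_hilbert_L2[OF finite_M\<Omega>])
  interpret HZ: semi_hilbert Z ipZ by (rule semi_hilbert_Z)
  have M0: "M \<ge> 0" using ipZ_nonneg[of "v 0"] M[of 0] by linarith
  have diff: "ipZ (v i - v j) (v i - v j) \<le> 4 * M" for i j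
  proof -
    have "HZ.nrm (v i - v j) \<le> HZ.nrm (v i) + HZ.nrm (v j)" by (intro HZ.nrm_diff_le v)
    also have "\<dots> \<le> sqrt M + sqrt M" unfolding HZ.nrm_def by (intro add_mono real_sqrt_le_mono M)
    finally have "(HZ.nrm (v i - v j))\<^sup>2 \<le> (2 * sqrt M)\<^sup>2"
      using v by (intro power_mono) auto
    then show ?thesis using M0 v by (simp add: HZ.nrm_squared power_mult_distrib)
  qed
  obtain C where C: "C > 0" and poinc: "\<And>u. u \<in> Z \<Longrightarrow> L2_ip M\<Omega> u u \<le> C * ipZ u u"
    using poincare by blast
  have "\<exists>r :: nat \<Rightarrow> nat. strict_mono r \<and>
      (\<forall>e>0. \<exists>N. \<forall>m\<ge>N. \<forall>n\<ge>N. L2_ip M\<Omega> (v (r m) - v (r n)) (v (r m) - v (r n)) < e)"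
  proof (rule cauchy_subseq)
    fix \<epsilon> :: real assume \<epsilon>: "\<epsilon> > 0"
    \<comment> \<open>Differences of members of the sequence have energy at most
      \<open>4 * M\<close>; the \<open>+ 1\<close> covers \<open>M = 0\<close>.\<close>
    have e: "\<epsilon> / (4 * M + 1) > 0" using \<epsilon> M0 by (intro divide_pos_pos) auto
    obtain I :: "('n \<Rightarrow> int) set" and c q where I: "finite I" and c: "c \<ge> 0" and q: "\<And>z. z \<in> I \<Longrightarrow> q z \<in> lmeasurable"
      and est: "\<And>u. u \<in> Z \<Longrightarrow> L2_ip M\<Omega> u u \<le> \<epsilon> / (4 * M + 1) * ipZ u u + c * (\<Sum>z\<in>I. (\<integral>x. u x \<partial>lebesgue_on (q z))\<^sup>2)"
      using grid_estimate[OF e] by blast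
    define L where "L z i = (\<integral>x. v i x \<partial>lebesgue_on (q z))" for z i
    have int: "integrable (lebesgue_on (q z)) (v i)" if "z \<in> I" for z i
      using q[OF that] Z_L2_on(1)[OF v] by (intro finite_measure.L2_integrable finite_measure_lebesgue_on) auto
    have "bounded (range (L z))" if z: "z \<in> I" for z
    proof -
      have "\<bar>L z i\<bar> \<le> measure lebesgue (q z) + C * M" for i
      proof -
        have "\<bar>L z i\<bar> \<le> (\<integral>x. \<bar>v i x\<bar> \<partial>lebesgue_on (q z))"
          unfolding L_def by (rule integral_abs_bound)
        also have "\<dots> \<le> 1 * measure (lebesgue_on (q z)) (space (lebesgue_on (q z))) + (\<integral>x. (v i x)\<^sup>2 \<partial>lebesgue_on (q z)) / 1"
          using q[OF z] Z_L2_on(1)[OF v] by (intro finite_measure.L1_le_L2 finite_measure_lebesgue_on) auto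
        also have "\<dots> \<le> measure lebesgue (q z) + C * M"
        proof -
          have "(\<integral>x. (v i x)\<^sup>2 \<partial>lebesgue_on (q z)) \<le> L2_ip M\<Omega> (v i) (v i)"
            using q[OF z] by (intro Z_L2_on(2) v) auto
          also have "\<dots> \<le> C * ipZ (v i) (v i)" by (rule poinc[OF v])
          also have "\<dots> \<le> C * M" using C M by simp
          finally show ?thesis using q[OF z] by (simp add: measure_restrict_space fmeasurableD)
        qed
        finally show ?thesis .
      qed
      then show ?thesis unfolding bounded_iff by auto
    qed
    moreover have "L2_ip M\<Omega> (v i - v j) (v i - v j) \<le> \<epsilon> + c * (\<Sum>z\<in>I. (L z i - L z j)\<^sup>2)" for i j
    proof -
      have "(\<integral>x. (v i - v j) x \<partial>lebesgue_on (q z)) = L z i - L z j" if "z \<in> I" for z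
        using int[OF that] by (simp add: L_def)
      then have "(\<Sum>z\<in>I. (\<integral>x. (v i - v j) x \<partial>lebesgue_on (q z))\<^sup>2) = (\<Sum>z\<in>I. (L z i - L z j)\<^sup>2)"
        by (intro sum.cong refl) simp
      then have "L2_ip M\<Omega> (v i - v j) (v i - v j)
          \<le> \<epsilon> / (4 * M + 1) * ipZ (v i - v j) (v i - v j) + c * (\<Sum>z\<in>I. (L z i - L z j)\<^sup>2)"
        using est[OF Z_diff[OF v v], of i j] by simp
      moreover have "\<epsilon> / (4 * M + 1) * ipZ (v i - v j) (v i - v j) \<le> \<epsilon> / (4 * M + 1) * (4 * M + 1)"
        using diff[of i j] e by (intro mult_left_mono) auto
      moreover have "\<epsilon> / (4 * M + 1) * (4 * M + 1) = \<epsilon>" using M0 by simp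
      ultimately show ?thesis by linarith
    qed
    ultimately show "\<exists>(I :: ('n \<Rightarrow> int) set) c L. finite I \<and> (\<forall>z\<in>I. bounded (range (L z :: nat \<Rightarrow> real))) \<and> c \<ge> 0 \<and>
        (\<forall>i j. L2_ip M\<Omega> (v i - v j) (v i - v j) \<le> \<epsilon> + c * (\<Sum>z\<in>I. (L z i - L z j)\<^sup>2))"
      using I c by blast
  qed
  then obtain r :: "nat \<Rightarrow> nat" where r: "strict_mono r"
    and cauchy: "\<And>e. e > 0 \<Longrightarrow> \<exists>N. \<forall>m\<ge>N. \<forall>n\<ge>N. L2_ip M\<Omega> (v (r m) - v (r n)) (v (r m) - v (r n)) < e"
    by blast
  then obtain l where "l \<in> L2 M\<Omega>" "(\<lambda>n. L2_ip M\<Omega> (v (r n) - l) (v (r n) - l)) \<longlonglongrightarrow> 0"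
    using H.ip_complete[of "\<lambda>n. v (r n)"] Z_L2[OF v] by blast
  then show ?thesis using r by blast
qed

end

section \<open>The nonlinearity\<close>

text \<open>Extracts plain comparisons between constants such as \<open>lam h\<close> and
  \<open>lam k\<close> from statements that hold almost everywhere.\<close>

lemma AE_lebesgue_on_ex:
  assumes S: "S \<in> sets lebesgue" and pos: "measure lebesgue S > 0" and ae: "AE x in lebesgue_on S. P x"
  shows "\<exists>x\<in>S. P x"
proof (rule ccontr)
  assume no: "\<not> ?thesis"
  have "AE x in lebesgue_on S. P x \<and> x \<in> S" using ae AE_space[of "lebesgue_on S"] by auto
  then have "AE x in lebesgue_on S. False" by (rule eventually_mono) (use no in auto)
  then obtain N where "space (lebesgue_on S) \<subseteq> N" "emeasure (lebesgue_on S) N = 0" "N \<in> sets (lebesgue_on S)"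
    by (elim AE_E) auto
  then have "emeasure (lebesgue_on S) (space (lebesgue_on S)) = 0"
    using emeasure_mono[of "space (lebesgue_on S)" N "lebesgue_on S"] by simp
  then have "emeasure lebesgue S = 0" using S by (simp add: emeasure_restrict_space)
  then show False using pos by (simp add: measure_def)
qed

text \<open>Along a simple function only finitely many slices of \<open>f\<close> occur, and
  continuity in the second argument carries measurability to the limit. Extension by 0 moves the
  argument to \<open>lebesgue\<close>, whose completeness absorbs the null set where continuity
  fails.\<close>

lemma caratheodory_measurable:
  fixes S :: "'a::euclidean_space set"
  assumes car: "caratheodory S f" and S: "S \<in> sets lebesgue"
    and u: "u \<in> borel_measurable (lebesgue_on S)"
  shows "(\<lambda>x. f x (u x)) \<in> borel_measurable (lebesgue_on S)"
proof -
  obtain F where F: "\<And>i. simple_function (lebesgue_on S) (F i)"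
    and lim: "\<And>x. x \<in> space (lebesgue_on S) \<Longrightarrow> (\<lambda>i. F i x) \<longlonglongrightarrow> u x"
    using borel_measurable_implies_sequence_metric[OF u, of 0] by metis
  have fF: "(\<lambda>x. f x (F i x)) \<in> borel_measurable (lebesgue_on S)" for i
  proof (rule measurable_compose_countable'[of "F i ` space (lebesgue_on S)" "\<lambda>t x. f x t"])
    show "(\<lambda>x. f x t) \<in> borel_measurable (lebesgue_on S)" for t
      using car by (simp add: caratheodory_def)
    show "F i \<in> measurable (lebesgue_on S) (count_space (F i ` space (lebesgue_on S)))"
      using F[of i] by (auto simp: measurable_count_space_eq2 simple_function_def)
    show "countable (F i ` space (lebesgue_on S))"
      using F[of i] by (simp add: simple_function_def uncountable_infinite countable_finite)
  qed
  define g where "g i x = (if x \<in> S then f x (F i x) else 0)" for i x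
  have g: "g i \<in> borel_measurable lebesgue" for i
    unfolding g_def[abs_def] using fF S by (subst borel_measurable_if) auto
  have "AE x in lebesgue. x \<in> S \<longrightarrow> continuous_on UNIV (f x)"
    using car S by (simp add: caratheodory_def AE_restrict_space_iff)
  then have "AE x in lebesgue. lim (\<lambda>i. g i x) = (if x \<in> S then f x (u x) else 0)"
  proof eventually_elim
    case (elim x)
    have "(\<lambda>i. g i x) \<longlonglongrightarrow> (if x \<in> S then f x (u x) else 0)"
    proof (cases "x \<in> S")
      case True
      then have cont: "isCont (f x) (u x)" using elim by (simp add: continuous_on_eq_continuous_at)
      have "(\<lambda>i. f x (F i x)) \<longlonglongrightarrow> f x (u x)"
        by (rule isCont_tendsto_compose[OF cont]) (use lim[of x] True in simp)
      then show ?thesis using True by (simp add: g_def)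
    qed (simp add: g_def)
    then show ?case by (rule limI)
  qed
  moreover have "(\<lambda>x. lim (\<lambda>i. g i x)) \<in> borel_measurable lebesgue"
    using g by (intro borel_measurable_lim_metric) auto
  ultimately have "(\<lambda>x. if x \<in> S then f x (u x) else 0) \<in> borel_measurable lebesgue"
    by (rule borel_measurable_AE[rotated])
  then show ?thesis using S by (subst (asm) borel_measurable_if) auto
qed

text \<open>\<open>f x t / t\<close> is the slope between \<open>t\<close> and 0 plus
  \<open>f x 0 / t\<close>, which vanishes at infinity. Strictness is lost in the limit and has to
  come from the asymptotic hypothesis.\<close>

lemma slope_bounds_alpha:
  assumes slope: "\<And>s t. s \<noteq> t \<Longrightarrow> p < (f x s - f x t) / (s - t) \<and> (f x s - f x t) / (s - t) < q"
  shows "ereal p \<le> alpha_lower f x" and "alpha_lower f x \<le> alpha_upper f x" and "alpha_upper f x \<le> ereal q"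
proof -
  have lim: "((\<lambda>t. ereal (c + f x 0 / t)) \<longlongrightarrow> ereal c) at_infinity" for c
  proof -
    have "((\<lambda>t. c + f x 0 * inverse t) \<longlongrightarrow> c + f x 0 * 0) at_infinity"
      by (intro tendsto_intros tendsto_inverse_0)
    then show ?thesis by (simp add: divide_inverse)
  qed
  have nz: "eventually (\<lambda>t :: real. t \<noteq> 0) at_infinity"
    unfolding eventually_at_infinity by (intro exI[of _ 1]) auto
  have bounds: "eventually (\<lambda>t. p + f x 0 / t \<le> f x t / t \<and> f x t / t \<le> q + f x 0 / t) at_infinity"
    using nz
  proof eventually_elim
    case (elim t)
    have "(f x t - f x 0) / (t - 0) = f x t / t - f x 0 / t" by (simp add: diff_divide_distrib)
    then show ?case using slope[of t 0] elim by linarith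
  qed
  have "ereal p = Liminf at_infinity (\<lambda>t. ereal (p + f x 0 / t))"
    using lim by (intro lim_imp_Liminf[symmetric] trivial_limit_at_infinity)
  also have "\<dots> \<le> alpha_lower f x"
    unfolding alpha_lower_def using bounds by (intro Liminf_mono) (auto elim: eventually_mono)
  finally show "ereal p \<le> alpha_lower f x" .
  show "alpha_lower f x \<le> alpha_upper f x"
    unfolding alpha_lower_def alpha_upper_def by (intro Liminf_le_Limsup trivial_limit_at_infinity)
  have "alpha_upper f x \<le> Limsup at_infinity (\<lambda>t. ereal (q + f x 0 / t))"
    unfolding alpha_upper_def using bounds by (intro Limsup_mono) (auto elim: eventually_mono)
  also have "\<dots> = ereal q"
    using lim by (intro lim_imp_Limsup trivial_limit_at_infinity)
  finally show "alpha_upper f x \<le> ereal q" .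
qed

text \<open>Intermediate reals \<open>q1\<close> and \<open>q2\<close> turn the strict inequalities
  into a margin: for large arguments \<open>f x t / t\<close> stays between them. Both
  \<open>d'\<close> and \<open>R\<close> depend on \<open>x\<close>.\<close>

lemma asymptotic_slope_bound:
  assumes "ereal p < alpha_lower f x" "alpha_lower f x \<le> alpha_upper f x" "alpha_upper f x < ereal q"
  shows "\<exists>d' R. 0 \<le> d' \<and> d' < (q - p) / 2 \<and>
    (\<forall>t. \<bar>t\<bar> \<ge> R \<longrightarrow> \<bar>f x t - (p + q) / 2 * t\<bar> \<le> d' * \<bar>t\<bar>)"
proof -
  obtain q1 where q1: "ereal p < ereal q1" "ereal q1 < alpha_lower f x"
    using ereal_dense2[OF assms(1)] by blast
  obtain q2 where q2: "alpha_upper f x < ereal q2" "ereal q2 < ereal q"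
    using ereal_dense2[OF assms(3)] by blast
  have "ereal q1 < ereal q2" using q1(2) assms(2) q2(1) by order
  then have order: "p < q1" "q1 < q2" "q2 < q" using q1(1) q2(2) by auto
  have "eventually (\<lambda>t. ereal q1 < ereal (f x t / t)) at_infinity"
    using q1(2) unfolding alpha_lower_def by (rule less_LiminfD)
  moreover have "eventually (\<lambda>t. ereal (f x t / t) < ereal q2) at_infinity"
    using q2(1) unfolding alpha_upper_def by (rule Limsup_lessD)
  ultimately have "eventually (\<lambda>t. q1 < f x t / t \<and> f x t / t < q2) at_infinity"
    by eventually_elim simp
  then obtain R where R: "\<And>t. norm t \<ge> R \<Longrightarrow> q1 < f x t / t \<and> f x t / t < q2"
    unfolding eventually_at_infinity by blast
  define d' where "d' = max \<bar>q1 - (p + q) / 2\<bar> \<bar>q2 - (p + q) / 2\<bar>"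
  have "d' < (q - p) / 2" using order unfolding d'_def max_less_iff_conj abs_less_iff by (intro conjI) (simp_all add: field_simps)
  moreover have "\<bar>f x t - (p + q) / 2 * t\<bar> \<le> d' * \<bar>t\<bar>" if "\<bar>t\<bar> \<ge> max R 1" for t
  proof -
    have t: "t \<noteq> 0" "q1 < f x t / t" "f x t / t < q2" using R[of t] that by auto
    have "\<bar>f x t / t - (p + q) / 2\<bar> \<le> d'" using t unfolding d'_def by linarith
    then have "\<bar>f x t / t - (p + q) / 2\<bar> * \<bar>t\<bar> \<le> d' * \<bar>t\<bar>" by (rule mult_right_mono) simp
    moreover have "(f x t / t - (p + q) / 2) * t = f x t - (p + q) / 2 * t" using t by (simp add: left_diff_distrib)
    ultimately show ?thesis by (simp flip: abs_mult)
  qed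
  moreover have "0 \<le> d'" by (simp add: d'_def)
  ultimately show ?thesis by blast
qed

text \<open>A value missing from the list would have multiplicity 0, and an eigenspace with an empty
  basis contains only null functions.\<close>

lemma eigenvalue_sequence_surj:
  assumes seq: "eigenvalue_sequence \<Omega> K lam" and ev: "is_eigenvalue \<Omega> K \<mu>"
  shows "\<exists>j\<ge>1. lam j = \<mu>"
proof (rule ccontr)
  assume "\<not> ?thesis"
  then have "{j. 1 \<le> j \<and> lam j = \<mu>} = {}" by auto
  then have "has_ae_dim (eigenspace \<Omega> K \<mu>) 0"
    using seq ev unfolding eigenvalue_sequence_def by (metis card.empty)
  then have "\<forall>v\<in>eigenspace \<Omega> K \<mu>. AE x in lebesgue. v x = 0" by (simp add: has_ae_dim_def)
  then show False using ev unfolding is_eigenvalue_def by blast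
qed

lemma eigenvalue_sequence_gap:
  assumes seq: "eigenvalue_sequence \<Omega> K lam" and ev: "is_eigenvalue \<Omega> K \<mu>"
    and k: "k \<ge> 1"
  shows "\<not> (lam k < \<mu> \<and> \<mu> < lam (k + 1))"
proof
  assume mu: "lam k < \<mu> \<and> \<mu> < lam (k + 1)"
  obtain j where j: "j \<ge> 1" "lam j = \<mu>" using eigenvalue_sequence_surj[OF seq ev] by blast
  have mono: "lam i \<le> lam j" if "1 \<le> i" "i \<le> j" for i j
    using seq that by (simp add: eigenvalue_sequence_def)
  show False
  proof (cases "j \<le> k")
    case True
    then show ?thesis using mono[of j k] j mu by simp
  next
    case False
    then show ?thesis using mono[of "k + 1" j] j mu by simp
  qed
qed

section \<open>No resonance at infinity\<close>

context finite_measure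
begin

lemma L1_null_if_L2_null:
  assumes x: "\<And>n. x n \<in> L2 M" and lim: "(\<lambda>n. \<integral>y. (x n y)\<^sup>2 \<partial>M) \<longlonglongrightarrow> 0"
  shows "(\<lambda>n. \<integral>y. norm (x n y) \<partial>M) \<longlonglongrightarrow> 0"
proof (rule Lim_null_comparison)
  let ?s = "\<lambda>n. sqrt (measure M (space M) * (\<integral>y. (x n y)\<^sup>2 \<partial>M))"
  have "norm (\<integral>y. norm (x n y) \<partial>M) \<le> ?s n" for n
    using integral_sq_le[OF L2_abs[OF x[of n]]] by (intro real_le_rsqrt) simp
  then show "eventually (\<lambda>n. norm (\<integral>y. norm (x n y) \<partial>M) \<le> ?s n) sequentially" by simp
  have "?s \<longlonglongrightarrow> sqrt (measure M (space M) * 0)" by (intro tendsto_intros lim)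
  then show "?s \<longlonglongrightarrow> 0" by simp
qed

text \<open>If \<open>\<parallel>G (u n)\<parallel> \<ge> d \<parallel>u n\<parallel>\<close>, the defect \<open>(\<bar>g\<^sub>0\<bar> + d \<bar>u n\<bar>)\<^sup>2 - (G (u n))\<^sup>2 \<ge> 0\<close>, scaled by
  \<open>\<parallel>u n\<parallel>\<^sup>-\<^sup>2\<close>, tends to \<open>0\<close> in \<open>L\<^sup>1\<close>; where the normalized limit is nonzero, however, \<open>\<bar>u n\<bar>\<close> blows up
  and the asymptotic slope \<open>d' < d\<close> keeps the defect away from \<open>0\<close>.\<close>

lemma nonresonance:
  fixes g :: "'a \<Rightarrow> real \<Rightarrow> real"
  assumes u: "\<And>n. u n \<in> L2 M" and v: "v \<in> L2 M" and d: "d > 0"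
    and g_in: "\<And>w. w \<in> L2 M \<Longrightarrow> (\<lambda>x. g x (w x)) \<in> L2 M"
    and lip: "AE x in M. \<forall>s t. \<bar>g x s - g x t\<bar> \<le> d * \<bar>s - t\<bar>"
    and asym: "AE x in M. \<exists>d' R. 0 \<le> d' \<and> d' < d \<and> (\<forall>t. \<bar>t\<bar> \<ge> R \<longrightarrow> \<bar>g x t\<bar> \<le> d' * \<bar>t\<bar>)"
    and top: "filterlim (\<lambda>n. sqrt (L2_ip M (u n) (u n))) at_top sequentially"
    and lim: "(\<lambda>n. \<integral>x. (u n x / sqrt (L2_ip M (u n) (u n)) - v x)\<^sup>2 \<partial>M) \<longlonglongrightarrow> 0"
    and big: "\<And>n. d * sqrt (L2_ip M (u n) (u n)) \<le> sqrt (L2_ip M (\<lambda>x. g x (u n x)) (\<lambda>x. g x (u n x)))"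
  shows False
proof -
  interpret H: semi_hilbert "L2 M" "L2_ip M" by (rule semi_hilbert_L2)
  define \<rho> where "\<rho> n = H.nrm (u n)" for n
  have \<rho>: "\<rho> n \<ge> 0" for n using u by (simp add: \<rho>_def)
  have \<rho>_top: "filterlim \<rho> at_top sequentially" using top by (simp add: \<rho>_def[abs_def] H.nrm_def)
  define G where "G n = (\<lambda>x. g x (u n x))" for n
  have G: "G n \<in> L2 M" for n unfolding G_def by (rule g_in[OF u])
  define g0 where "g0 = (\<lambda>x. \<bar>g x 0\<bar>)"
  have g0: "g0 \<in> L2 M" unfolding g0_def using g_in[OF const_in_L2[of 0]] by (rule L2_abs)
  \<comment> \<open>Division by 0 yields 0 when \<open>\<rho> n = 0\<close>, which happens for only
    finitely many \<open>n\<close>.\<close>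
  define y where "y n = (1 / \<rho> n) *\<^sub>R u n" for n
  have y: "y n \<in> L2 M" for n unfolding y_def using u by auto
  define ay where "ay n = (\<lambda>x. \<bar>y n x\<bar>)" for n
  have ay: "ay n \<in> L2 M" for n unfolding ay_def by (rule L2_abs[OF y])
  have nrm_ay: "H.nrm (ay n) = H.nrm (y n)" for n
    by (simp add: H.nrm_def L2_ip_def ay_def abs_mult_self)
  \<comment> \<open>The normalised majorant of \<open>\<bar>G n\<bar>\<close> supplied by the
    Lipschitz bound.\<close>
  define z where "z n = (1 / \<rho> n) *\<^sub>R g0 + d *\<^sub>R ay n" for n
  have z: "z n \<in> L2 M" for n unfolding z_def using g0 ay by auto
  define F where "F n x = (z n x)\<^sup>2 - (((1 / \<rho> n) *\<^sub>R G n) x)\<^sup>2" for n x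
  have F_int: "integrable M (F n)" for n
    unfolding F_def[abs_def] by (intro Bochner_Integration.integrable_diff L2_integrable_sq z H.scale_in G)
  have F_nonneg: "AE x in M. \<forall>n. 0 \<le> F n x"
    using lip
  proof eventually_elim
    case (elim x)
    show ?case
    proof
      fix n
      have "\<bar>g x (u n x)\<bar> \<le> g0 x + d * \<bar>u n x\<bar>"
        using elim[rule_format, of "u n x" 0] by (simp add: g0_def)
      then have "(1 / \<rho> n) * \<bar>g x (u n x)\<bar> \<le> (1 / \<rho> n) * (g0 x + d * \<bar>u n x\<bar>)"
        using \<rho>[of n] by (intro mult_left_mono) auto
      also have "\<dots> = z n x" using \<rho>[of n] by (simp add: z_def ay_def y_def abs_mult distrib_left)
      finally have "\<bar>((1 / \<rho> n) *\<^sub>R G n) x\<bar> \<le> z n x" using \<rho>[of n] by (simp add: G_def abs_mult)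
      then show "0 \<le> F n x" unfolding F_def using power_mono[of "\<bar>((1 / \<rho> n) *\<^sub>R G n) x\<bar>" "z n x" 2]
        by (simp only: power2_abs diff_ge_0_iff_ge abs_ge_zero)
    qed
  qed
  \<comment> \<open>As \<open>y n\<close> has norm 1, \<open>z n\<close> has norm at most
    \<open>H.nrm g0 / \<rho> n + d\<close>, while \<open>big\<close> keeps the norm of
    \<open>G n / \<rho> n\<close> at least \<open>d\<close>; the two bounds meet as
    \<open>\<rho> n\<close> grows.\<close>
  have F_le: "(\<integral>x. norm (F n x) \<partial>M) \<le> ((1 / \<rho> n) * H.nrm g0 + d)\<^sup>2 - d\<^sup>2" if pos: "\<rho> n > 0" for n
  proof -
    have "(\<integral>x. norm (F n x) \<partial>M) = (\<integral>x. F n x \<partial>M)"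
      using F_nonneg F_int by (intro integral_cong_AE) (auto elim!: eventually_mono)
    also have "\<dots> = (\<integral>x. (z n x)\<^sup>2 \<partial>M) - (\<integral>x. (((1 / \<rho> n) *\<^sub>R G n) x)\<^sup>2 \<partial>M)"
      unfolding F_def by (intro Bochner_Integration.integral_diff L2_integrable_sq z H.scale_in G)
    also have "\<dots> = (H.nrm (z n))\<^sup>2 - (H.nrm ((1 / \<rho> n) *\<^sub>R G n))\<^sup>2"
      using z G by (simp only: H.nrm_squared H.scale_in) (simp add: L2_ip_def power2_eq_square)
    also have "\<dots> \<le> ((1 / \<rho> n) * H.nrm g0 + d)\<^sup>2 - d\<^sup>2"
    proof (rule diff_mono)
      have "H.nrm (y n) = 1" using pos u by (simp add: y_def H.nrm_scale \<rho>_def[symmetric])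
      then have "H.nrm (z n) \<le> (1 / \<rho> n) * H.nrm g0 + d"
        using H.nrm_triangle[of "(1 / \<rho> n) *\<^sub>R g0" "d *\<^sub>R ay n"] g0 ay d \<rho>[of n]
        by (simp add: z_def H.nrm_scale nrm_ay)
      then show "(H.nrm (z n))\<^sup>2 \<le> ((1 / \<rho> n) * H.nrm g0 + d)\<^sup>2" using z by (intro power_mono) auto
      have "d * \<rho> n \<le> H.nrm (G n)" using big[of n] by (simp add: \<rho>_def H.nrm_def G_def)
      then have "d \<le> H.nrm ((1 / \<rho> n) *\<^sub>R G n)" using pos G by (simp add: H.nrm_scale field_simps)
      then show "d\<^sup>2 \<le> (H.nrm ((1 / \<rho> n) *\<^sub>R G n))\<^sup>2" using d by (intro power_mono) auto
    qed
    finally show ?thesis .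
  qed
  have ev_pos: "eventually (\<lambda>n. \<rho> n > 0) sequentially"
    using \<rho>_top by (simp add: filterlim_at_top_dense)
  have F_lim: "(\<lambda>n. \<integral>x. norm (F n x) \<partial>M) \<longlonglongrightarrow> 0"
  proof (rule Lim_null_comparison)
    show "eventually (\<lambda>n. norm (\<integral>x. norm (F n x) \<partial>M) \<le> ((1 / \<rho> n) * H.nrm g0 + d)\<^sup>2 - d\<^sup>2) sequentially"
      using ev_pos by eventually_elim (use F_le in auto)
    have "(\<lambda>n. 1 / \<rho> n) \<longlonglongrightarrow> 0"
      using tendsto_inverse_0_at_top[OF \<rho>_top] by (simp add: inverse_eq_divide)
    then have "(\<lambda>n. ((1 / \<rho> n) * H.nrm g0 + d)\<^sup>2 - d\<^sup>2) \<longlonglongrightarrow> (0 * H.nrm g0 + d)\<^sup>2 - d\<^sup>2"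
      by (intro tendsto_intros)
    then show "(\<lambda>n. ((1 / \<rho> n) * H.nrm g0 + d)\<^sup>2 - d\<^sup>2) \<longlonglongrightarrow> 0" by simp
  qed
  obtain r :: "nat \<Rightarrow> nat" where r: "strict_mono r" and F_ae: "AE x in M. (\<lambda>n. F (r n) x) \<longlonglongrightarrow> 0"
    using tendsto_L1_AE_subseq[OF F_int F_lim] by blast
  have yv: "(\<lambda>n. \<integral>x. ((y n - v) x)\<^sup>2 \<partial>M) \<longlonglongrightarrow> 0"
    using lim by (simp add: y_def \<rho>_def H.nrm_def)
  have "(\<lambda>n. \<integral>x. norm ((y (r n) - v) x) \<partial>M) \<longlonglongrightarrow> 0"
    by (rule L1_null_if_L2_null[of "\<lambda>n. y (r n) - v", OF H.diff_in[OF y v]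
          LIMSEQ_subseq_LIMSEQ[OF yv r, unfolded o_def]])
  then obtain r' :: "nat \<Rightarrow> nat" where r': "strict_mono r'"
    and y_ae: "AE x in M. (\<lambda>n. (y (r (r' n)) - v) x) \<longlonglongrightarrow> 0"
    using tendsto_L1_AE_subseq[of M "\<lambda>n. y (r n) - v"] L2_integrable[OF H.diff_in[OF y v]] by blast
  define s where "s n = r (r' n)" for n
  have s: "strict_mono s" using strict_mono_o[OF r r'] by (simp add: s_def[abs_def] o_def)
  have \<rho>s: "filterlim (\<lambda>n. \<rho> (s n)) at_top sequentially"
    using filterlim_compose[OF \<rho>_top filterlim_subseq[OF s]] by simp
  have "AE x in M. v x = 0"
    using F_ae y_ae asym F_nonneg
  proof eventually_elim
    case (elim x)
    then obtain d' R where d': "0 \<le> d'" "d' < d" and R: "\<And>t. \<bar>t\<bar> \<ge> R \<Longrightarrow> \<bar>g x t\<bar> \<le> d' * \<bar>t\<bar>" by blast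
    have yx: "(\<lambda>n. y (s n) x) \<longlonglongrightarrow> v x" using elim(2) by (simp add: s_def LIM_zero_iff)
    have Fx: "(\<lambda>n. F (s n) x) \<longlonglongrightarrow> 0"
      using LIMSEQ_subseq_LIMSEQ[OF elim(1) r'] by (simp add: s_def o_def)
    show "v x = 0"
    proof (rule ccontr)
      assume vx: "v x \<noteq> 0"
      \<comment> \<open>This product is \<open>\<bar>u (s n) x\<bar>\<close> as soon as
        \<open>\<rho> (s n) > 0\<close>, so the threshold \<open>R\<close> belonging to
        \<open>x\<close> is eventually passed.\<close>
      have "filterlim (\<lambda>n. \<bar>y (s n) x\<bar> * \<rho> (s n)) at_top sequentially"
        by (rule filterlim_tendsto_pos_mult_at_top[OF tendsto_rabs[OF yx] _ \<rho>s]) (use vx in simp)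
      then have "eventually (\<lambda>n. \<bar>y (s n) x\<bar> * \<rho> (s n) \<ge> R) sequentially"
        by (simp add: filterlim_at_top)
      moreover have "eventually (\<lambda>n. \<rho> (s n) > 0) sequentially"
        using \<rho>s by (simp add: filterlim_at_top_dense)
      ultimately have "eventually (\<lambda>n. (d\<^sup>2 - d'\<^sup>2) * (y (s n) x)\<^sup>2 \<le> F (s n) x) sequentially"
      proof eventually_elim
        case (elim n)
        have ux: "\<bar>y (s n) x\<bar> * \<rho> (s n) = \<bar>u (s n) x\<bar>" using elim(2) by (simp add: y_def abs_mult)
        have "\<bar>g x (u (s n) x)\<bar> \<le> d' * \<bar>u (s n) x\<bar>" using R elim(1) ux by simp
        then have "(1 / \<rho> (s n)) * \<bar>g x (u (s n) x)\<bar> \<le> (1 / \<rho> (s n)) * (d' * \<bar>u (s n) x\<bar>)"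
          using elim(2) by (intro mult_left_mono) auto
        then have "\<bar>((1 / \<rho> (s n)) *\<^sub>R G (s n)) x\<bar> \<le> d' * \<bar>y (s n) x\<bar>"
          using elim(2) by (simp add: G_def y_def abs_mult)
        from power_mono[OF this, of 2] have 1: "(((1 / \<rho> (s n)) *\<^sub>R G (s n)) x)\<^sup>2 \<le> d'\<^sup>2 * (y (s n) x)\<^sup>2"
          by (simp only: power2_abs power_mult_distrib abs_ge_zero)
        have "d * \<bar>y (s n) x\<bar> \<le> z (s n) x" using elim(2) by (simp add: z_def ay_def g0_def)
        from power_mono[OF this, of 2] have 2: "d\<^sup>2 * (y (s n) x)\<^sup>2 \<le> (z (s n) x)\<^sup>2"
          using d by (simp add: power_mult_distrib)
        show ?case using 1 2 by (simp add: F_def left_diff_distrib)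
      qed
      moreover have "(\<lambda>n. (d\<^sup>2 - d'\<^sup>2) * (y (s n) x)\<^sup>2) \<longlonglongrightarrow> (d\<^sup>2 - d'\<^sup>2) * (v x)\<^sup>2"
        by (intro tendsto_intros yx)
      ultimately have "(d\<^sup>2 - d'\<^sup>2) * (v x)\<^sup>2 \<le> 0"
        using Fx by (intro tendsto_le[OF sequentially_bot]) auto
      moreover have "d'\<^sup>2 < d\<^sup>2" using d' by (intro power_strict_mono) auto
      ultimately show False using vx by (simp add: mult_le_0_iff)
    qed
  qed
  then have "L2_ip M v v = (\<integral>x. 0 \<partial>M)"
    unfolding L2_ip_def using L2_measurable[OF v] by (intro integral_cong_AE) auto
  then have nv: "H.nrm v = 0" by (simp add: H.nrm_def)
  \<comment> \<open>\<open>v\<close> is null and yet a limit of vectors \<open>y n\<close> that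
    eventually have norm 1; one index suffices for the contradiction.\<close>
  have "eventually (\<lambda>n. (\<integral>x. ((y n - v) x)\<^sup>2 \<partial>M) < 1) sequentially"
    using yv by (intro order_tendstoD(2)) auto
  then have "eventually (\<lambda>n. (\<integral>x. ((y n - v) x)\<^sup>2 \<partial>M) < 1 \<and> \<rho> n > 0) sequentially"
    using ev_pos by eventually_elim simp
  then obtain n where n: "(\<integral>x. ((y n - v) x)\<^sup>2 \<partial>M) < 1" "\<rho> n > 0"
    using eventually_happens'[OF sequentially_bot] by blast
  have "H.nrm (y n) = 1" using n(2) u by (simp add: y_def H.nrm_scale \<rho>_def[symmetric])
  then have "1 \<le> H.nrm (y n - v)" using H.nrm_le_add_diff[OF y[of n] v] nv by simp
  moreover have "H.nrm (y n - v) = sqrt (\<integral>x. ((y n - v) x)\<^sup>2 \<partial>M)"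
    by (simp add: H.nrm_def L2_ip_def power2_eq_square)
  ultimately show False using real_sqrt_less_mono[OF n(1)] by simp
qed

end

section \<open>The solution operator and the weak solution\<close>

context fractional_setting
begin

text \<open>A weak inverse of the operator of \<open>ipZ\<close>. Weak solutions for the same
  \<open>w\<close> differ by a function of energy 0, so the choice is harmless, but it guarantees
  linearity only modulo null functions.\<close>

definition solution_operator :: "(real ^ 'n \<Rightarrow> real) \<Rightarrow> real ^ 'n \<Rightarrow> real" where
  "solution_operator w = (SOME u. u \<in> Z \<and> (\<forall>\<phi>\<in>Z. ipZ u \<phi> = L2_ip M\<Omega> w \<phi>))"

lemma solution_operator:
  assumes w: "w \<in> L2 M\<Omega>"
  shows "solution_operator w \<in> Z" and "\<And>\<phi>. \<phi> \<in> Z \<Longrightarrow> ipZ (solution_operator w) \<phi> = L2_ip M\<Omega> w \<phi>"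
proof -
  interpret H: semi_hilbert "L2 M\<Omega>" "L2_ip M\<Omega>" by (rule finite_measure.semi_hilbert_L2[OF finite_M\<Omega>])
  interpret HZ: semi_hilbert Z ipZ by (rule semi_hilbert_Z)
  obtain C where C: "C > 0" and poinc: "\<And>u. u \<in> Z \<Longrightarrow> L2_ip M\<Omega> u u \<le> C * ipZ u u"
    using poincare by blast
  have "\<exists>u\<in>Z. \<forall>\<phi>\<in>Z. ipZ u \<phi> = L2_ip M\<Omega> w \<phi>"
  proof (rule HZ.riesz)
    show "L2_ip M\<Omega> w (u + v) = L2_ip M\<Omega> w u + L2_ip M\<Omega> w v" if "u \<in> Z" "v \<in> Z" for u v
      using that w Z_L2 by (intro H.ip_add_right) auto
    show "L2_ip M\<Omega> w (r *\<^sub>R u) = r * L2_ip M\<Omega> w u" if "u \<in> Z" for r u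
      using that w Z_L2 by (intro H.ip_scale_right) auto
    show "\<bar>L2_ip M\<Omega> w v\<bar> \<le> (H.nrm w * sqrt C) * HZ.nrm v" if v: "v \<in> Z" for v
    proof -
      have "H.nrm v \<le> sqrt C * HZ.nrm v"
        unfolding H.nrm_def HZ.nrm_def real_sqrt_mult[symmetric] by (intro real_sqrt_le_mono poinc v)
      then have "H.nrm w * H.nrm v \<le> H.nrm w * (sqrt C * HZ.nrm v)" using w by (intro mult_left_mono) auto
      then show ?thesis using H.cauchy_schwarz[OF w Z_L2[OF v]] by simp
    qed
  qed
  then have "\<exists>u. u \<in> Z \<and> (\<forall>\<phi>\<in>Z. ipZ u \<phi> = L2_ip M\<Omega> w \<phi>)" by blast
  from someI_ex[OF this] show "solution_operator w \<in> Z"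
    "\<And>\<phi>. \<phi> \<in> Z \<Longrightarrow> ipZ (solution_operator w) \<phi> = L2_ip M\<Omega> w \<phi>"
    by (auto simp: solution_operator_def)
qed

text \<open>Symmetry holds because both sides equal the energy product of the two images. Testing
  the equation with its own solution bounds the energy; Poincare then gives boundedness and the
  embedding of \<open>Z\<close> gives compactness.\<close>

lemma compact_selfadjoint_solution_operator:
  "\<exists>\<kappa>. compact_selfadjoint (L2 M\<Omega>) (L2_ip M\<Omega>) solution_operator \<kappa>"
proof -
  interpret H: semi_hilbert "L2 M\<Omega>" "L2_ip M\<Omega>" by (rule finite_measure.semi_hilbert_L2[OF finite_M\<Omega>])
  let ?S = solution_operator
  obtain C where C: "C > 0" and poinc: "\<And>u. u \<in> Z \<Longrightarrow> L2_ip M\<Omega> u u \<le> C * ipZ u u"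
    using poincare by blast
  have S_in: "?S v \<in> L2 M\<Omega>" if "v \<in> L2 M\<Omega>" for v using solution_operator(1)[OF that] by (rule Z_L2)
  have energy: "ipZ (?S v) (?S v) = L2_ip M\<Omega> v (?S v)" if "v \<in> L2 M\<Omega>" for v
    using solution_operator[OF that] by blast
  have bound: "H.nrm (?S v) \<le> C * H.nrm v" if v: "v \<in> L2 M\<Omega>" for v
  proof -
    have "(H.nrm (?S v))\<^sup>2 \<le> C * L2_ip M\<Omega> v (?S v)"
      using poinc[OF solution_operator(1)[OF v]] S_in[OF v] by (simp add: H.nrm_squared energy[OF v])
    also have "\<dots> \<le> C * (H.nrm v * H.nrm (?S v))"
      using H.cauchy_schwarz[OF v S_in[OF v]] C by (intro mult_left_mono) auto
    finally have "H.nrm (?S v) * H.nrm (?S v) \<le> (C * H.nrm v) * H.nrm (?S v)"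
      by (simp add: power2_eq_square mult.assoc)
    then show ?thesis
      using H.nrm_nonneg[OF S_in[OF v]] H.nrm_nonneg[OF v] C
      by (cases "H.nrm (?S v) = 0") (auto simp: mult_le_cancel_right)
  qed
  have "compact_selfadjoint (L2 M\<Omega>) (L2_ip M\<Omega>) ?S C"
  proof
    show "?S v \<in> L2 M\<Omega>" if "v \<in> L2 M\<Omega>" for v using that by (rule S_in)
    show "L2_ip M\<Omega> (?S u) v = L2_ip M\<Omega> u (?S v)" if u: "u \<in> L2 M\<Omega>" and v: "v \<in> L2 M\<Omega>" for u v
    proof -
      have "L2_ip M\<Omega> (?S u) v = L2_ip M\<Omega> v (?S u)" using u v S_in by (intro H.ip_commute) auto
      also have "\<dots> = ipZ (?S v) (?S u)" using solution_operator(2)[OF v solution_operator(1)[OF u]] by simp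
      also have "\<dots> = ipZ (?S u) (?S v)" by (rule ipZ_commute)
      also have "\<dots> = L2_ip M\<Omega> u (?S v)" by (rule solution_operator(2)[OF u solution_operator(1)[OF v]])
      finally show ?thesis .
    qed
    show "H.nrm (?S v) \<le> C * H.nrm v" if "v \<in> L2 M\<Omega>" for v using that by (rule bound)
    show "0 < C" by (rule C)
    fix w :: "nat \<Rightarrow> real ^ 'n \<Rightarrow> real" and M
    assume w: "\<And>n. w n \<in> L2 M\<Omega>" and M: "\<And>n. H.nrm (w n) \<le> M"
    have M0: "M \<ge> 0" using H.nrm_nonneg[OF w[of 0]] M[of 0] by linarith
    have "ipZ (?S (w n)) (?S (w n)) \<le> M * (C * M)" for n
    proof -
      have "ipZ (?S (w n)) (?S (w n)) \<le> H.nrm (w n) * H.nrm (?S (w n))"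
        unfolding energy[OF w] using H.cauchy_schwarz[OF w S_in[OF w], of n n] by linarith
      also have "\<dots> \<le> M * (C * M)"
      proof (rule mult_mono)
        show "H.nrm (?S (w n)) \<le> C * M" using bound[OF w, of n] mult_left_mono[OF M[of n] less_imp_le[OF C]] by linarith
      qed (rule M M0 H.nrm_nonneg[OF S_in[OF w]])+
      finally show ?thesis .
    qed
    then have "\<exists>r l. strict_mono (r :: nat \<Rightarrow> nat) \<and> l \<in> L2 M\<Omega> \<and>
        (\<lambda>n. L2_ip M\<Omega> (?S (w (r n)) - l) (?S (w (r n)) - l)) \<longlonglongrightarrow> 0"
      by (rule Z_compact_embedding[of "\<lambda>n. ?S (w n)", OF solution_operator(1)[OF w]])
    then obtain r l where r: "strict_mono (r :: nat \<Rightarrow> nat)" and l: "l \<in> L2 M\<Omega>"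
      and lim: "(\<lambda>n. L2_ip M\<Omega> (?S (w (r n)) - l) (?S (w (r n)) - l)) \<longlonglongrightarrow> 0" by blast
    have "(\<lambda>n. H.nrm (?S (w (r n)) - l)) \<longlonglongrightarrow> 0"
      unfolding H.nrm_def using tendsto_real_sqrt[OF lim] by simp
    then show "\<exists>r l. strict_mono (r :: nat \<Rightarrow> nat) \<and> l \<in> L2 M\<Omega> \<and> (\<lambda>n. H.nrm (?S (w (r n)) - l)) \<longlonglongrightarrow> 0"
      using r l by blast
  qed
  then show ?thesis by blast
qed

section \<open>Eigenvalues and the spectral gap of the solution operator\<close>

lemma Z_null:
  assumes u: "u \<in> Z" and "L2_ip M\<Omega> u u = 0"
  shows "AE x in lebesgue. u x = 0"
proof -
  have "(\<integral>x. (u x)\<^sup>2 \<partial>lebesgue) = 0" using Z_sq_integrable(2)[OF u] assms(2) by simp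
  then have "AE x in lebesgue. (u x)\<^sup>2 = 0"
    using integral_nonneg_eq_0_iff_AE[OF Z_sq_integrable(1)[OF u]] by simp
  then show ?thesis by eventually_elim simp
qed

lemma eigenvalue_pos:
  assumes "is_eigenvalue \<Omega> K \<mu>"
  shows "\<mu> > 0"
proof -
  obtain e where e: "e \<in> Z" "\<And>\<phi>. \<phi> \<in> Z \<Longrightarrow> ipZ e \<phi> = \<mu> * L2_ip M\<Omega> e \<phi>" and nz: "\<not> (AE x in lebesgue. e x = 0)"
    using assms unfolding is_eigenvalue_def eigenspace_def L2_ip_def by auto
  have "L2_ip M\<Omega> e e \<noteq> 0" using Z_null[OF e(1)] nz by blast
  moreover have "L2_ip M\<Omega> e e \<ge> 0" by (simp add: L2_ip_def)
  ultimately have pos: "L2_ip M\<Omega> e e > 0" by simp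
  obtain C where C: "C > 0" and poinc: "\<And>u. u \<in> Z \<Longrightarrow> L2_ip M\<Omega> u u \<le> C * ipZ u u"
    using poincare by blast
  have "0 < C * (\<mu> * L2_ip M\<Omega> e e)" using poinc[OF e(1)] pos unfolding e(2)[OF e(1)] by linarith
  then show ?thesis using C pos by (simp add: zero_less_mult_iff)
qed

lemma spectral_gap_solution_operator:
  assumes "compact_selfadjoint (L2 M\<Omega>) (L2_ip M\<Omega>) solution_operator \<kappa>"
    and seq: "eigenvalue_sequence \<Omega> K lam" and k: "k \<ge> 1" and less: "lam k < lam (k + 1)"
  shows "spectral_gap (L2 M\<Omega>) (L2_ip M\<Omega>) solution_operator \<kappa> (lam k) (lam (k + 1))"
proof -
  interpret compact_selfadjoint "L2 M\<Omega>" "L2_ip M\<Omega>" solution_operator \<kappa> by (rule assms(1))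
  show ?thesis
  proof
    show "0 < lam k" using seq k by (intro eigenvalue_pos) (simp add: eigenvalue_sequence_def)
    show "lam k < lam (k + 1)" by (rule less)
    fix s w
    assume w: "w \<in> L2 M\<Omega>" and neg: "(1 - lam k * s) * (1 - lam (k + 1) * s) < 0"
      and eig: "nrm (solution_operator w - s *\<^sub>R w) = 0"
    show "nrm w = 0"
    proof (rule ccontr)
      assume nw: "nrm w \<noteq> 0"
      \<comment> \<open>For \<open>s = 0\<close> the product in \<open>neg\<close> would be
        1.\<close>
      have s: "s \<noteq> 0" using neg by auto
      \<comment> \<open>\<open>w\<close> is merely in \<open>L2\<close>. Its image lies in
        \<open>Z\<close>, agrees with \<open>s\<close> times \<open>w\<close> up to length 0, and is
        therefore the eigenfunction, with eigenvalue \<open>1 / s\<close>.\<close>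
      let ?e = "solution_operator w"
      have e: "?e \<in> Z" by (rule solution_operator(1)[OF w])
      have eL: "?e \<in> L2 M\<Omega>" by (rule Z_L2[OF e])
      have ip_e: "L2_ip M\<Omega> ?e \<phi> = s * L2_ip M\<Omega> w \<phi>" if "\<phi> \<in> L2 M\<Omega>" for \<phi>
        using ip_cong_null[OF eL scale_in[OF w] that eig] w that by (simp add: ip_scale_left)
      have "ipZ ?e \<phi> = 1 / s * L2_ip M\<Omega> ?e \<phi>" if "\<phi> \<in> Z" for \<phi>
        using solution_operator(2)[OF w that] ip_e[OF Z_L2[OF that]] s by simp
      then have "?e \<in> eigenspace \<Omega> K (1 / s)" using e by (simp add: eigenspace_def L2_ip_def)
      moreover have "\<not> (AE x in lebesgue. ?e x = 0)"
      proof
        assume "AE x in lebesgue. ?e x = 0"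
        then have ae: "AE x in M\<Omega>. ?e x = 0" by (auto simp: AE_restrict_space_iff elim: eventually_mono)
        have "L2_ip M\<Omega> ?e ?e = (\<integral>x. 0 \<partial>M\<Omega>)"
          unfolding L2_ip_def using ae L2_measurable[OF eL] by (intro integral_cong_AE) auto
        then have "nrm ?e = 0" by (simp add: nrm_def)
        then have "nrm (s *\<^sub>R w) = 0" using nrm_cong_null[OF eL scale_in[OF w] eig] by simp
        then show False using nw s w by (simp add: nrm_scale)
      qed
      ultimately have "is_eigenvalue \<Omega> K (1 / s)" unfolding is_eigenvalue_def by blast
      moreover have "lam k < 1 / s \<and> 1 / s < lam (k + 1)"
      proof -
        have "(1 / s - lam k) * (1 / s - lam (k + 1)) = (1 / s)\<^sup>2 * ((1 - lam k * s) * (1 - lam (k + 1) * s))"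
          using s by (simp add: power2_eq_square field_simps)
        also have "\<dots> < 0" by (intro mult_pos_neg neg) (use s in simp)
        finally show ?thesis using less by (auto simp: mult_less_0_iff)
      qed
      ultimately show False using eigenvalue_sequence_gap[OF seq _ k] by blast
    qed
  qed
qed

section \<open>The semilinear equation inside a single gap\<close>

lemma unique_weak_solution:
  fixes f :: "real ^ 'n \<Rightarrow> real \<Rightarrow> real"
  assumes car: "caratheodory \<Omega> f"
    and a: "a \<in> L2 M\<Omega>"
    and growth: "AE x in M\<Omega>. \<forall>t. \<bar>f x t\<bar> \<le> a x + b * \<bar>t\<bar>"
    and seq: "eigenvalue_sequence \<Omega> K lam" and k: "k \<ge> 1"
    and slope: "AE x in M\<Omega>. \<forall>s t. s \<noteq> t \<longrightarrow>
        lam k < (f x s - f x t) / (s - t) \<and> (f x s - f x t) / (s - t) < lam (k + 1)"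
    and alpha: "AE x in M\<Omega>. ereal (lam k) < alpha_lower f x \<and>
        alpha_lower f x \<le> alpha_upper f x \<and> alpha_upper f x < ereal (lam (k + 1))"
  shows "\<exists>u. weak_solution \<Omega> K f u \<and> (\<forall>v. weak_solution \<Omega> K f v \<longrightarrow> (AE x in lebesgue. v x = u x))"
proof -
  interpret MO: finite_measure M\<Omega> by (rule finite_M\<Omega>)
  obtain x0 where "\<forall>s t. s \<noteq> t \<longrightarrow> lam k < (f x0 s - f x0 t) / (s - t) \<and> (f x0 s - f x0 t) / (s - t) < lam (k + 1)"
    using AE_lebesgue_on_ex[OF \<Omega>_sets \<Omega>_measure_pos slope] by blast
  then have less: "lam k < lam (k + 1)" using zero_neq_one by (meson order.strict_trans)
  obtain \<kappa> where cs: "compact_selfadjoint (L2 M\<Omega>) (L2_ip M\<Omega>) solution_operator \<kappa>"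
    using compact_selfadjoint_solution_operator by blast
  interpret spectral_gap "L2 M\<Omega>" "L2_ip M\<Omega>" solution_operator \<kappa> "lam k" "lam (k + 1)"
    by (rule spectral_gap_solution_operator[OF cs seq k less])
  define d where "d = half_gap"
  have d: "d > 0" using half_gap_pos by (simp add: d_def)
  define F where "F u = (\<lambda>x. f x (u x))" for u
  define g where "g x t = f x t - mid * t" for x t
  define G where "G u = (\<lambda>x. g x (u x))" for u :: "real ^ 'n \<Rightarrow> real"
  have F_in: "F u \<in> L2 M\<Omega>" if u: "u \<in> L2 M\<Omega>" for u
  proof (rule L2_I_bound)
    show "F u \<in> borel_measurable M\<Omega>"
      unfolding F_def by (rule caratheodory_measurable[OF car \<Omega>_sets L2_measurable[OF u]])
    show "(\<lambda>x. \<bar>a x\<bar> + \<bar>b\<bar> * \<bar>u x\<bar>) \<in> L2 M\<Omega>" using a u by (intro L2_add L2_cmult L2_abs)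
    show "AE x in M\<Omega>. \<bar>F u x\<bar> \<le> \<bar>\<bar>a x\<bar> + \<bar>b\<bar> * \<bar>u x\<bar>\<bar>"
      using growth
    proof eventually_elim
      case (elim x)
      have "b * \<bar>u x\<bar> \<le> \<bar>b\<bar> * \<bar>u x\<bar>" by (intro mult_right_mono) auto
      then show ?case using elim[rule_format, of "u x"] by (simp add: F_def)
    qed
  qed
  have G_eq: "G u = F u - mid *\<^sub>R u" for u by (rule ext) (simp add: G_def F_def g_def)
  have G_in: "G u \<in> L2 M\<Omega>" if "u \<in> L2 M\<Omega>" for u unfolding G_eq using F_in that by auto
  have strict: "AE x in M\<Omega>. \<forall>s t. s \<noteq> t \<longrightarrow> \<bar>g x s - g x t\<bar> < d * \<bar>s - t\<bar>"
    using slope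
  proof eventually_elim
    case (elim x)
    show ?case
    proof (intro allI impI)
      fix s t :: real assume st: "s \<noteq> t"
      have "\<bar>q - mid\<bar> < d" if "lam k < q" "q < lam (k + 1)" for q
        using that unfolding d_def mid_def half_gap_def abs_less_iff by (simp add: field_simps)
      then have "\<bar>(f x s - f x t) / (s - t) - mid\<bar> < d" using elim[rule_format, OF st] by blast
      then have "\<bar>(f x s - f x t) / (s - t) - mid\<bar> * \<bar>s - t\<bar> < d * \<bar>s - t\<bar>"
        using st by (intro mult_strict_right_mono) auto
      moreover have "((f x s - f x t) / (s - t) - mid) * (s - t) = g x s - g x t"
      proof -
        have "(f x s - f x t) / (s - t) * (s - t) = f x s - f x t" using st by simp
        then show ?thesis unfolding left_diff_distrib g_def by (simp only: right_diff_distrib)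
      qed
      ultimately show "\<bar>g x s - g x t\<bar> < d * \<bar>s - t\<bar>" by (simp only: abs_mult[symmetric])
    qed
  qed
  have lip: "AE x in M\<Omega>. \<forall>s t. \<bar>g x s - g x t\<bar> \<le> d * \<bar>s - t\<bar>"
    using strict
  proof eventually_elim
    case (elim x)
    have "\<bar>g x s - g x t\<bar> \<le> d * \<bar>s - t\<bar>" for s t
      by (cases "s = t") (use elim[rule_format, of s t] in auto)
    then show ?case by blast
  qed
  \<comment> \<open>The pointwise defect of the Lipschitz estimate integrates to a difference of
    squared norms. Its sign gives \<open>G_lip\<close>; when the integral is 0 the defect vanishes
    almost everywhere, which \<open>strict\<close> permits only where the two functions
    agree.\<close>
  have defect: "integrable M\<Omega> (\<lambda>x. d\<^sup>2 * (u x - v x)\<^sup>2 - (G u x - G v x)\<^sup>2)"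
    "(\<integral>x. d\<^sup>2 * (u x - v x)\<^sup>2 - (G u x - G v x)\<^sup>2 \<partial>M\<Omega>) = d\<^sup>2 * (nrm (u - v))\<^sup>2 - (nrm (G u - G v))\<^sup>2"
    "AE x in M\<Omega>. 0 \<le> d\<^sup>2 * (u x - v x)\<^sup>2 - (G u x - G v x)\<^sup>2"
    if u: "u \<in> L2 M\<Omega>" and v: "v \<in> L2 M\<Omega>" for u v
  proof -
    have 1: "integrable M\<Omega> (\<lambda>x. (u x - v x)\<^sup>2)" and 2: "integrable M\<Omega> (\<lambda>x. (G u x - G v x)\<^sup>2)"
      using L2_integrable_sq[OF L2_diff[OF u v]] L2_integrable_sq[OF L2_diff[OF G_in[OF u] G_in[OF v]]] by auto
    then show "integrable M\<Omega> (\<lambda>x. d\<^sup>2 * (u x - v x)\<^sup>2 - (G u x - G v x)\<^sup>2)" by auto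
    have "(nrm (u - v))\<^sup>2 = (\<integral>x. (u x - v x)\<^sup>2 \<partial>M\<Omega>)" "(nrm (G u - G v))\<^sup>2 = (\<integral>x. (G u x - G v x)\<^sup>2 \<partial>M\<Omega>)"
      using nrm_squared[OF diff_in[OF u v]] nrm_squared[OF diff_in[OF G_in[OF u] G_in[OF v]]]
      by (simp_all add: L2_ip_def power2_eq_square)
    then show "(\<integral>x. d\<^sup>2 * (u x - v x)\<^sup>2 - (G u x - G v x)\<^sup>2 \<partial>M\<Omega>) = d\<^sup>2 * (nrm (u - v))\<^sup>2 - (nrm (G u - G v))\<^sup>2"
      using 1 2 by simp
    show "AE x in M\<Omega>. 0 \<le> d\<^sup>2 * (u x - v x)\<^sup>2 - (G u x - G v x)\<^sup>2"
      using lip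
    proof eventually_elim
      case (elim x)
      have "\<bar>G u x - G v x\<bar> \<le> d * \<bar>u x - v x\<bar>" using elim by (simp add: G_def)
      from power_mono[OF this, of 2] show ?case
        by (simp only: power2_abs power_mult_distrib abs_ge_zero diff_ge_0_iff_ge)
    qed
  qed
  have G_lip: "nrm (G u - G v) \<le> half_gap * nrm (u - v)" if u: "u \<in> L2 M\<Omega>" and v: "v \<in> L2 M\<Omega>" for u v
  proof (rule power2_le_imp_le)
    have "0 \<le> d\<^sup>2 * (nrm (u - v))\<^sup>2 - (nrm (G u - G v))\<^sup>2"
      unfolding defect(2)[OF u v, symmetric] by (rule integral_nonneg_AE[OF defect(3)[OF u v]])
    then show "(nrm (G u - G v))\<^sup>2 \<le> (half_gap * nrm (u - v))\<^sup>2" by (simp add: d_def power_mult_distrib)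
    show "0 \<le> half_gap * nrm (u - v)" using half_gap_pos u v by (intro mult_nonneg_nonneg nrm_nonneg) auto
  qed
  have asym: "AE x in M\<Omega>. \<exists>d' R. 0 \<le> d' \<and> d' < d \<and> (\<forall>t. \<bar>t\<bar> \<ge> R \<longrightarrow> \<bar>g x t\<bar> \<le> d' * \<bar>t\<bar>)"
    using alpha
  proof eventually_elim
    case (elim x)
    then show ?case
      unfolding d_def half_gap_def mid_def g_def
      using asymptotic_slope_bound[of "lam k" f x "lam (k + 1)"] by blast
  qed
  have "\<exists>u\<in>L2 M\<Omega>. solves u (G u)"
  proof (rule nonlinear_solution)
    fix u :: "nat \<Rightarrow> real ^ 'n \<Rightarrow> real" and v
    assume u: "\<And>n. u n \<in> L2 M\<Omega>" and v: "v \<in> L2 M\<Omega>"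
      and top: "filterlim (\<lambda>n. nrm (u n)) at_top sequentially"
      and lim: "(\<lambda>n. nrm ((1 / nrm (u n)) *\<^sub>R u n - v)) \<longlonglongrightarrow> 0"
      and big: "\<And>n. half_gap * nrm (u n) \<le> nrm (G (u n))"
    show False
    proof (rule MO.nonresonance[OF u v d _ lip asym])
      show "(\<lambda>x. g x (w x)) \<in> L2 M\<Omega>" if "w \<in> L2 M\<Omega>" for w using G_in[OF that] by (simp add: G_def)
      show "filterlim (\<lambda>n. sqrt (L2_ip M\<Omega> (u n) (u n))) at_top sequentially" using top by (simp add: nrm_def)
      show "d * sqrt (L2_ip M\<Omega> (u n) (u n)) \<le> sqrt (L2_ip M\<Omega> (\<lambda>x. g x (u n x)) (\<lambda>x. g x (u n x)))" for n
        using big[of n] by (simp add: d_def nrm_def G_def)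
      have "(nrm ((1 / nrm (u n)) *\<^sub>R u n - v))\<^sup>2 = (\<integral>x. (u n x / sqrt (L2_ip M\<Omega> (u n) (u n)) - v x)\<^sup>2 \<partial>M\<Omega>)" for n
        using u v by (subst nrm_squared) (auto simp: L2_ip_def power2_eq_square nrm_def)
      then show "(\<lambda>n. \<integral>x. (u n x / sqrt (L2_ip M\<Omega> (u n) (u n)) - v x)\<^sup>2 \<partial>M\<Omega>) \<longlonglongrightarrow> 0"
        using tendsto_power[OF lim, of 2] by simp
    qed
  qed (use G_in G_lip in auto)
  then obtain u0 where u0: "u0 \<in> L2 M\<Omega>" and sol0: "solves u0 (G u0)" by blast
  have midG: "mid *\<^sub>R u + G u = F u" for u by (simp add: G_eq)
  \<comment> \<open>\<open>u0\<close> is only an \<open>L2\<close> function with arbitrary values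
    off \<Omega>. This representative lies in \<open>Z\<close> and agrees with \<open>u0\<close>
    almost everywhere on \<Omega>, so \<open>F\<close> takes the same values there.\<close>
  define u where "u = solution_operator (F u0)"
  have uZ: "u \<in> Z" unfolding u_def by (rule solution_operator(1)[OF F_in[OF u0]])
  have uL: "u \<in> L2 M\<Omega>" by (rule Z_L2[OF uZ])
  have "nrm (u0 - u) = 0" using sol0 unfolding solves_def midG u_def .
  then have "(\<integral>x. (u0 x - u x)\<^sup>2 \<partial>M\<Omega>) = 0"
    using nrm_squared[OF diff_in[OF u0 uL]] by (simp add: L2_ip_def power2_eq_square)
  then have "AE x in M\<Omega>. (u0 x - u x)\<^sup>2 = 0"
    using integral_nonneg_eq_0_iff_AE[OF L2_integrable_sq[OF L2_diff[OF u0 uL]]] by simp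
  then have u0_eq: "AE x in M\<Omega>. u0 x = u x" by eventually_elim simp
  have weak_iff: "weak_solution \<Omega> K f v \<longleftrightarrow> v \<in> Z \<and> (\<forall>\<phi>\<in>Z. ipZ v \<phi> = L2_ip M\<Omega> (F v) \<phi>)" for v
    by (simp add: weak_solution_def inner_Z_def L2_ip_def F_def)
  have weak_u: "weak_solution \<Omega> K f u"
    unfolding weak_iff
  proof (intro conjI ballI)
    fix \<phi> assume \<phi>: "\<phi> \<in> Z"
    have "ipZ u \<phi> = L2_ip M\<Omega> (F u0) \<phi>" unfolding u_def by (rule solution_operator(2)[OF F_in[OF u0] \<phi>])
    also have "\<dots> = L2_ip M\<Omega> (F u) \<phi>"
      unfolding L2_ip_def
    proof (rule integral_cong_AE)
      show "(\<lambda>x. F u0 x * \<phi> x) \<in> borel_measurable M\<Omega>" "(\<lambda>x. F u x * \<phi> x) \<in> borel_measurable M\<Omega>"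
        using L2_measurable[OF F_in[OF u0]] L2_measurable[OF F_in[OF uL]] L2_measurable[OF Z_L2[OF \<phi>]] by auto
      show "AE x in M\<Omega>. F u0 x * \<phi> x = F u x * \<phi> x" using u0_eq by eventually_elim (simp add: F_def)
    qed
    finally show "ipZ u \<phi> = L2_ip M\<Omega> (F u) \<phi>" .
  qed (rule uZ)
  have solves_weak: "v \<in> Z \<and> solves v (G v)" if "weak_solution \<Omega> K f v" for v
  proof -
    have v: "v \<in> Z" and eq: "\<And>\<phi>. \<phi> \<in> Z \<Longrightarrow> ipZ v \<phi> = L2_ip M\<Omega> (F v) \<phi>" using that by (auto simp: weak_iff)
    \<comment> \<open>The energy of this difference is 0 by testing both equations with it, and
      Poincare turns that into length 0 in \<open>L2\<close>.\<close>
    let ?w = "v - solution_operator (F v)"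
    have S: "solution_operator (F v) \<in> Z" by (rule solution_operator(1)[OF F_in[OF Z_L2[OF v]]])
    have w: "?w \<in> Z" by (rule Z_diff[OF v S])
    have "ipZ ?w ?w = ipZ v ?w - ipZ (solution_operator (F v)) ?w"
      by (intro ipZ_diff_left Z_subset_X v S w)
    also have "\<dots> = 0" using eq[OF w] solution_operator(2)[OF F_in[OF Z_L2[OF v]] w] by simp
    finally have "L2_ip M\<Omega> ?w ?w \<le> 0" using poincare w by (metis mult_zero_right)
    moreover have "L2_ip M\<Omega> ?w ?w \<ge> 0" by (rule ip_nonneg[OF Z_L2[OF w]])
    ultimately have "nrm ?w = 0" unfolding nrm_def by simp
    then have "solves v (G v)" unfolding solves_def midG .
    then show ?thesis using v by blast
  qed
  have "AE x in lebesgue. v x = u x" if "weak_solution \<Omega> K f v" for v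
  proof -
    have v: "v \<in> Z" and sv: "solves v (G v)" using solves_weak[OF that] by auto
    have su: "solves u (G u)" using solves_weak[OF weak_u] by auto
    have vL: "v \<in> L2 M\<Omega>" by (rule Z_L2[OF v])
    \<comment> \<open>The gap gives this inequality and the Lipschitz estimate its converse, so the
      defect integrates to 0.\<close>
    have "d * nrm (v - u) \<le> nrm (G v - G u)"
      unfolding d_def using uL vL sv su G_in by (intro solves_bound solves_diff) auto
    then have "(d * nrm (v - u))\<^sup>2 \<le> (nrm (G v - G u))\<^sup>2"
      using d uL vL by (intro power_mono mult_nonneg_nonneg nrm_nonneg) auto
    then have "(\<integral>x. d\<^sup>2 * (v x - u x)\<^sup>2 - (G v x - G u x)\<^sup>2 \<partial>M\<Omega>) \<le> 0"
      unfolding defect(2)[OF vL uL] by (simp add: power_mult_distrib)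
    moreover have "0 \<le> (\<integral>x. d\<^sup>2 * (v x - u x)\<^sup>2 - (G v x - G u x)\<^sup>2 \<partial>M\<Omega>)"
      by (rule integral_nonneg_AE[OF defect(3)[OF vL uL]])
    ultimately have "AE x in M\<Omega>. d\<^sup>2 * (v x - u x)\<^sup>2 - (G v x - G u x)\<^sup>2 = 0"
      using integral_nonneg_eq_0_iff_AE[OF defect(1)[OF vL uL] defect(3)[OF vL uL]] by simp
    then have "AE x in M\<Omega>. v x - u x = 0"
      using strict
    proof eventually_elim
      case (elim x)
      show ?case
      proof (rule ccontr)
        assume ne: "v x - u x \<noteq> 0"
        then have "\<bar>G v x - G u x\<bar> < d * \<bar>v x - u x\<bar>" using elim(2) by (simp add: G_def)
        from power_strict_mono[OF this, of 2] have "(G v x - G u x)\<^sup>2 < d\<^sup>2 * (v x - u x)\<^sup>2"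
          by (simp add: power_mult_distrib)
        then show False using elim(1) by simp
      qed
    qed
    then have "AE x in M\<Omega>. (v - u) x * (v - u) x = 0" by eventually_elim simp
    moreover have "(\<lambda>x. (v - u) x * (v - u) x) \<in> borel_measurable M\<Omega>"
      using L2_measurable[OF diff_in[OF vL uL]] by (intro borel_measurable_times)
    ultimately have "L2_ip M\<Omega> (v - u) (v - u) = (\<integral>x. 0 \<partial>M\<Omega>)"
      unfolding L2_ip_def by (intro integral_cong_AE) auto
    also have "\<dots> = 0" by simp
    finally have "AE x in lebesgue. (v - u) x = 0" by (rule Z_null[OF Z_diff[OF v uZ]])
    then show ?thesis by eventually_elim simp
  qed
  then show ?thesis using weak_u by blast
qed

end

section \<open>Identifying the two gaps\<close>

theorem corollary3:
  fixes \<Omega> :: "(real ^ 'n::finite) set"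
    and K :: "real ^ 'n \<Rightarrow> real"
    and \<theta> \<sigma> :: real
    and f :: "real ^ 'n \<Rightarrow> real \<Rightarrow> real"
    and a :: "real ^ 'n \<Rightarrow> real"
    and b :: real
    and lam :: "nat \<Rightarrow> real"
  assumes "\<Omega> \<noteq> {}" and "open \<Omega>" and "bounded \<Omega>"
    and "K \<in> borel_measurable (lebesgue_on (- {0}))"
    and "\<And>x. x \<noteq> 0 \<Longrightarrow> K x > 0"
    and "integrable lebesgue (\<lambda>x. min ((norm x)\<^sup>2) 1 * K x)"
    and "\<theta> > 0" and "0 < \<sigma>" and "\<sigma> < 1"
    and "\<And>x. x \<noteq> 0 \<Longrightarrow> K x \<ge> \<theta> * norm x powr (- (real CARD('n) + 2 * \<sigma>))"
    and "caratheodory \<Omega> f"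
    and "a \<in> borel_measurable (lebesgue_on \<Omega>)"
    and "integrable (lebesgue_on \<Omega>) (\<lambda>x. (a x)\<^sup>2)"
    and "b \<ge> 0"
    and "AE x in lebesgue_on \<Omega>. \<forall>t. \<bar>f x t\<bar> \<le> a x + b * \<bar>t\<bar>"
    and "eigenvalue_sequence \<Omega> K lam"
    and "(AE x in lebesgue_on \<Omega>. alpha_upper f x < ereal (lam 1)) \<or>
         (\<exists>h\<ge>1. AE x in lebesgue_on \<Omega>. ereal (lam h) < alpha_lower f x \<and>
            alpha_lower f x \<le> alpha_upper f x \<and> alpha_upper f x < ereal (lam (h + 1)))"
    and "\<exists>k\<ge>1. AE x in lebesgue_on \<Omega>. \<forall>s t. s \<noteq> t \<longrightarrow>
            lam k < (f x s - f x t) / (s - t) \<and> (f x s - f x t) / (s - t) < lam (k + 1)"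
  shows "\<exists>u. weak_solution \<Omega> K f u \<and>
            (\<forall>v. weak_solution \<Omega> K f v \<longrightarrow> (AE x in lebesgue. v x = u x))"
proof -
  interpret fractional_setting \<Omega> K \<theta> \<sigma>
    using assms(1-8,10) by unfold_locales auto
  obtain k where k: "k \<ge> 1" and slope: "AE x in M\<Omega>. \<forall>s t. s \<noteq> t \<longrightarrow>
            lam k < (f x s - f x t) / (s - t) \<and> (f x s - f x t) / (s - t) < lam (k + 1)"
    using assms(18) by blast
  have mono: "lam i \<le> lam j" if "1 \<le> i" "i \<le> j" for i j
    using assms(16) that by (simp add: eigenvalue_sequence_def)
  have bounds: "AE x in M\<Omega>. ereal (lam k) \<le> alpha_lower f x \<and> alpha_lower f x \<le> alpha_upper f x \<and>
      alpha_upper f x \<le> ereal (lam (k + 1))"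
    using slope
  proof eventually_elim
    case (elim x)
    then show ?case using slope_bounds_alpha[of "lam k" f x "lam (k + 1)"] by blast
  qed
  have "\<exists>h\<ge>1. AE x in M\<Omega>. ereal (lam h) < alpha_lower f x \<and>
            alpha_lower f x \<le> alpha_upper f x \<and> alpha_upper f x < ereal (lam (h + 1))"
    using assms(17)
  proof
    assume "AE x in M\<Omega>. alpha_upper f x < ereal (lam 1)"
    \<comment> \<open>\<open>lam k\<close> lies below the asymptotic slopes, and the first
      alternative puts these below \<open>lam 1\<close>, against monotonicity of
      \<open>lam\<close>.\<close>
    then have "AE x in M\<Omega>. ereal (lam k) < ereal (lam 1)"
      using bounds
    proof eventually_elim
      case (elim x)
      then have "ereal (lam k) \<le> alpha_upper f x" by (blast intro: order_trans)
      then show ?case using elim(1) by (rule le_less_trans)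
    qed
    then have "lam k < lam 1" using AE_lebesgue_on_ex[OF \<Omega>_sets \<Omega>_measure_pos] by auto
    then show ?thesis using mono[of 1 k] k by simp
  qed
  then obtain h where h: "h \<ge> 1" and alpha: "AE x in M\<Omega>. ereal (lam h) < alpha_lower f x \<and>
            alpha_lower f x \<le> alpha_upper f x \<and> alpha_upper f x < ereal (lam (h + 1))" by blast
  have "AE x in M\<Omega>. ereal (lam h) < ereal (lam (k + 1)) \<and> ereal (lam k) < ereal (lam (h + 1))"
    using alpha bounds
  proof eventually_elim
    case (elim x)
    have "ereal (lam h) < alpha_upper f x" using elim by (blast intro: less_le_trans)
    moreover have "ereal (lam k) \<le> alpha_upper f x" using elim by (blast intro: order_trans)
    ultimately show ?case using elim by (blast intro: less_le_trans le_less_trans)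
  qed
  then have "lam h < lam (k + 1)" "lam k < lam (h + 1)"
    using AE_lebesgue_on_ex[OF \<Omega>_sets \<Omega>_measure_pos] by auto
  \<comment> \<open>If \<open>h > k\<close> then \<open>lam (k + 1) \<le> lam h\<close>, and if
    \<open>k > h\<close> then \<open>lam (h + 1) \<le> lam k\<close>; each contradicts one of the
    two inequalities, even when \<open>lam\<close> has repetitions.\<close>
  then have "h = k"
    using mono[of "k + 1" h] mono[of "h + 1" k] h k by (metis Suc_eq_plus1 Suc_leI le_add2 not_le nat_neq_iff)
  then show ?thesis
    using assms(11-16) slope alpha k by (intro unique_weak_solution[where a = a and b = b and lam = lam]) (auto simp: L2_def)
qed

end
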